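(* Assume: (1) $\alpha_i>0$ for $i=1,2,3,4$ and $\tau_j>0$ for $j=1,2$; (2) $h\in C^0(\mathbb{R}^m;\mathbb{R}^m)$; (3) $\sigma$ is Lipschitz continuous and acts componentwise; (4) $\sigma(0)=0$; (5) $\mathcal{L}\ge 0$ and $\mathcal{L}$ is continuous in its first argument. Let $\{(x_s,y_s)\}_{s=1}^S\subset\mathbb{R}^d\times\mathbb{R}^m$ be any given set of training data ($S\ge1$). Then the following holds: 1. for every $n\in\mathbb{N}$ there exists a minimiser of $\mathcal{E}_n$ in $\Theta^{(n)}$; 2. any sequence $(K^{(n)},b^{(n)},W^{(n)},c^{(n)})\in\Theta^{(n)}$, $n\in\mathbb{N}$, with $\sup_{n\in\mathbb{N}}\mathcal{E}_n(K^{(n)},b^{(n)},W^{(n)},c^{(n)})<\infty$ is relatively compact (every subsequence has a further subsequence converging, with respect to $d$, to an element of $\Theta$); and 3. $\Gamma\text{-}\lim_{n\to\infty}\mathcal{E}_n=\mathcal{E}_\infty$.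
   Context: $\mathbb{N}=\{1,2,\dots\}$. Fix $d,m,S\in\mathbb{N}$, training data $\{(x_s,y_s)\}_{s=1}^S\subset\mathbb{R}^d\times\mathbb{R}^m$, functions $\sigma:\mathbb{R}^d\to\mathbb{R}^d$, $h:\mathbb{R}^m\to\mathbb{R}^m$, $\mathcal{L}:\mathbb{R}^m\times\mathbb{R}^m\to\mathbb{R}$, weights $\alpha_1,\dots,\alpha_4$ and $\tau_1,\tau_2$, and norms $\|\cdot\|$ on the finite-dimensional spaces $\mathbb{R}^d,\mathbb{R}^{d\times d},\mathbb{R}^{m\times d},\mathbb{R}^m$. "$\sigma$ acts componentwise" means $\sigma(x)=(\tilde\sigma(x_1),\dots,\tilde\sigma(x_d))^\top$ for some $\tilde\sigma:\mathbb{R}\to\mathbb{R}$. Parameter spaces. For $n\in\mathbb{N}$ let $\mu_n=\frac1n\sum_{i=0}^{n-1}\delta_{i/n}$; a function $K^{(n)}$ on $\{i/n\}_{i=0}^{n-1}$ is identified with the tuple $K^{(n)}_i=K^{(n)}(i/n)$, $i=0,\dots,n-1$. Set $\Theta^{(n)}=L^2(\mu_n;\mathbb{R}^{d\times d})\times L^2(\mu_n;\mathbb{R}^d)\times\mathbb{R}^{m\times d}\times\mathbb{R}^m$ and $\Theta=H^1([0,1];\mathbb{R}^{d\times d})\times H^1([0,1];\mathbb{R}^d)\times\mathbb{R}^{m\times d}\times\mathbb{R}^m$. $H^1$ functions are identified with their continuous representatives. Discrete functional. $X_i^{(n)}=X_i^{(n)}[x;K^{(n)},b^{(n)}]$ is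 defined by $X_0^{(n)}=x$ and $X_{i+1}^{(n)}=X_i^{(n)}+\frac1n\sigma(K_i^{(n)}X_i^{(n)}+b_i^{(n)})$, $i=0,\dots,n-1$. Then $E_n(K^{(n)},b^{(n)},W,c;x,y)=\mathcal{L}(h(WX_n^{(n)}[x;K^{(n)},b^{(n)}]+c),y)$, $R_n^{(1)}(K^{(n)})=n\sum_{i=1}^{n-1}\|K_i^{(n)}-K_{i-1}^{(n)}\|^2+\tau_1\|K_0^{(n)}\|^2$, $R_n^{(2)}(b^{(n)})=n\sum_{i=1}^{n-1}\|b_i^{(n)}-b_{i-1}^{(n)}\|^2+\tau_2\|b_0^{(n)}\|^2$, $R^{(3)}(W)=\|W\|^2$, $R^{(4)}(c)=\|c\|^2$, and $\mathcal{E}_n(K^{(n)},b^{(n)},W,c)=\sum_{s=1}^S E_n(K^{(n)},b^{(n)},W,c;x_s,y_s)+\alpha_1R_n^{(1)}(K^{(n)})+\alpha_2R_n^{(2)}(b^{(n)})+\alpha_3R^{(3)}(W)+\alpha_4R^{(4)}(c)$. Continuum functional. $X(\cdot;x,K,b):[0,1]\to\mathbb{R}^d$ solves $\dot X(t)=\sigma(K(t)X(t)+b(t))$, $X(0)=x$. Then $E_\infty(K,b,W,c;x,y)=\mathcal{L}(h(WX(1;x,K,b)+c),y)$, $R_\infty^{(1)}(K)=\|\dot K\|_{L^2}^2+\tau_1\|K(0)\|^2$, $R_\infty^{(2)}(b)=\|\dot b\|_{L^2}^2+\tau_2\|b(0)\|^2$, and $\mathcal{E}_\infty(K,b,W,c)=\sum_{s=1}^S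 E_\infty(K,b,W,c;x_s,y_s)+\alpha_1R_\infty^{(1)}(K)+\alpha_2R_\infty^{(2)}(b)+\alpha_3R^{(3)}(W)+\alpha_4R^{(4)}(c)$. Convergence. For $\theta^{(n)}=(K^{(n)},b^{(n)},W^{(n)},c^{(n)})\in\Theta^{(n)}$ and $\theta=(K,b,W,c)\in\Theta$, $d(\theta^{(n)},\theta)=\|\tilde K^{(n)}-K\|_{L^2}+\|\tilde b^{(n)}-b\|_{L^2}+\|W^{(n)}-W\|+\|c^{(n)}-c\|$, where $\tilde K^{(n)}(t)=K^{(n)}_{i-1}$ for $t\in(\frac{i-1}n,\frac in)$, $i=1,\dots,n$, and similarly $\tilde b^{(n)}$. $\theta^{(n)}\to\theta$ means $d(\theta^{(n)},\theta)\to0$. $\Gamma$-convergence. $\Gamma\text{-}\lim_{n\to\infty}\mathcal{E}_n=\mathcal{E}_\infty$ means that for all $\theta\in\Theta$: (i) for any sequence $\theta^{(n)}\in\Theta^{(n)}$ with $\theta^{(n)}\to\theta$, $\liminf_{n\to\infty}\mathcal{E}_n(\theta^{(n)})\ge\mathcal{E}_\infty(\theta)$; (ii) there exists a sequence $\theta^{(n)}\in\Theta^{(n)}$ with $\theta^{(n)}\to\theta$ and $\limsup_{n\to\infty}\mathcal{E}_n(\theta^{(n)})\le\mathcal{E}_\infty(\theta)$. *)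

theory Defs
  imports "HOL-Analysis.Analysis"
begin

definition is_norm :: "('a::real_vector \<Rightarrow> real) \<Rightarrow> bool" where
  "is_norm N \<longleftrightarrow>
     (\<forall>v. 0 \<le> N v) \<and> (\<forall>v. N v = 0 \<longleftrightarrow> v = 0) \<and>
     (\<forall>a v. N (a *\<^sub>R v) = \<bar>a\<bar> * N v) \<and> (\<forall>u v. N (u + v) \<le> N u + N v)"

definition acts_componentwise :: "(real^'d \<Rightarrow> real^'d) \<Rightarrow> bool" where
  "acts_componentwise f \<longleftrightarrow> (\<exists>g :: real \<Rightarrow> real. \<forall>x. f x = (\<chi> i. g (x $ i)))"

text \<open>Functions on \<open>[0,1]\<close> are total functions on the reals whose values outside \<open>[0,1]\<close> are
  never used. Membership in \<open>L\<^sup>2\<close> is expressed with the library norm; since the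
  value spaces are finite dimensional, any other norm gives the same set. The value of the
  \<open>L\<^sup>2\<close> norm does depend on the norm \<open>N\<close> chosen on the value space.\<close>

definition L2_space :: "(real \<Rightarrow> 'a::euclidean_space) set" where
  "L2_space = {f. f \<in> borel_measurable (lebesgue_on {0..1}) \<and>
                  integrable (lebesgue_on {0..1}) (\<lambda>t. (norm (f t))\<^sup>2)}"

definition L2_norm :: "('a \<Rightarrow> real) \<Rightarrow> (real \<Rightarrow> 'a::euclidean_space) \<Rightarrow> real" where
  "L2_norm N f = sqrt (integral\<^sup>L (lebesgue_on {0..1}) (\<lambda>t. (N (f t))\<^sup>2))"

text \<open>The test functions are those in \<open>C\<^sub>c\<^sup>\<infinity>\<close> of the open interval \<open>(0,1)\<close>; a closed subset
  of it is automatically compact.\<close>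

definition test_function :: "(real \<Rightarrow> real) \<Rightarrow> bool" where
  "test_function \<phi> \<longleftrightarrow>
     (\<forall>k t. (deriv ^^ k) \<phi> field_differentiable (at t)) \<and>
     closure {t. \<phi> t \<noteq> 0} \<subseteq> {0<..<1}"

definition has_weak_deriv ::
    "(real \<Rightarrow> 'a::euclidean_space) \<Rightarrow> (real \<Rightarrow> 'a) \<Rightarrow> bool" where
  "has_weak_deriv u g \<longleftrightarrow>
     g \<in> L2_space \<and>
     (\<forall>\<phi>. test_function \<phi> \<longrightarrow>
        integral\<^sup>L (lebesgue_on {0..1}) (\<lambda>t. deriv \<phi> t *\<^sub>R u t) =
        - integral\<^sup>L (lebesgue_on {0..1}) (\<lambda>t. \<phi> t *\<^sub>R g t))"

text \<open>Elements of \<open>H\<^sup>1\<close> are represented by their continuous representatives. The weak derivative is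
  determined only up to a null set, hence the choice operator below.\<close>

definition H1_space :: "(real \<Rightarrow> 'a::euclidean_space) set" where
  "H1_space = {u. u \<in> L2_space \<and> continuous_on {0..1} u \<and> (\<exists>g. has_weak_deriv u g)}"

definition weak_deriv :: "(real \<Rightarrow> 'a::euclidean_space) \<Rightarrow> real \<Rightarrow> 'a" where
  "weak_deriv u = (SOME g. has_weak_deriv u g)"

text \<open>The data fixed throughout: the activation \<open>\<sigma>\<close>, the output map \<open>h\<close>, the loss \<open>\<L>\<close>, the weights
  \<open>\<alpha>\<^sub>1,\<dots>,\<alpha>\<^sub>4\<close> and \<open>\<tau>\<^sub>1, \<tau>\<^sub>2\<close> (only these indices are used), the number \<open>S\<close> of
  training pairs, the pairs (only the indices \<open>1,\<dots>,S\<close> are used), and arbitrary norms on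
  \<open>d\<close>-vectors, \<open>d \<times> d\<close> matrices, \<open>m \<times> d\<close> matrices and \<open>m\<close>-vectors.\<close>

record ('d::finite, 'm::finite) resnet =
  act :: "real^'d \<Rightarrow> real^'d"
  outmap :: "real^'m \<Rightarrow> real^'m"
  loss :: "real^'m \<Rightarrow> real^'m \<Rightarrow> real"
  alpha :: "nat \<Rightarrow> real"
  tau :: "nat \<Rightarrow> real"
  num_data :: nat
  xdata :: "nat \<Rightarrow> real^'d"
  ydata :: "nat \<Rightarrow> real^'m"
  norm_d :: "real^'d \<Rightarrow> real"
  norm_dd :: "real^'d^'d \<Rightarrow> real"
  norm_md :: "real^'d^'m \<Rightarrow> real"
  norm_m :: "real^'m \<Rightarrow> real"

type_synonym ('d, 'm) discrete_param =
  "(nat \<Rightarrow> real^'d^'d) \<times> (nat \<Rightarrow> real^'d) \<times> (real^'d^'m) \<times> (real^'m)"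

type_synonym ('d, 'm) continuum_param =
  "(real \<Rightarrow> real^'d^'d) \<times> (real \<Rightarrow> real^'d) \<times> (real^'d^'m) \<times> (real^'m)"

text \<open>An element of \<open>L\<^sup>2(\<mu>\<^sub>n; V)\<close> is identified with the tuple of its values at
  \<open>i/n\<close>, \<open>i = 0,\<dots>,n-1\<close>.\<close>

definition Theta_n :: "nat \<Rightarrow> ('d::finite, 'm::finite) discrete_param set" where
  "Theta_n n = ({..<n} \<rightarrow>\<^sub>E UNIV) \<times> ({..<n} \<rightarrow>\<^sub>E UNIV) \<times> UNIV \<times> UNIV"

definition Theta :: "('d::finite, 'm::finite) continuum_param set" where
  "Theta = H1_space \<times> H1_space \<times> UNIV \<times> UNIV"

subsection \<open>Discrete functional\<close>

primrec layer :: "(real^'d \<Rightarrow> real^'d) \<Rightarrow> nat \<Rightarrow> (nat \<Rightarrow> real^'d^'d) \<Rightarrow> (nat \<Rightarrow> real^'d) \<Rightarrow>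
    real^'d \<Rightarrow> nat \<Rightarrow> real^'d::finite" where
  "layer \<sigma> n K b x 0 = x"
| "layer \<sigma> n K b x (Suc i) =
     layer \<sigma> n K b x i + (1 / real n) *\<^sub>R \<sigma> (K i *v layer \<sigma> n K b x i + b i)"

definition discrete_reg :: "('a::real_vector \<Rightarrow> real) \<Rightarrow> real \<Rightarrow> nat \<Rightarrow> (nat \<Rightarrow> 'a) \<Rightarrow> real" where
  "discrete_reg N \<tau> n K =
     real n * (\<Sum>i = 1..n - 1. (N (K i - K (i - 1)))\<^sup>2) + \<tau> * (N (K 0))\<^sup>2"

fun energy_n ::
    "('d::finite, 'm::finite) resnet \<Rightarrow> nat \<Rightarrow> ('d, 'm) discrete_param \<Rightarrow> real" where
  "energy_n P n (K, b, W, c) =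
     (\<Sum>s = 1..num_data P.
        loss P (outmap P (W *v layer (act P) n K b (xdata P s) n + c)) (ydata P s))
     + alpha P 1 * discrete_reg (norm_dd P) (tau P 1) n K
     + alpha P 2 * discrete_reg (norm_d P) (tau P 2) n b
     + alpha P 3 * (norm_md P W)\<^sup>2
     + alpha P 4 * (norm_m P c)\<^sup>2"

subsection \<open>Continuum functional\<close>

definition is_flow :: "(real^'d \<Rightarrow> real^'d) \<Rightarrow> (real \<Rightarrow> real^'d^'d) \<Rightarrow> (real \<Rightarrow> real^'d) \<Rightarrow>
    real^'d \<Rightarrow> (real \<Rightarrow> real^'d::finite) \<Rightarrow> bool" where
  "is_flow \<sigma> K b x X \<longleftrightarrow>
     X 0 = x \<and>
     (\<forall>t\<in>{0..1}. (X has_vector_derivative \<sigma> (K t *v X t + b t)) (at t within {0..1}))"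

text \<open>For Lipschitz \<open>\<sigma>\<close> and continuous \<open>K\<close>, \<open>b\<close> the solution exists and is unique on \<open>[0,1]\<close>; the
  choice operator only leaves open the irrelevant values outside \<open>[0,1]\<close>.\<close>

definition flow :: "(real^'d \<Rightarrow> real^'d) \<Rightarrow> (real \<Rightarrow> real^'d^'d) \<Rightarrow> (real \<Rightarrow> real^'d) \<Rightarrow>
    real^'d \<Rightarrow> real \<Rightarrow> real^'d::finite" where
  "flow \<sigma> K b x = (SOME X. is_flow \<sigma> K b x X)"

definition continuum_reg ::
    "('a::euclidean_space \<Rightarrow> real) \<Rightarrow> real \<Rightarrow> (real \<Rightarrow> 'a) \<Rightarrow> real" where
  "continuum_reg N \<tau> K = (L2_norm N (weak_deriv K))\<^sup>2 + \<tau> * (N (K 0))\<^sup>2"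

fun energy_infinity ::
    "('d::finite, 'm::finite) resnet \<Rightarrow> ('d, 'm) continuum_param \<Rightarrow> real" where
  "energy_infinity P (K, b, W, c) =
     (\<Sum>s = 1..num_data P.
        loss P (outmap P (W *v flow (act P) K b (xdata P s) 1 + c)) (ydata P s))
     + alpha P 1 * continuum_reg (norm_dd P) (tau P 1) K
     + alpha P 2 * continuum_reg (norm_d P) (tau P 2) b
     + alpha P 3 * (norm_md P W)\<^sup>2
     + alpha P 4 * (norm_m P c)\<^sup>2"

subsection \<open>Convergence\<close>

definition piecewise_const :: "nat \<Rightarrow> (nat \<Rightarrow> 'a::real_vector) \<Rightarrow> real \<Rightarrow> 'a" where
  "piecewise_const n K t =
     (\<Sum>i = 1..n. indicat_real {real (i - 1) / real n <..< real i / real n} t *\<^sub>R K (i - 1))"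

fun param_dist ::
    "('d::finite, 'm::finite) resnet \<Rightarrow> nat \<Rightarrow> ('d, 'm) discrete_param \<Rightarrow>
     ('d, 'm) continuum_param \<Rightarrow> real" where
  "param_dist P n (Kn, bn, Wn, cn) (K, b, W, c) =
     L2_norm (norm_dd P) (\<lambda>t. piecewise_const n Kn t - K t)
     + L2_norm (norm_d P) (\<lambda>t. piecewise_const n bn t - b t)
     + norm_md P (Wn - W) + norm_m P (cn - c)"

text \<open>\<open>\<Gamma>\<close>-convergence of functionals \<open>E n\<close> on varying spaces \<open>A n\<close>, \<open>n \<ge> 1\<close>, to a functional on
  \<open>B\<close>; \<open>D n\<close> measures the distance between a point of \<open>A n\<close> and a point of \<open>B\<close>.\<close>

definition Gamma_limit :: "(nat \<Rightarrow> 'a set) \<Rightarrow> 'b set \<Rightarrow> (nat \<Rightarrow> 'a \<Rightarrow> 'b \<Rightarrow> real) \<Rightarrow>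
    (nat \<Rightarrow> 'a \<Rightarrow> real) \<Rightarrow> ('b \<Rightarrow> real) \<Rightarrow> bool" where
  "Gamma_limit A B D E F \<longleftrightarrow>
     (\<forall>\<theta>\<in>B.
        (\<forall>\<theta>n. (\<forall>n\<ge>1. \<theta>n n \<in> A n) \<and> (\<lambda>n. D n (\<theta>n n) \<theta>) \<longlonglongrightarrow> 0 \<longrightarrow>
           ereal (F \<theta>) \<le> liminf (\<lambda>n. ereal (E n (\<theta>n n)))) \<and>
        (\<exists>\<theta>n. (\<forall>n\<ge>1. \<theta>n n \<in> A n) \<and> (\<lambda>n. D n (\<theta>n n) \<theta>) \<longlonglongrightarrow> 0 \<and>
           limsup (\<lambda>n. ereal (E n (\<theta>n n))) \<le> ereal (F \<theta>)))"

end

theory Submission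
  imports Defs "HOL-Complex_Analysis.Great_Picard" "HOL-Real_Asymp.Real_Asymp"
    "HOL-Computational_Algebra.Polynomial"
begin

text \<open>Functions in \<open>H\<^sup>1\<close> are the indefinite integrals of \<open>L\<^sup>2\<close> functions, and the energy
  \<open>\<integral> N(u')\<^sup>2\<close> is the supremum of the difference-quotient energies
  \<open>m \<Sum>\<^sub>i N(u((i+1)/m) - u(i/m))\<^sup>2\<close> over \<open>m = 2\<^sup>k\<close>. Unlike the weak derivative, these sums pass to
  pointwise limits, and on a coarse grid they are controlled by the discrete regulariser on a finer one
  by the Cauchy-Schwarz inequality. A bound on the discrete regularisers also gives equi-Hoelder
  continuity up to the mesh size, hence uniform convergence of a subsequence on the grid
  (Arzela-Ascoli); uniform convergence of the coefficients gives convergence of the Euler scheme to the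
  flow. This yields compactness and the lower bound. Sampling a limit function on the grid gives
  the recovery sequence, because Jensen's inequality bounds its discrete regulariser by the
  continuum one. Minimisers for fixed \<open>n\<close> exist by coercivity in finite dimensions.\<close>

section \<open>Norms on finite-dimensional spaces\<close>

text \<open>The obstacle is the derivative term: discrete gradients are bounded in
  \<open>L\<^sup>2\<close> but need not converge strongly. The finite sums replace weak compactness,
  since each involves finitely many point values, and nested dyadic partitions turn the difference
  quotients of the limit into a martingale whose limit is the weak derivative. Orthogonality of its
  increments is Euclidean, whereas \<open>N\<close> is an arbitrary norm; hence the Euclidean norm
  serves for convergence, and \<open>N\<close> enters through norm equivalence and Fatou's lemma.
  Coarse and fine grids need not be aligned, which costs a factor 1 + m/n; it tends to 1 because n
  goes to infinity with m fixed. Step functions are discontinuous, so Arzela-Ascoli is used with an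
  error that vanishes with the mesh. Weak derivatives are defined by testing and picked by choice,
  so both passages between them and indefinite integrals are proved, with explicit smooth cut-offs.
  The lower bound starts from mere \<open>L\<^sup>2\<close> convergence; bounded energy upgrades it
  to grid convergence along a subsequence, and uniqueness of \<open>L\<^sup>2\<close> limits
  identifies the limit.\<close>

lemma is_normD:
  assumes "is_norm N"
  shows is_norm_nonneg: "0 \<le> N v"
    and is_norm_eq_0: "N v = 0 \<longleftrightarrow> v = 0"
    and is_norm_scaleR: "N (a *\<^sub>R v) = \<bar>a\<bar> * N v"
    and is_norm_triangle: "N (u + v) \<le> N u + N v"
  using assms unfolding is_norm_def by blast+

lemma is_norm_zero: "is_norm N \<Longrightarrow> N 0 = 0"
  by (simp add: is_norm_eq_0)

lemma is_norm_minus: "is_norm N \<Longrightarrow> N (- v) = N v"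
  using is_norm_scaleR[of N "-1" v] by simp

lemma is_norm_diff_commute: "is_norm N \<Longrightarrow> N (u - v) = N (v - u)"
  using is_norm_minus[of N "u - v"] by simp

lemma is_norm_triangle_sub: "is_norm N \<Longrightarrow> N (u - v) \<le> N u + N v"
  using is_norm_triangle[of N u "- v"] is_norm_minus[of N v] by simp

lemma is_norm_diff_le: "is_norm N \<Longrightarrow> \<bar>N u - N v\<bar> \<le> N (u - v)"
  using is_norm_triangle[of N "u - v" v] is_norm_triangle[of N "v - u" u] is_norm_diff_commute[of N u v]
  by simp

lemma is_norm_sum:
  assumes "is_norm N"
  shows "N (\<Sum>i\<in>A. f i) \<le> (\<Sum>i\<in>A. N (f i))"
proof (induction A rule: infinite_finite_induct)
  case (insert x F)
  then show ?case using is_norm_triangle[OF assms, of "f x" "sum f F"] by simp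
qed (simp_all add: is_norm_zero[OF assms])

lemma is_norm_norm: "is_norm (norm :: 'a::real_normed_vector \<Rightarrow> real)"
  by (simp add: is_norm_def norm_triangle_ineq)

lemma is_norm_upper:
  fixes N :: "'a::euclidean_space \<Rightarrow> real"
  assumes "is_norm N"
  obtains C where "C > 0" "\<And>v. N v \<le> C * norm v"
proof -
  define C where "C = (\<Sum>b\<in>Basis. N (b::'a)) + 1"
  have "C > 0" unfolding C_def
    by (intro add_nonneg_pos sum_nonneg is_norm_nonneg[OF assms]) simp
  moreover have "N v \<le> C * norm v" for v
  proof -
    have "N v = N (\<Sum>b\<in>Basis. (v \<bullet> b) *\<^sub>R b)" by (simp add: euclidean_representation)
    also have "\<dots> \<le> (\<Sum>b\<in>Basis. N ((v \<bullet> b) *\<^sub>R b))" by (rule is_norm_sum[OF assms])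
    also have "\<dots> = (\<Sum>b\<in>Basis. \<bar>v \<bullet> b\<bar> * N b)" by (simp add: is_norm_scaleR[OF assms])
    also have "\<dots> \<le> (\<Sum>b\<in>Basis. norm v * N b)"
      by (intro sum_mono mult_right_mono Basis_le_norm is_norm_nonneg[OF assms])
    also have "\<dots> \<le> C * norm v" by (simp add: C_def sum_distrib_left algebra_simps)
    finally show ?thesis .
  qed
  ultimately show ?thesis using that by blast
qed

lemma is_norm_continuous_on:
  fixes N :: "'a::euclidean_space \<Rightarrow> real"
  assumes "is_norm N"
  shows "continuous_on A N"
proof -
  obtain C where C: "C > 0" "\<And>v. N v \<le> C * norm v" using is_norm_upper[OF assms] by blast
  have "C-lipschitz_on A N"
  proof (rule lipschitz_onI)
    fix x y
    have "\<bar>N x - N y\<bar> \<le> C * norm (x - y)"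
      using is_norm_diff_le[OF assms, of x y] C(2)[of "x - y"] by linarith
    then show "dist (N x) (N y) \<le> C * dist x y" by (simp add: dist_norm)
  qed (use C in simp)
  then show ?thesis by (rule lipschitz_on_continuous_on)
qed

text \<open>By compactness \<open>N\<close> attains its minimum on the Euclidean unit sphere; the
  minimum is positive, and homogeneity carries the bound to all vectors.\<close>

lemma is_norm_lower:
  fixes N :: "'a::euclidean_space \<Rightarrow> real"
  assumes "is_norm N"
  obtains C where "C > 0" "\<And>v. norm v \<le> C * N v"
proof -
  have "\<exists>x\<in>sphere (0::'a) 1. \<forall>y\<in>sphere 0 1. N x \<le> N y"
    by (rule continuous_attains_inf) (auto intro: is_norm_continuous_on[OF assms])
  then obtain x where x: "norm x = 1" "\<And>y. norm y = 1 \<Longrightarrow> N x \<le> N y" by auto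
  have pos: "N x > 0"
    using x(1) is_norm_nonneg[OF assms, of x] is_norm_eq_0[OF assms, of x] by (metis less_eq_real_def norm_zero zero_neq_one)
  have "norm v \<le> (1 / N x) * N v" for v
  proof (cases "v = 0")
    case False
    have "N x \<le> N ((1 / norm v) *\<^sub>R v)" by (rule x(2)) (use False in simp)
    then show ?thesis using False pos by (simp add: is_norm_scaleR[OF assms] field_simps)
  qed (simp add: is_norm_zero[OF assms])
  then show ?thesis using that[of "1 / N x"] pos by simp
qed

lemma is_norm_tendsto:
  fixes N :: "'a::euclidean_space \<Rightarrow> real"
  assumes "is_norm N" "(f \<longlongrightarrow> l) F"
  shows "((\<lambda>x. N (f x)) \<longlongrightarrow> N l) F"
  using continuous_on_tendsto_compose[OF is_norm_continuous_on[OF assms(1), of UNIV] assms(2)] by simp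

lemma is_norm_tendsto_0_iff:
  fixes N :: "'a::euclidean_space \<Rightarrow> real"
  assumes "is_norm N"
  shows "((\<lambda>x. N (f x - l)) \<longlongrightarrow> 0) F \<longleftrightarrow> (f \<longlongrightarrow> l) F"
proof
  obtain C where C: "C > 0" "\<And>v. norm v \<le> C * N v" using is_norm_lower[OF assms] by blast
  assume "((\<lambda>x. N (f x - l)) \<longlongrightarrow> 0) F"
  then have "((\<lambda>x. C * N (f x - l)) \<longlongrightarrow> C * 0) F" by (intro tendsto_intros)
  then have "((\<lambda>x. f x - l) \<longlongrightarrow> 0) F"
    by (intro Lim_null_comparison[of "\<lambda>x. f x - l" "\<lambda>x. C * N (f x - l)"]) (auto simp: C)
  then show "(f \<longlongrightarrow> l) F" by (simp add: LIM_zero_iff)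
next
  assume "(f \<longlongrightarrow> l) F"
  then have "((\<lambda>x. N (f x - l)) \<longlongrightarrow> N (l - l)) F"
    by (intro is_norm_tendsto[OF assms] tendsto_intros)
  then show "((\<lambda>x. N (f x - l)) \<longlongrightarrow> 0) F" by (simp add: is_norm_zero[OF assms])
qed

section \<open>Smooth step functions\<close>

text \<open>The differentiability clause of \<open>test_function\<close>, separated from the support
  condition so that closure properties can be proved.\<close>

definition smooth :: "(real \<Rightarrow> real) \<Rightarrow> bool" where
  "smooth f \<longleftrightarrow> (\<forall>k t. (deriv ^^ k) f field_differentiable (at t))"

text \<open>A class of differentiable functions closed under \<open>deriv\<close> contains all
  iterated derivatives of its members. Smoothness thus follows from one derivative formula, without
  a formula for the k-th derivative.\<close>

lemma smooth_coinduct: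
  assumes "f \<in> A" and "\<And>f t. f \<in> A \<Longrightarrow> f field_differentiable (at t)" and "\<And>f. f \<in> A \<Longrightarrow> deriv f \<in> A"
  shows "smooth f"
proof -
  have "(deriv ^^ k) f \<in> A" for k
    by (induction k) (use assms in auto)
  then show ?thesis using assms(2) by (auto simp: smooth_def)
qed

lemma smooth_differentiable: "smooth f \<Longrightarrow> f field_differentiable (at t)"
  unfolding smooth_def by (metis funpow_0)

lemma smooth_deriv: "smooth f \<Longrightarrow> smooth (deriv f)"
  unfolding smooth_def by (metis comp_apply funpow_Suc_right)

lemma smooth_has_real_derivative: "smooth f \<Longrightarrow> (f has_real_derivative deriv f t) (at t)"
  by (simp add: DERIV_deriv_iff_field_differentiable smooth_differentiable)

lemma smooth_continuous_on: "smooth f \<Longrightarrow> continuous_on A f"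
  by (intro continuous_at_imp_continuous_on ballI)
    (auto dest: smooth_has_real_derivative intro: DERIV_isCont)

lemma smooth_antiderivative:
  assumes "\<And>t. (F has_real_derivative f t) (at t)" "smooth f"
  shows "smooth F"
proof (rule smooth_coinduct)
  show "F \<in> {F} \<union> {g. smooth g}" by simp
  have "deriv F = f" using assms(1) by (auto intro!: ext DERIV_imp_deriv)
  then show "deriv g \<in> {F} \<union> {g. smooth g}" if "g \<in> {F} \<union> {g. smooth g}" for g
    using that assms(2) smooth_deriv by auto
  show "g field_differentiable (at t)" if "g \<in> {F} \<union> {g. smooth g}" for g t
    using that assms(1) smooth_differentiable field_differentiable_def by blast
qed

text \<open>Single products are not closed under \<open>deriv\<close>, but by the Leibniz rule
  finite sums of products are, which makes this a class to which \<open>smooth_coinduct\<close>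
  applies.\<close>

inductive_set sums_of_products :: "(real \<Rightarrow> real) set" where
  prod: "smooth f \<Longrightarrow> smooth g \<Longrightarrow> (\<lambda>t. f t * g t) \<in> sums_of_products"
| add: "p \<in> sums_of_products \<Longrightarrow> q \<in> sums_of_products \<Longrightarrow> (\<lambda>t. p t + q t) \<in> sums_of_products"

lemma sums_of_products_deriv:
  assumes "p \<in> sums_of_products"
  shows "\<exists>q\<in>sums_of_products. \<forall>t. (p has_real_derivative q t) (at t)"
  using assms
proof induction
  case (prod f g)
  show ?case
  proof (intro bexI allI)
    show "(\<lambda>t. deriv f t * g t + f t * deriv g t) \<in> sums_of_products"
      by (intro sums_of_products.intros prod smooth_deriv)
    show "((\<lambda>t. f t * g t) has_real_derivative deriv f t * g t + f t * deriv g t) (at t)" for t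
      using smooth_has_real_derivative[OF prod(1), of t] smooth_has_real_derivative[OF prod(2), of t]
      by (auto intro!: derivative_eq_intros)
  qed
next
  case (add p q)
  then obtain p' q' where *: "p' \<in> sums_of_products" "q' \<in> sums_of_products"
    "\<And>t. (p has_real_derivative p' t) (at t)" "\<And>t. (q has_real_derivative q' t) (at t)" by blast
  show ?case
    by (intro bexI[of _ "\<lambda>t. p' t + q' t"] allI DERIV_add * sums_of_products.intros)
qed

lemma smooth_sums_of_products: "p \<in> sums_of_products \<Longrightarrow> smooth p"
proof (rule smooth_coinduct[of _ sums_of_products])
  fix f assume "f \<in> sums_of_products"
  then obtain q where q: "q \<in> sums_of_products" "\<And>t. (f has_real_derivative q t) (at t)"
    using sums_of_products_deriv by blast
  then show "f field_differentiable (at t)" for t by (auto simp: field_differentiable_def)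
  have "deriv f = q" using q(2) by (auto intro!: ext DERIV_imp_deriv)
  then show "deriv f \<in> sums_of_products" using q(1) by simp
qed

lemma smooth_mult: "smooth f \<Longrightarrow> smooth g \<Longrightarrow> smooth (\<lambda>t. f t * g t)"
  by (rule smooth_sums_of_products) (rule sums_of_products.prod)

lemma smooth_const: "smooth (\<lambda>_. c)"
proof (rule smooth_coinduct[of _ "range (\<lambda>c _. c)"])
  fix f :: "real \<Rightarrow> real" assume "f \<in> range (\<lambda>c _. c)"
  then obtain c where "f = (\<lambda>_. c)" by auto
  then show "f field_differentiable (at t)" "deriv f \<in> range (\<lambda>c _. c)" for t
    by auto
qed auto

lemma smooth_add:
  assumes "smooth f" "smooth g"
  shows "smooth (\<lambda>t. f t + g t)"
proof -
  have "(\<lambda>t. f t * 1 + g t * 1) \<in> sums_of_products"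
    by (intro sums_of_products.intros assms smooth_const)
  then show ?thesis using smooth_sums_of_products by simp
qed

lemma smooth_affine:
  assumes "smooth f"
  shows "smooth (\<lambda>t. f (a * t + b))"
proof -
  \<comment> \<open>The free factor \<open>c\<close> absorbs the powers of \<open>a\<close> that the
    chain rule produces.\<close>
  define A where "A = {g. \<exists>c f. smooth f \<and> g = (\<lambda>t. c * f (a * t + b))}"
  show ?thesis
  proof (rule smooth_coinduct[of _ A])
    show "(\<lambda>t. f (a * t + b)) \<in> A"
      unfolding A_def using assms by (intro CollectI exI[of _ 1] exI[of _ f]) simp
  next
    fix g assume "g \<in> A"
    then obtain c f where f: "smooth f" "g = (\<lambda>t. c * f (a * t + b))" by (auto simp: A_def)
    have "((\<lambda>t. f (a * t + b)) has_real_derivative deriv f (a * t + b) * a) (at t)" for t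
      by (rule DERIV_chain2[OF smooth_has_real_derivative[OF f(1)]]) (auto intro!: derivative_eq_intros)
    then have *: "(g has_real_derivative (c * a) * deriv f (a * t + b)) (at t)" for t
      unfolding f(2) by (auto intro!: derivative_eq_intros)
    then show "g field_differentiable (at t)" for t by (auto simp: field_differentiable_def)
    have "deriv g = (\<lambda>t. (c * a) * deriv f (a * t + b))" using * by (auto intro!: ext DERIV_imp_deriv)
    then show "deriv g \<in> A" unfolding A_def using smooth_deriv[OF f(1)] by blast
  qed
qed

section \<open>The flat function exp(-1/t) and a smooth step from 0 to 1\<close>

definition flat_exp :: "real poly \<Rightarrow> real \<Rightarrow> real" where
  "flat_exp p t = (if t \<le> 0 then 0 else poly p (1 / t) * exp (- (1 / t)))"

lemma poly_mult_exp_minus_tendsto_0: "((\<lambda>x. poly p x * exp (- x)) \<longlongrightarrow> (0::real)) at_top"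
proof -
  have "((\<lambda>x::real. \<Sum>i\<le>degree p. coeff p i * (x ^ i / exp x)) \<longlongrightarrow> (\<Sum>i\<le>degree p. coeff p i * 0)) at_top"
    by (intro tendsto_intros tendsto_power_div_exp_0)
  moreover have "(\<lambda>x. poly p x * exp (- x)) = (\<lambda>x. \<Sum>i\<le>degree p. coeff p i * (x ^ i / exp x))"
    by (auto simp: poly_altdef exp_minus sum_distrib_right divide_simps)
  ultimately show ?thesis by simp
qed

text \<open>Differentiating p(1/t) exp(-1/t) gives (p - p')(1/t) exp(-1/t) / t^2, and division by
  t^2 multiplies the polynomial in 1/t by the square of its variable. The polynomial is a parameter
  so that the family is closed under \<open>deriv\<close>.\<close>

lemma flat_exp_has_derivative:
  "(flat_exp p has_real_derivative flat_exp ((p - pderiv p) * [:0, 0, 1:]) t) (at t)"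
proof -
  consider "t < 0" | "t = 0" | "t > 0" by linarith
  then show ?thesis
  proof cases
    case 1
    have "((\<lambda>_. 0) has_real_derivative 0) (at t)" by simp
    then have "(flat_exp p has_real_derivative 0) (at t)"
      by (rule has_field_derivative_transform_within_open[of _ _ _ "{..<0}"])
        (use 1 in \<open>auto simp: flat_exp_def\<close>)
    then show ?thesis using 1 by (simp add: flat_exp_def)
  next
    case 2
    \<comment> \<open>The right difference quotient at 0: division by \<open>x\<close> multiplies
      the polynomial in \<open>1/x\<close> by its variable, hence \<open>[:0, 1:]\<close>.\<close>
    have *: "((\<lambda>x. poly (p * [:0, 1:]) (inverse x) * exp (- (inverse x))) \<longlongrightarrow> 0) (at_right (0::real))"
      by (rule filterlim_compose[OF poly_mult_exp_minus_tendsto_0 filterlim_inverse_at_top_right])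
    have right: "((\<lambda>x. (flat_exp p x - flat_exp p 0) / (x - 0)) \<longlongrightarrow> 0) (at_right 0)"
      by (rule Lim_transform_eventually[OF *])
        (auto simp: flat_exp_def eventually_at_filter field_simps)
    have left: "((\<lambda>x. (flat_exp p x - flat_exp p 0) / (x - 0)) \<longlongrightarrow> 0) (at_left 0)"
      by (rule Lim_transform_eventually[OF tendsto_const])
        (auto simp: flat_exp_def eventually_at_filter)
    have "((\<lambda>x. (flat_exp p x - flat_exp p 0) / (x - 0)) \<longlongrightarrow> 0) (at 0)"
      using left right by (simp add: filterlim_split_at_real)
    then show ?thesis using 2 by (simp add: has_field_derivative_iff flat_exp_def)
  next
    case 3
    have "((\<lambda>t. poly p (1 / t) * exp (- (1 / t))) has_real_derivative
        poly (pderiv p) (1 / t) * (- 1 / t\<^sup>2) * exp (- (1 / t))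
        + poly p (1 / t) * (exp (- (1 / t)) * (1 / t\<^sup>2))) (at t)"
      using 3 by (auto intro!: derivative_eq_intros DERIV_chain2[OF poly_DERIV] simp: power2_eq_square field_simps)
    then have "(flat_exp p has_real_derivative
        poly (pderiv p) (1 / t) * (- 1 / t\<^sup>2) * exp (- (1 / t))
        + poly p (1 / t) * (exp (- (1 / t)) * (1 / t\<^sup>2))) (at t)"
      by (rule has_field_derivative_transform_within_open[of _ _ _ "{0<..}"])
        (use 3 in \<open>auto simp: flat_exp_def\<close>)
    moreover have "poly (pderiv p) (1 / t) * (- 1 / t\<^sup>2) * exp (- (1 / t))
        + poly p (1 / t) * (exp (- (1 / t)) * (1 / t\<^sup>2)) = flat_exp ((p - pderiv p) * [:0, 0, 1:]) t"
      using 3 by (simp add: flat_exp_def field_simps power2_eq_square)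
    ultimately show ?thesis by simp
  qed
qed

lemma smooth_flat_exp: "smooth (flat_exp p)"
proof (rule smooth_coinduct[of _ "range flat_exp"])
  fix f assume "f \<in> range flat_exp"
  then obtain p where p: "f = flat_exp p" by auto
  show "f field_differentiable (at t)" for t
    unfolding p field_differentiable_def using flat_exp_has_derivative by blast
  have "deriv f = flat_exp ((p - pderiv p) * [:0, 0, 1:])"
    unfolding p by (rule ext, rule DERIV_imp_deriv, rule flat_exp_has_derivative)
  then show "deriv f \<in> range flat_exp" by simp
qed simp

lemma smooth_step_exists:
  obtains F :: "real \<Rightarrow> real" where
    "smooth F" "\<And>t. t \<le> 0 \<Longrightarrow> F t = 0" "\<And>t. t \<ge> 1 \<Longrightarrow> F t = 1" "\<And>t. deriv F t \<ge> 0"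
proof -
  \<comment> \<open>A flat exponential times its reflection about 1/2: a smooth bump positive
    exactly on the open unit interval. The step is its normalised antiderivative.\<close>
  define \<beta> where "\<beta> t = flat_exp 1 t * flat_exp 1 (- 1 * t + 1)" for t
  have smooth: "smooth \<beta>" unfolding \<beta>_def by (intro smooth_mult smooth_affine smooth_flat_exp)
  have nn: "\<beta> t \<ge> 0" for t by (simp add: \<beta>_def flat_exp_def)
  have zero: "\<beta> t = 0" if "t \<le> 0 \<or> t \<ge> 1" for t using that by (auto simp: \<beta>_def flat_exp_def)
  have pos: "\<beta> t > 0" if "0 < t" "t < 1" for t using that by (auto simp: \<beta>_def flat_exp_def)
  have cont: "continuous_on A \<beta>" for A by (rule smooth_continuous_on[OF smooth])
  have "\<exists>G. \<forall>x::real. -\<infinity> < ereal x \<longrightarrow> ereal x < \<infinity> \<longrightarrow> (G has_vector_derivative \<beta> x) (at x)"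
    by (rule einterval_antiderivative) (use cont[of UNIV] in \<open>auto simp: continuous_on_eq_continuous_at\<close>)
  then obtain G where G: "\<And>x. (G has_real_derivative \<beta> x) (at x)"
    by (auto simp: has_real_derivative_iff_has_vector_derivative)
  have mvt: "\<exists>z>a. z < b \<and> G b - G a = (b - a) * \<beta> z" if "a < b" for a b
    using MVT2[OF that, of G \<beta>] G by auto
  have left: "G t = G 0" if "t \<le> 0" for t
    using that mvt[of t 0] zero by (cases "t = 0") auto
  have right: "G t = G 1" if "t \<ge> 1" for t
    using that mvt[of 1 t] zero by (cases "t = 1") auto
  have "G 0 < G 1"
    using mvt[of 0 1] pos by force
  define F where "F t = (1 / (G 1 - G 0)) * (G t + - G 0)" for t
  show ?thesis
  proof
    show "smooth F" unfolding F_def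
      by (intro smooth_mult smooth_add smooth_const smooth_antiderivative[OF G smooth])
    have "(F has_real_derivative (1 / (G 1 - G 0)) * \<beta> t) (at t)" for t
      unfolding F_def using DERIV_cmult[OF DERIV_add[OF G[of t] DERIV_const[of "- G 0"]]] by (simp only: add_0_right)
    then have "deriv F t = (1 / (G 1 - G 0)) * \<beta> t" for t by (rule DERIV_imp_deriv)
    then show "deriv F t \<ge> 0" for t using nn[of t] \<open>G 0 < G 1\<close> by simp
    show "F t = 0" if "t \<le> 0" for t unfolding F_def left[OF that] by simp
    show "F t = 1" if "t \<ge> 1" for t unfolding F_def right[OF that] using \<open>G 0 < G 1\<close> by simp
  qed
qed

section \<open>Square-integrable functions on the unit interval\<close>

lemma finite_measure_unit: "finite_measure (lebesgue_on {0..1::real})"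
  by (intro finite_measureI) (simp add: emeasure_restrict_space)

lemma L2_space_measurable: "f \<in> L2_space \<Longrightarrow> f \<in> borel_measurable (lebesgue_on {0..1})"
  and L2_space_norm_sq: "f \<in> L2_space \<Longrightarrow> integrable (lebesgue_on {0..1}) (\<lambda>t. (norm (f t))\<^sup>2)"
  by (simp_all add: L2_space_def)

lemma L2_space_integrable:
  assumes "f \<in> L2_space"
  shows "integrable (lebesgue_on {0..1}) f"
proof (rule Bochner_Integration.integrable_bound)
  show "integrable (lebesgue_on {0..1}) (\<lambda>t. 1 + (norm (f t))\<^sup>2)"
    using assms finite_measure_unit
    by (intro Bochner_Integration.integrable_add finite_measure.integrable_const L2_space_norm_sq)
  show "AE t in lebesgue_on {0..1}. norm (f t) \<le> norm (1 + (norm (f t))\<^sup>2)"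
  proof (rule AE_I2)
    fix t
    have "0 \<le> (norm (f t) - 1)\<^sup>2" by simp
    then have "2 * norm (f t) \<le> 1 + (norm (f t))\<^sup>2" unfolding power2_diff by simp
    then show "norm (f t) \<le> norm (1 + (norm (f t))\<^sup>2)"
      using norm_ge_zero[of "f t"] by (simp del: norm_ge_zero)
  qed
qed (use assms in \<open>simp add: L2_space_measurable\<close>)

lemma L2_space_absolutely_integrable:
  assumes "f \<in> L2_space"
  shows "f absolutely_integrable_on {0..1}"
  using L2_space_integrable[OF assms]
  by (simp add: set_integrable_def integrable_restrict_space)

lemma absolutely_integrable_on_subinterval':
  fixes f :: "real \<Rightarrow> 'a::euclidean_space"
  assumes "f absolutely_integrable_on {0..1}" "0 \<le> a" "b \<le> 1"
  shows "f absolutely_integrable_on {a..b}"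
  using absolutely_integrable_on_subinterval[OF assms(1), of a b] assms(2,3) by simp

lemma is_norm_measurable:
  fixes N :: "'a::euclidean_space \<Rightarrow> real"
  assumes "is_norm N" "f \<in> borel_measurable M"
  shows "(\<lambda>t. N (f t)) \<in> borel_measurable M"
  using measurable_compose[OF assms(2) borel_measurable_continuous_onI[OF is_norm_continuous_on[OF assms(1)]]]
  by simp

lemma L2_space_is_norm_sq:
  fixes f :: "real \<Rightarrow> 'a::euclidean_space"
  assumes "is_norm N" "f \<in> L2_space"
  shows "integrable (lebesgue_on {0..1}) (\<lambda>t. (N (f t))\<^sup>2)"
proof -
  obtain C where C: "C > 0" "\<And>v. N v \<le> C * norm v" using is_norm_upper[OF assms(1)] by blast
  show ?thesis
  proof (rule Bochner_Integration.integrable_bound)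
    show "integrable (lebesgue_on {0..1}) (\<lambda>t. C\<^sup>2 * (norm (f t))\<^sup>2)"
      using L2_space_norm_sq[OF assms(2)] by simp
    show "(\<lambda>t. (N (f t))\<^sup>2) \<in> borel_measurable (lebesgue_on {0..1})"
      using is_norm_measurable[OF assms(1) L2_space_measurable[OF assms(2)]] by simp
    show "AE t in lebesgue_on {0..1}. norm ((N (f t))\<^sup>2) \<le> norm (C\<^sup>2 * (norm (f t))\<^sup>2)"
      by (rule AE_I2)
        (simp add: C is_norm_nonneg[OF assms(1)] power_mono flip: power_mult_distrib)
  qed
qed

lemma continuous_on_imp_L2_space:
  fixes f :: "real \<Rightarrow> 'a::euclidean_space"
  assumes "continuous_on {0..1} f"
  shows "f \<in> L2_space"
  unfolding L2_space_def
proof (intro CollectI conjI)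
  show "f \<in> borel_measurable (lebesgue_on {0..1})"
    using assms by (intro continuous_imp_measurable_on_sets_lebesgue) auto
  have "(\<lambda>t. (norm (f t))\<^sup>2) absolutely_integrable_on {0..1}"
    using assms by (intro absolutely_integrable_continuous_real continuous_intros)
  then show "integrable (lebesgue_on {0..1}) (\<lambda>t. (norm (f t))\<^sup>2)"
    by (simp add: set_integrable_def integrable_restrict_space)
qed

lemma L2_space_diff:
  assumes "f \<in> L2_space" "g \<in> L2_space"
  shows "(\<lambda>t. f t - g t) \<in> L2_space"
  unfolding L2_space_def
proof (intro CollectI conjI)
  show m: "(\<lambda>t. f t - g t) \<in> borel_measurable (lebesgue_on {0..1})"
    using assms by (intro borel_measurable_diff L2_space_measurable)
  show "integrable (lebesgue_on {0..1}) (\<lambda>t. (norm (f t - g t))\<^sup>2)"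
  proof (rule Bochner_Integration.integrable_bound)
    show "integrable (lebesgue_on {0..1}) (\<lambda>t. 2 * (norm (f t))\<^sup>2 + 2 * (norm (g t))\<^sup>2)"
      using L2_space_norm_sq[OF assms(1)] L2_space_norm_sq[OF assms(2)] by auto
    show "(\<lambda>t. (norm (f t - g t))\<^sup>2) \<in> borel_measurable (lebesgue_on {0..1})" using m by simp
    show "AE t in lebesgue_on {0..1}. norm ((norm (f t - g t))\<^sup>2) \<le> norm (2 * (norm (f t))\<^sup>2 + 2 * (norm (g t))\<^sup>2)"
    proof (rule AE_I2)
      fix t
      have "(norm (f t - g t))\<^sup>2 \<le> (norm (f t) + norm (g t))\<^sup>2"
        by (intro power_mono norm_triangle_ineq4) simp
      also have "\<dots> \<le> 2 * (norm (f t))\<^sup>2 + 2 * (norm (g t))\<^sup>2"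
        using sum_squares_bound[of "norm (f t)" "norm (g t)"] by (simp add: power2_sum)
      finally show "norm ((norm (f t - g t))\<^sup>2) \<le> norm (2 * (norm (f t))\<^sup>2 + 2 * (norm (g t))\<^sup>2)" by simp
    qed
  qed
qed

section \<open>Weak derivatives and indefinite integrals\<close>

text \<open>For \<open>g\<close> in \<open>L\<^sup>2\<close> this is the description of
  \<open>H\<^sup>1\<close> by absolutely continuous functions. It speaks of all subintervals, so the
  increment of \<open>u\<close> over any cell of a partition can be read off.\<close>

definition indefinite_integral :: "(real \<Rightarrow> 'a::euclidean_space) \<Rightarrow> (real \<Rightarrow> 'a) \<Rightarrow> bool" where
  "indefinite_integral u g \<longleftrightarrow> (\<forall>s\<in>{0..1}. \<forall>t\<in>{0..1}. s \<le> t \<longrightarrow> (g has_integral (u t - u s)) {s..t})"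

lemma affine_le_0: "0 < e \<Longrightarrow> x \<le> s \<Longrightarrow> (1/e) * x + (- s/e) \<le> (0::real)"
  and affine_ge_1: "0 < e \<Longrightarrow> s + e \<le> x \<Longrightarrow> (1/e) * x + (- s/e) \<ge> (1::real)"
  by (simp_all add: field_simps)

text \<open>The difference of two rescaled steps starting at \<open>s\<close> and \<open>t\<close>
  is a smooth substitute for the indicator of the interval between them. Both ramps extend to the
  right, so \<open>t + e < 1\<close> keeps the support inside the open unit interval.\<close>

lemma test_function_smooth_step:
  assumes "smooth F" "\<And>t. t \<le> 0 \<Longrightarrow> F t = 0" "\<And>t. t \<ge> 1 \<Longrightarrow> F t = 1"
    and "0 < s" "s < t" "0 < e" "t + e < 1"
  shows "test_function (\<lambda>x. F ((1/e) * x + (- s/e)) + (-1) * F ((1/e) * x + (- t/e)))"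
  unfolding test_function_def
proof
  let ?\<phi> = "\<lambda>x. F ((1/e) * x + (- s/e)) + (-1) * F ((1/e) * x + (- t/e))"
  have "smooth ?\<phi>"
    by (intro smooth_add smooth_mult smooth_const smooth_affine assms(1))
  then show "\<forall>k t. (deriv ^^ k) ?\<phi> field_differentiable at t" by (simp add: smooth_def)
  have "{x. ?\<phi> x \<noteq> 0} \<subseteq> {s..t + e}"
  proof
    fix x assume x: "x \<in> {x. ?\<phi> x \<noteq> 0}"
    show "x \<in> {s..t + e}"
    proof (rule ccontr)
      assume "x \<notin> {s..t + e}"
      then consider "x < s" | "x > t + e" by fastforce
      then have "?\<phi> x = 0"
      proof cases
        case 1
        then have "(1/e) * x + (- s/e) \<le> 0" "(1/e) * x + (- t/e) \<le> 0"
          using assms(5,6) by (simp_all add: divide_simps)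
        then show ?thesis using assms(2) by simp
      next
        case 2
        then have "(1/e) * x + (- s/e) \<ge> 1" "(1/e) * x + (- t/e) \<ge> 1"
          using assms(5,6) by (simp_all add: divide_simps)
        then show ?thesis using assms(3) by simp
      qed
      then show False using x by simp
    qed
  qed
  then have "closure {x. ?\<phi> x \<noteq> 0} \<subseteq> {s..t + e}" by (rule closure_minimal) simp
  then show "closure {x. ?\<phi> x \<noteq> 0} \<subseteq> {0<..<1}" using assms by (auto simp: subset_iff)
qed

text \<open>The derivatives of the rescaled steps form an approximate identity: they are
  nonnegative, vanish outside \<open>[s, s + e n]\<close> and have total mass 1, so they average a
  continuous \<open>u\<close> over ever shorter intervals next to \<open>s\<close>.\<close>

lemma smooth_step_average_tendsto:
  fixes u :: "real \<Rightarrow> 'a::euclidean_space"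
  assumes F: "smooth F" "\<And>t. t \<le> 0 \<Longrightarrow> F t = 0" "\<And>t. t \<ge> 1 \<Longrightarrow> F t = 1" "\<And>t. deriv F t \<ge> 0"
    and u: "continuous_on {0..1} u" and s: "0 < s" "s < 1"
    and e: "\<And>n. e n > 0" "e \<longlonglongrightarrow> 0"
  shows "(\<lambda>n. integral {0..1} (\<lambda>x. ((1/e n) * deriv F ((1/e n) * x + (- s/e n))) *\<^sub>R u x)) \<longlonglongrightarrow> u s"
proof (rule LIMSEQ_I)
  fix r :: real assume "r > 0"
  have "\<exists>d>0. \<forall>x\<in>{0..1}. dist x s < d \<longrightarrow> dist (u x) (u s) < r / 2"
    using u s \<open>r > 0\<close> unfolding continuous_on_iff by (metis atLeastAtMost_iff half_gt_zero less_eq_real_def)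
  then obtain d where d: "d > 0" "\<And>x. x \<in> {0..1} \<Longrightarrow> dist x s < d \<Longrightarrow> dist (u x) (u s) < r / 2" by blast
  \<comment> \<open>The bound \<open>d\<close> places the support of the kernel where
    \<open>u\<close> is close to \<open>u s\<close>; the bound \<open>1 - s\<close> keeps its whole
    mass inside the unit interval.\<close>
  define m where "m = min d (1 - s)"
  have "m > 0" using d s by (simp add: m_def)
  then obtain n0 where n0: "\<And>n. n \<ge> n0 \<Longrightarrow> e n < m"
    using LIMSEQ_D[OF e(2), of m] e(1) by (auto simp: abs_of_pos)
  show "\<exists>n0. \<forall>n\<ge>n0. norm (integral {0..1} (\<lambda>x. ((1/e n) * deriv F ((1/e n) * x + (- s/e n))) *\<^sub>R u x) - u s) < r"
  proof (intro exI[of _ n0] allI impI)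
    fix n assume n: "n \<ge> n0"
    define w where "w x = (1/e n) * deriv F ((1/e n) * x + (- s/e n))" for x
    have wnn: "w x \<ge> 0" for x using F(4) e(1)[of n] by (simp add: w_def)
    have wcont: "continuous_on A w" for A
      unfolding w_def by (intro continuous_intros smooth_continuous_on smooth_affine smooth_deriv F(1))
    have wF: "((\<lambda>x. F ((1/e n) * x + (- s/e n))) has_real_derivative w x) (at x)" for x
      unfolding w_def by (rule DERIV_chain2[OF smooth_has_real_derivative[OF F(1)], THEN DERIV_cong])
        (use e(1)[of n] in \<open>auto intro!: derivative_eq_intros\<close>)
    have "(w has_integral F ((1/e n) * 1 + (- s/e n)) - F ((1/e n) * 0 + (- s/e n))) {0..1}"
      by (rule fundamental_theorem_of_calculus, simp, rule has_vector_derivative_at_within,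
          rule wF[unfolded has_real_derivative_iff_has_vector_derivative])
    moreover have "(1/e n) * 1 + (- s/e n) \<ge> 1" using n0[OF n] e(1)[of n] by (simp add: m_def field_simps)
    moreover have "(1/e n) * 0 + (- s/e n) \<le> 0" using e(1)[of n] s by simp
    ultimately have w1: "(w has_integral 1) {0..1}" using F(2,3) by simp
    have w0: "w x = 0" if "x < s \<or> x > s + e n" for x
    proof -
      have "((\<lambda>x. F ((1/e n) * x + (- s/e n))) has_real_derivative 0) (at x)"
        using that
      proof
        assume "x < s"
        show ?thesis
        proof (rule has_field_derivative_transform_within_open[of "\<lambda>_. 0" _ _ "{..<s}"])
          show "0 = F ((1/e n) * y + (- s/e n))" if "y \<in> {..<s}" for y
            using affine_le_0[OF e(1)[of n], of y s] that by (intro F(2)[symmetric]) auto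
        qed (use \<open>x < s\<close> in auto)
      next
        assume "x > s + e n"
        show ?thesis
        proof (rule has_field_derivative_transform_within_open[of "\<lambda>_. 1" _ _ "{s + e n<..}"])
          show "1 = F ((1/e n) * y + (- s/e n))" if "y \<in> {s + e n<..}" for y
            using affine_ge_1[OF e(1)[of n], of s y] that by (intro F(3)[symmetric]) auto
        qed (use \<open>x > s + e n\<close> in auto)
      qed
      then show ?thesis using wF DERIV_unique by blast
    qed
    have i1: "((\<lambda>x. w x *\<^sub>R u s) has_integral 1 *\<^sub>R u s) {0..1}"
      by (rule has_integral_scaleR_left[OF w1])
    have i2: "(\<lambda>x. w x *\<^sub>R u x) integrable_on {0..1}"
      by (intro integrable_continuous_interval continuous_intros wcont u)
    have "integral {0..1} (\<lambda>x. w x *\<^sub>R u x) - u s = integral {0..1} (\<lambda>x. w x *\<^sub>R u x - w x *\<^sub>R u s)"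
      using i1 i2 by (subst Henstock_Kurzweil_Integration.integral_diff) (auto simp: integral_unique has_integral_integrable)
    also have "norm \<dots> \<le> integral {0..1} (\<lambda>x. w x * (r / 2))"
    proof (rule integral_norm_bound_integral)
      show "(\<lambda>x. w x *\<^sub>R u x - w x *\<^sub>R u s) integrable_on {0..1}"
        "(\<lambda>x. w x * (r / 2)) integrable_on {0..1}"
        by (intro integrable_continuous_interval continuous_intros wcont u)+
      fix x :: real assume x: "x \<in> {0..1}"
      show "norm (w x *\<^sub>R u x - w x *\<^sub>R u s) \<le> w x * (r / 2)"
      proof (cases "x < s \<or> x > s + e n")
        case False
        then have "dist x s < d" using n0[OF n] by (auto simp: dist_real_def m_def)
        then have "norm (u x - u s) \<le> r / 2" using d(2)[OF x] by (simp add: dist_norm)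
        then have "w x * norm (u x - u s) \<le> w x * (r / 2)" using wnn by (intro mult_left_mono)
        then show ?thesis using wnn[of x] by (simp flip: scaleR_right_diff_distrib)
      qed (simp add: w0)
    qed
    also have "\<dots> = r / 2" using integral_unique[OF has_integral_mult_left[OF w1, of "r/2"]] by simp
    also have "\<dots> < r" using \<open>r > 0\<close> by simp
    finally show "norm (integral {0..1} (\<lambda>x. ((1/e n) * deriv F ((1/e n) * x + (- s/e n))) *\<^sub>R u x) - u s) < r"
      unfolding w_def .
  qed
qed

lemma smooth_step_range:
  assumes "smooth F" "\<And>t. t \<le> 0 \<Longrightarrow> F t = 0" "\<And>t. t \<ge> 1 \<Longrightarrow> F t = 1" "\<And>t. deriv F t \<ge> 0"
  shows "0 \<le> F t" "F t \<le> 1"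
proof -
  have mono: "F a \<le> F b" if "a \<le> b" for a b
    by (rule DERIV_nonneg_imp_nondecreasing[OF that])
      (use smooth_has_real_derivative[OF assms(1)] assms(4) in blast)
  show "0 \<le> F t" using mono[of "min t 0" t] assms(2)[of "min t 0"] by simp
  show "F t \<le> 1" using mono[of t "max t 1"] assms(3)[of "max t 1"] by simp
qed

text \<open>The weak derivative is tested with smooth indicators. On one side their derivatives
  average \<open>u\<close> near \<open>s\<close> and near \<open>t\<close>; on the other, dominated
  convergence yields the integral of \<open>g\<close> between these points.\<close>

lemma has_weak_deriv_imp_has_integral_interior:
  fixes u :: "real \<Rightarrow> 'a::euclidean_space"
  assumes u: "continuous_on {0..1} u" and g: "has_weak_deriv u g" and st: "0 < s" "s < t" "t < 1"
  shows "(g has_integral (u t - u s)) {s..t}"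
proof -
  obtain F :: "real \<Rightarrow> real" where F: "smooth F" "\<And>t. t \<le> 0 \<Longrightarrow> F t = 0" "\<And>t. t \<ge> 1 \<Longrightarrow> F t = 1"
    "\<And>t. deriv F t \<ge> 0" using smooth_step_exists by blast
  \<comment> \<open>With \<open>n + 2\<close> in the denominator, \<open>t + e n < 1\<close> is
    strict already for \<open>n = 0\<close>, as the support condition demands.\<close>
  define e where "e n = (1 - t) / real (n + 2)" for n
  have e: "e n > 0" "t + e n < 1" for n
  proof -
    have "(1 - t) / real (n + 2) < (1 - t) / 1"
      using st by (intro divide_strict_left_mono) auto
    then show "e n > 0" "t + e n < 1" using st by (auto simp: e_def)
  qed
  have e0: "e \<longlonglongrightarrow> 0" unfolding e_def by real_asymp
  define \<phi> where "\<phi> n x = F ((1/e n) * x + (- s/e n)) + (-1) * F ((1/e n) * x + (- t/e n))" for n x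
  define w where "w n s x = (1/e n) * deriv F ((1/e n) * x + (- s/e n))" for n s x
  have wF: "((\<lambda>x. F ((1/e n) * x + (- s/e n))) has_real_derivative w n s x) (at x)" for n s x
      unfolding w_def by (rule DERIV_chain2[OF smooth_has_real_derivative[OF F(1)], THEN DERIV_cong])
        (use e(1)[of n] in \<open>auto intro!: derivative_eq_intros\<close>)
  have wcont: "continuous_on A (w n s)" for A n s
      unfolding w_def by (intro continuous_intros smooth_continuous_on smooth_affine smooth_deriv F(1))
  have \<phi>': "deriv (\<phi> n) x = w n s x - w n t x" for n x
    unfolding \<phi>_def by (rule DERIV_imp_deriv) (use wF[of n s x] wF[of n t x] in \<open>auto intro!: derivative_eq_intros\<close>)
  have \<phi>_cont: "continuous_on A (\<phi> n)" for A n
    unfolding \<phi>_def by (intro smooth_continuous_on smooth_add smooth_mult smooth_const smooth_affine F(1))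
  have \<phi>_test: "test_function (\<phi> n)" for n
    unfolding \<phi>_def by (rule test_function_smooth_step) (use F st e in auto)
  have gL2: "g \<in> L2_space" using g by (simp add: has_weak_deriv_def)
  have g1: "integrable (lebesgue_on {0..1}) g" by (rule L2_space_integrable[OF gL2])
  have \<phi>_bound: "\<bar>\<phi> n x\<bar> \<le> 1" for n x
    using smooth_step_range[OF F, of "(1/e n) * x + (- s/e n)"] smooth_step_range[OF F, of "(1/e n) * x + (- t/e n)"]
    by (simp add: \<phi>_def abs_le_iff)
  have \<phi>g: "integrable (lebesgue_on {0..1}) (\<lambda>x. \<phi> n x *\<^sub>R g x)" for n
  proof (rule Bochner_Integration.integrable_bound[OF integrable_norm[OF g1]])
    show "(\<lambda>x. \<phi> n x *\<^sub>R g x) \<in> borel_measurable (lebesgue_on {0..1})"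
      by (intro borel_measurable_scaleR L2_space_measurable[OF gL2] continuous_imp_measurable_on_sets_lebesgue \<phi>_cont) auto
    show "AE x in lebesgue_on {0..1}. norm (\<phi> n x *\<^sub>R g x) \<le> norm (norm (g x))"
      using \<phi>_bound[of n] by (intro AE_I2) (auto intro: mult_left_le_one_le)
  qed
  have eq: "integral {0..1} (\<lambda>x. deriv (\<phi> n) x *\<^sub>R u x) = - integral {0..1} (\<lambda>x. \<phi> n x *\<^sub>R g x)" for n
  proof -
    have "continuous_on {0..1} (\<lambda>x. deriv (\<phi> n) x *\<^sub>R u x)"
      unfolding \<phi>' by (intro continuous_intros wcont u)
    then have "integrable (lebesgue_on {0..1}) (\<lambda>x. deriv (\<phi> n) x *\<^sub>R u x)"
      by (intro L2_space_integrable continuous_on_imp_L2_space)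
    then have "integral\<^sup>L (lebesgue_on {0..1}) (\<lambda>x. deriv (\<phi> n) x *\<^sub>R u x) = integral {0..1} (\<lambda>x. deriv (\<phi> n) x *\<^sub>R u x)"
      by (intro lebesgue_integral_eq_integral) auto
    moreover have "integral\<^sup>L (lebesgue_on {0..1}) (\<lambda>x. \<phi> n x *\<^sub>R g x) = integral {0..1} (\<lambda>x. \<phi> n x *\<^sub>R g x)"
      by (intro lebesgue_integral_eq_integral \<phi>g) auto
    ultimately show ?thesis using g \<phi>_test by (auto simp: has_weak_deriv_def)
  qed
  have "(\<lambda>n. integral {0..1} (\<lambda>x. w n s x *\<^sub>R u x) - integral {0..1} (\<lambda>x. w n t x *\<^sub>R u x)) \<longlonglongrightarrow> u s - u t"
    unfolding w_def
    by (intro tendsto_diff smooth_step_average_tendsto F u e e0) (use st in auto)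
  also have "(\<lambda>n. integral {0..1} (\<lambda>x. w n s x *\<^sub>R u x) - integral {0..1} (\<lambda>x. w n t x *\<^sub>R u x)) =
      (\<lambda>n. integral {0..1} (\<lambda>x. deriv (\<phi> n) x *\<^sub>R u x))"
    unfolding \<phi>' scaleR_left_diff_distrib
    by (subst Henstock_Kurzweil_Integration.integral_diff)
      (auto intro!: integrable_continuous_interval continuous_intros wcont u)
  finally have lim1: "(\<lambda>n. integral {0..1} (\<lambda>x. \<phi> n x *\<^sub>R g x)) \<longlonglongrightarrow> u t - u s"
    unfolding eq using tendsto_minus by fastforce
  have "(\<lambda>n. integral {0..1} (\<lambda>x. \<phi> n x *\<^sub>R g x)) \<longlonglongrightarrow> integral {0..1} (\<lambda>x. if x \<in> {s<..t} then g x else 0)"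
  proof (rule dominated_convergence(2)[where h = "\<lambda>x. norm (g x)"])
    show "(\<lambda>x. \<phi> n x *\<^sub>R g x) integrable_on {0..1}" for n
      by (rule integrable_on_lebesgue_on[OF \<phi>g]) auto
    show "(\<lambda>x. norm (g x)) integrable_on {0..1}"
      by (rule integrable_on_lebesgue_on[OF integrable_norm[OF g1]]) auto
    show "norm (\<phi> n x *\<^sub>R g x) \<le> norm (g x)" for n x
      using \<phi>_bound[of n x] by (auto intro: mult_left_le_one_le)
    \<comment> \<open>At \<open>x = s\<close> the step is 0, so the smooth indicators converge to
      the indicator of a half-open interval; the point \<open>s\<close> is later discarded as
      negligible.\<close>
    have step: "(\<lambda>n. F ((1/e n) * x + (- s/e n))) \<longlonglongrightarrow> (if x > s then 1 else 0)" for x s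
    proof (cases "x > s")
      case True
      then have "eventually (\<lambda>n. e n < x - s) sequentially"
        using order_tendstoD(2)[OF e0, of "x - s"] by simp
      then have "eventually (\<lambda>n. 1 = F ((1/e n) * x + (- s/e n))) sequentially"
      proof eventually_elim
        case (elim n)
        then show ?case using affine_ge_1[OF e(1), of s n x] by (intro F(3)[symmetric]) simp
      qed
      then show ?thesis using True by (auto intro: Lim_transform_eventually)
    next
      case False
      then have "F ((1/e n) * x + (- s/e n)) = 0" for n
        using affine_le_0[OF e(1)[of n], of x s] by (intro F(2)) simp
      then show ?thesis using False by simp
    qed
    show "(\<lambda>n. \<phi> n x *\<^sub>R g x) \<longlonglongrightarrow> (if x \<in> {s<..t} then g x else 0)" for x
    proof -
      have "(\<lambda>n. \<phi> n x *\<^sub>R g x) \<longlonglongrightarrow> ((if x > s then 1 else 0) + (-1) * (if x > t then 1 else 0)) *\<^sub>R g x"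
        unfolding \<phi>_def by (intro tendsto_intros step)
      then show ?thesis using st by (auto split: if_splits)
    qed
  qed
  then have lim: "integral {0..1} (\<lambda>x. if x \<in> {s<..t} then g x else 0) = u t - u s"
    using lim1 LIMSEQ_unique by blast
  have gi: "g integrable_on {s..t}"
    using absolutely_integrable_on_subinterval'[OF L2_space_absolutely_integrable[OF gL2], of s t] st
    by (simp add: absolutely_integrable_on_def)
  have "integral {0..1} (\<lambda>x. if x \<in> {s<..t} then g x else 0) = integral {0..1} (\<lambda>x. if x \<in> {s..t} then g x else 0)"
    by (rule integral_spike[of "{s}"]) auto
  also have "\<dots> = integral {s..t} g"
    using integral_restrict_Int[of "{0..1}" "{s..t}" g] st by (simp add: Int_absorb1)
  finally show ?thesis using gi lim by (metis integrable_integral)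
qed

text \<open>Test functions see only the open interval, so the interior identity makes
  \<open>G\<close> constant there. Continuity of \<open>u\<close> and of the integral extends the
  identity to the endpoints.\<close>

lemma has_weak_deriv_imp_indefinite_integral:
  fixes u :: "real \<Rightarrow> 'a::euclidean_space"
  assumes u: "continuous_on {0..1} u" and g: "has_weak_deriv u g"
  shows "indefinite_integral u g"
proof -
  have gL2: "g \<in> L2_space" using g by (simp add: has_weak_deriv_def)
  have gi: "g integrable_on {0..1}"
    using L2_space_absolutely_integrable[OF gL2] by (simp add: absolutely_integrable_on_def)
  define G where "G t = integral {0..t} g - u t" for t
  define c where "c = G (1/2)"
  have "continuous_on {0..1} G"
    unfolding G_def by (intro continuous_intros indefinite_integral_continuous_1 gi u)
  moreover have "G t = c" if "t \<in> {0<..<1}" for t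
  proof -
    have "G t = G s" if "0 < s" "s < t" "t < 1" for s t
    proof -
      have "integral {0..s} g + integral {s..t} g = integral {0..t} g"
        by (rule Henstock_Kurzweil_Integration.integral_combine) (use that integrable_on_subinterval[OF gi, of 0 t] in auto)
      then have "integral {0..t} g = integral {0..s} g + (u t - u s)"
        using has_weak_deriv_imp_has_integral_interior[OF u g that] by (simp add: integral_unique)
      then show ?thesis by (simp add: G_def)
    qed
    note * = this[of t "1/2"] this[of "1/2" t]
    consider "t = 1/2" | "t < 1/2" | "t > 1/2" by linarith
    then have "G t = G (1/2)" by cases (use * \<open>t \<in> {0<..<1}\<close> in \<open>auto simp only: greaterThanLessThan_iff\<close>)
    then show ?thesis by (simp add: c_def)
  qed
  ultimately have "G t = c" if "t \<in> closure {0<..<1}" for t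
    using that by (intro continuous_constant_on_closure[of "{0<..<1}" G c t]) (auto simp: closure_greaterThanLessThan)
  then have const: "G t = c" if "t \<in> {0..1}" for t
    using that by (simp add: closure_greaterThanLessThan)
  show ?thesis unfolding indefinite_integral_def
  proof (intro ballI impI)
    fix s t :: real assume st: "s \<in> {0..1}" "t \<in> {0..1}" "s \<le> t"
    have "g integrable_on {s..t}" using integrable_on_subinterval[OF gi, of s t] st by auto
    moreover have "integral {0..s} g + integral {s..t} g = integral {0..t} g"
      by (rule Henstock_Kurzweil_Integration.integral_combine) (use st integrable_on_subinterval[OF gi, of 0 t] in auto)
    moreover have "G s = G t" using const[OF st(1)] const[OF st(2)] by simp
    moreover have "u t - u s = integral {0..t} g - integral {0..s} g"
      using \<open>G s = G t\<close> by (simp add: G_def algebra_simps)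
    ultimately have "u t - u s = integral {s..t} g" "g integrable_on {s..t}" by (metis add_diff_cancel_left', simp)
    then show "(g has_integral u t - u s) {s..t}" by (simp add: integrable_integral)
  qed
qed

section \<open>From indefinite integrals back to weak derivatives\<close>

lemma indefinite_integral_continuous_on:
  fixes u :: "real \<Rightarrow> 'a::euclidean_space"
  assumes "indefinite_integral u g"
  shows "continuous_on {0..1} u"
proof -
  have *: "(g has_integral (u t - u 0)) {0..t}" if "t \<in> {0..1}" for t
    using assms that unfolding indefinite_integral_def by auto
  have "continuous_on {0..1} (\<lambda>t. u 0 + integral {0..t} g)"
    by (intro continuous_intros indefinite_integral_continuous_1) (use *[of 1] in auto)
  then show ?thesis
    by (rule continuous_on_eq) (simp add: integral_unique[OF *])
qed

text \<open>The difference quotient of \<open>G\<close> at \<open>s\<close> is at most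
  \<open>\<bar>H t - H s\<bar>\<close>, which tends to 0 by continuity, so the derivative vanishes
  at every point. This form of the bound suits integration by parts with a merely integrable
  density, where \<open>H\<close> is a multiple of its cumulative norm.\<close>

lemma constant_if_increments_small:
  fixes G :: "real \<Rightarrow> 'a::real_normed_vector" and H :: "real \<Rightarrow> real"
  assumes H: "continuous_on {0..1} H"
    and G: "\<And>s t. 0 \<le> s \<Longrightarrow> s \<le> t \<Longrightarrow> t \<le> 1 \<Longrightarrow> norm (G t - G s) \<le> (t - s) * \<bar>H t - H s\<bar>"
  shows "G 1 = G 0"
proof -
  have G': "norm (G t - G s) \<le> \<bar>t - s\<bar> * \<bar>H t - H s\<bar>" if "s \<in> {0..1}" "t \<in> {0..1}" for s t
    using G[of s t] G[of t s] that by (cases "s \<le> t") (auto simp: norm_minus_commute abs_minus_commute)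
  have "(G has_derivative (\<lambda>h. 0)) (at s within {0..1})" if s: "s \<in> {0..1}" for s
    unfolding has_derivative_iff_norm
  proof (intro conjI)
    have "((\<lambda>t. H t - H s) \<longlongrightarrow> H s - H s) (at s within {0..1})"
      using H s by (intro tendsto_intros) (auto simp: continuous_on)
    then have lim: "((\<lambda>t. \<bar>H t - H s\<bar>) \<longlongrightarrow> 0) (at s within {0..1})"
      by (simp add: tendsto_rabs_zero)
    show "((\<lambda>t. norm (G t - G s - 0) / norm (t - s)) \<longlongrightarrow> 0) (at s within {0..1})"
    proof (rule tendsto_sandwich[OF _ _ tendsto_const lim])
      show "\<forall>\<^sub>F t in at s within {0..1}. norm (G t - G s - 0) / norm (t - s) \<le> \<bar>H t - H s\<bar>"
        using G'[OF s] unfolding eventually_at_filter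
        by (auto simp: divide_simps mult.commute)
    qed auto
  qed simp
  then show ?thesis
    using has_derivative_zero_constant[of "{0..1}" G] by (metis atLeastAtMost_iff convex_real_interval(5) order_refl zero_le_one)
qed

lemma test_functionD:
  assumes "test_function \<phi>"
  shows "smooth \<phi>" "\<phi> 0 = 0" "\<phi> 1 = 0"
proof -
  show "smooth \<phi>" using assms by (simp add: test_function_def smooth_def)
  have "t \<notin> closure {t. \<phi> t \<noteq> 0}" if "t \<notin> {0<..<1}" for t using assms that by (auto simp: test_function_def)
  then show "\<phi> 0 = 0" "\<phi> 1 = 0" by (metis (mono_tags) closure_subset greaterThanLessThan_iff less_irrefl mem_Collect_eq subsetD)+
qed

text \<open>Integration by parts: the increments of \<open>\<phi> u - \<integral> \<phi>' u - \<integral> \<phi> g\<close> over \<open>[s, t]\<close> are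
  \<open>O((t - s) \<integral>\<^sub>s\<^sup>t |g|)\<close>, so this function has derivative zero everywhere, although \<open>u\<close> itself need not
  be differentiable.\<close>

lemma indefinite_integral_imp_has_weak_deriv:
  fixes u :: "real \<Rightarrow> 'a::euclidean_space"
  assumes g: "g \<in> L2_space" and ug: "indefinite_integral u g"
  shows "has_weak_deriv u g"
  unfolding has_weak_deriv_def
proof (intro conjI g allI impI)
  fix \<phi> assume "test_function \<phi>"
  note \<phi> = test_functionD[OF this]
  have u: "continuous_on {0..1} u" by (rule indefinite_integral_continuous_on[OF ug])
  have \<phi>c: "continuous_on A \<phi>" "continuous_on A (deriv \<phi>)" for A
    using \<phi> by (auto intro: smooth_continuous_on smooth_deriv)
  have gabs: "g absolutely_integrable_on {0..1}" by (rule L2_space_absolutely_integrable[OF g])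
  have gi: "g integrable_on {s..t}" "(\<lambda>x. norm (g x)) integrable_on {s..t}" if "0 \<le> s" "t \<le> 1" for s t
    using absolutely_integrable_on_subinterval'[OF gabs that] by (auto simp: absolutely_integrable_on_def)
  have \<phi>g: "(\<lambda>x. \<phi> x *\<^sub>R g x) absolutely_integrable_on {0..1}"
  proof (rule absolutely_integrable_bounded_measurable_product[OF bilinear_conv_bounded_bilinear[THEN iffD2, OF bounded_bilinear_scaleR] _ _ _ gabs])
    show "\<phi> \<in> borel_measurable (lebesgue_on {0..1})"
      by (intro continuous_imp_measurable_on_sets_lebesgue \<phi>c) auto
    show "bounded (\<phi> ` {0..1})" by (intro compact_imp_bounded compact_continuous_image \<phi>c) auto
  qed auto
  have \<phi>gi: "(\<lambda>x. \<phi> x *\<^sub>R g x) integrable_on {s..t}" if "0 \<le> s" "t \<le> 1" for s t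
    using absolutely_integrable_on_subinterval'[OF \<phi>g that] by (auto simp: absolutely_integrable_on_def)
  have \<phi>ui: "(\<lambda>x. deriv \<phi> x *\<^sub>R u x) integrable_on {s..t}" if "0 \<le> s" "t \<le> 1" for s t
    using that by (intro integrable_continuous_interval continuous_intros \<phi>c continuous_on_subset[OF u]) auto
  obtain M where M: "\<And>x. x \<in> {0..1} \<Longrightarrow> \<bar>deriv \<phi> x\<bar> \<le> M" "M > 0"
  proof -
    have "bounded (deriv \<phi> ` {0..1})" by (intro compact_imp_bounded compact_continuous_image \<phi>c) auto
    then show ?thesis using that unfolding bounded_pos by (metis imageI real_norm_def)
  qed
  \<comment> \<open>Each of the two error integrals below contributes
    \<open>M * (t - s) * h\<close>; hence the factor 2.\<close>
  define H where "H t = 2 * M * integral {0..t} (\<lambda>x. norm (g x))" for t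
  define G where "G t = \<phi> t *\<^sub>R u t - integral {0..t} (\<lambda>x. deriv \<phi> x *\<^sub>R u x) - integral {0..t} (\<lambda>x. \<phi> x *\<^sub>R g x)" for t
  have "G 1 = G 0"
  proof (rule constant_if_increments_small)
    show "continuous_on {0..1} H" unfolding H_def
      by (intro continuous_intros indefinite_integral_continuous_1 gi) auto
    fix s t :: real assume st: "0 \<le> s" "s \<le> t" "t \<le> 1"
    define h where "h = integral {s..t} (\<lambda>x. norm (g x))"
    have comb: "integral {0..t} f - integral {0..s} f = integral {s..t} f"
      if "f integrable_on {0..t}" for f :: "real \<Rightarrow> 'b::euclidean_space"
      using Henstock_Kurzweil_Integration.integral_combine[of 0 s t f] st that by (simp add: algebra_simps)
    have combr: "integral {0..t} f - integral {0..s} f = integral {s..t} f"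
      if "f integrable_on {0..t}" for f :: "real \<Rightarrow> real"
      using Henstock_Kurzweil_Integration.integral_combine[of 0 s t f] st that by (simp add: algebra_simps)
    have hnn: "h \<ge> 0" unfolding h_def by (rule Henstock_Kurzweil_Integration.integral_nonneg) (use gi st in auto)
    have Hd: "H t - H s = 2 * M * h"
      unfolding H_def h_def using combr[OF gi(2)[of 0 t]] st by (simp flip: right_diff_distrib)
    have ur: "norm (u t - u r) \<le> h" if "r \<in> {s..t}" for r
    proof -
      have "u t - u r = integral {r..t} g"
        using ug that st by (intro integral_unique[symmetric]) (auto simp: indefinite_integral_def)
      also have "norm \<dots> \<le> integral {r..t} (\<lambda>x. norm (g x))"
        by (rule integral_norm_bound_integral) (use that st gi in auto)
      also have "\<dots> \<le> h" unfolding h_def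
        by (rule integral_subset_le) (use that st gi in auto)
      finally show ?thesis .
    qed
    have \<phi>r: "\<bar>\<phi> s - \<phi> r\<bar> \<le> M * (t - s)" if r: "r \<in> {s..t}" for r
    proof -
      have "norm (\<phi> r - \<phi> s) \<le> M * norm (r - s)"
        by (rule field_differentiable_bound[of "{s..t}"])
          (use M st r in \<open>auto intro: has_field_derivative_at_within smooth_has_real_derivative[OF \<phi>(1)]\<close>)
      also have "\<dots> \<le> M * (t - s)" using r M by (intro mult_left_mono) auto
      finally show ?thesis by (simp add: abs_minus_commute)
    qed
    have i1: "((\<lambda>r. deriv \<phi> r *\<^sub>R u t) has_integral (\<phi> t - \<phi> s) *\<^sub>R u t) {s..t}"
    proof (rule has_integral_scaleR_left)
      show "(deriv \<phi> has_integral \<phi> t - \<phi> s) {s..t}"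
        by (rule fundamental_theorem_of_calculus[OF st(2)])
          (use smooth_has_real_derivative[OF \<phi>(1)] in \<open>auto intro: has_vector_derivative_at_within simp: has_real_derivative_iff_has_vector_derivative\<close>)
    qed
    have i2: "((\<lambda>r. \<phi> s *\<^sub>R g r) has_integral \<phi> s *\<^sub>R (u t - u s)) {s..t}"
      using ug st by (intro has_integral_cmul) (auto simp: indefinite_integral_def)
    \<comment> \<open>The increment of the product is split as (\<phi> t - \<phi> s) u t + \<phi> s
      (u t - u s), so each part is compared with its own integral while one factor is
      frozen.\<close>
    have "G t - G s = ((\<phi> t - \<phi> s) *\<^sub>R u t - integral {s..t} (\<lambda>x. deriv \<phi> x *\<^sub>R u x))
        + (\<phi> s *\<^sub>R (u t - u s) - integral {s..t} (\<lambda>x. \<phi> x *\<^sub>R g x))"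
      using comb[OF \<phi>gi[of 0 t]] comb[OF \<phi>ui[of 0 t]] st by (simp add: G_def algebra_simps)
    also have "\<dots> = integral {s..t} (\<lambda>r. deriv \<phi> r *\<^sub>R u t - deriv \<phi> r *\<^sub>R u r)
        + integral {s..t} (\<lambda>r. \<phi> s *\<^sub>R g r - \<phi> r *\<^sub>R g r)"
      using integral_unique[OF has_integral_diff[OF i1 integrable_integral[OF \<phi>ui[of s t]]]]
        integral_unique[OF has_integral_diff[OF i2 integrable_integral[OF \<phi>gi[of s t]]]] st by simp
    finally have eq: "G t - G s = integral {s..t} (\<lambda>r. deriv \<phi> r *\<^sub>R u t - deriv \<phi> r *\<^sub>R u r)
        + integral {s..t} (\<lambda>r. \<phi> s *\<^sub>R g r - \<phi> r *\<^sub>R g r)" .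
    have b1: "norm (integral {s..t} (\<lambda>r. deriv \<phi> r *\<^sub>R u t - deriv \<phi> r *\<^sub>R u r)) \<le> integral {s..t} (\<lambda>r. M * h)"
    proof (rule integral_norm_bound_integral)
      show "(\<lambda>r. deriv \<phi> r *\<^sub>R u t - deriv \<phi> r *\<^sub>R u r) integrable_on {s..t}"
        using i1 \<phi>ui[of s t] st by (intro integrable_diff) (auto simp: has_integral_integrable)
      fix r assume r: "r \<in> {s..t}"
      have "norm (deriv \<phi> r *\<^sub>R (u t - u r)) \<le> M * h"
        unfolding norm_scaleR by (intro mult_mono) (use M r st ur[OF r] in auto)
      then show "norm (deriv \<phi> r *\<^sub>R u t - deriv \<phi> r *\<^sub>R u r) \<le> M * h" by (simp add: scaleR_right_diff_distrib)
    qed auto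
    have b2: "norm (integral {s..t} (\<lambda>r. \<phi> s *\<^sub>R g r - \<phi> r *\<^sub>R g r)) \<le> integral {s..t} (\<lambda>r. (M * (t - s)) * norm (g r))"
    proof (rule integral_norm_bound_integral)
      show "(\<lambda>r. \<phi> s *\<^sub>R g r - \<phi> r *\<^sub>R g r) integrable_on {s..t}"
        using i2 \<phi>gi[of s t] st by (intro integrable_diff) (auto simp: has_integral_integrable)
      show "(\<lambda>r. (M * (t - s)) * norm (g r)) integrable_on {s..t}"
        using gi(2)[of s t] st by (intro integrable_on_mult_right) auto
      fix r assume r: "r \<in> {s..t}"
      have "norm ((\<phi> s - \<phi> r) *\<^sub>R g r) \<le> (M * (t - s)) * norm (g r)"
        unfolding norm_scaleR using \<phi>r[OF r] by (intro mult_right_mono) auto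
      then show "norm (\<phi> s *\<^sub>R g r - \<phi> r *\<^sub>R g r) \<le> (M * (t - s)) * norm (g r)" by (simp add: scaleR_left_diff_distrib)
    qed
    have "norm (G t - G s) \<le> (t - s) * (M * h) + M * (t - s) * h"
      unfolding eq using b1 b2 st
      by (intro norm_triangle_le add_mono) (auto simp: h_def mult_ac)
    also have "\<dots> = (t - s) * \<bar>H t - H s\<bar>" using hnn M by (simp add: Hd)
    finally show "norm (G t - G s) \<le> (t - s) * \<bar>H t - H s\<bar>" .
  qed
  then have "- integral {0..1} (\<lambda>x. deriv \<phi> x *\<^sub>R u x) = integral {0..1} (\<lambda>x. \<phi> x *\<^sub>R g x)"
    using \<phi> by (simp add: G_def)
  then have "integral {0..1} (\<lambda>x. deriv \<phi> x *\<^sub>R u x) = - integral {0..1} (\<lambda>x. \<phi> x *\<^sub>R g x)"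
    by (metis minus_minus)
  moreover have "integral\<^sup>L (lebesgue_on {0..1}) (\<lambda>x. deriv \<phi> x *\<^sub>R u x) = integral {0..1} (\<lambda>x. deriv \<phi> x *\<^sub>R u x)"
    by (intro lebesgue_integral_eq_integral L2_space_integrable continuous_on_imp_L2_space continuous_intros \<phi>c u) auto
  moreover have "integral\<^sup>L (lebesgue_on {0..1}) (\<lambda>x. \<phi> x *\<^sub>R g x) = integral {0..1} (\<lambda>x. \<phi> x *\<^sub>R g x)"
    by (intro lebesgue_integral_eq_integral absolutely_integrable_imp_integrable \<phi>g) auto
  ultimately show "integral\<^sup>L (lebesgue_on {0..1}) (\<lambda>t. deriv \<phi> t *\<^sub>R u t) =
      - integral\<^sup>L (lebesgue_on {0..1}) (\<lambda>t. \<phi> t *\<^sub>R g t)" by simp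
qed

text \<open>Since the integral over every cell vanishes, Henstock's lemma bounds the Riemann sums of
  \<open>norm (f x)\<close> themselves. So \<open>norm (f x)\<close> has integral 0, and a
  nonnegative function with integral 0 vanishes almost everywhere.\<close>

lemma AE_zero_if_all_integrals_zero:
  fixes f :: "real \<Rightarrow> 'a::euclidean_space"
  assumes f: "\<And>s t. 0 \<le> s \<Longrightarrow> s \<le> t \<Longrightarrow> t \<le> 1 \<Longrightarrow> (f has_integral 0) {s..t}"
  shows "AE x in lebesgue_on {0..1}. f x = 0"
proof -
  have fi: "f integrable_on cbox 0 1" using f[of 0 1] by auto
  have "((\<lambda>x. norm (f x)) has_integral 0) (cbox 0 1)"
    unfolding has_integral
  proof (intro allI impI)
    fix e :: real assume "e > 0"
    from Henstock_lemma[OF fi this] obtain \<gamma> where \<gamma>: "gauge \<gamma>"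
      "\<And>p. p tagged_partial_division_of cbox 0 1 \<Longrightarrow> \<gamma> fine p \<Longrightarrow>
        (\<Sum>(x,k)\<in>p. norm (measure lborel k *\<^sub>R f x - integral k f)) < e" by blast
    show "\<exists>\<gamma>. gauge \<gamma> \<and> (\<forall>\<D>. \<D> tagged_division_of cbox 0 1 \<and> \<gamma> fine \<D> \<longrightarrow>
        norm ((\<Sum>(x,k)\<in>\<D>. measure lborel k *\<^sub>R norm (f x)) - 0) < e)"
    proof (intro exI[of _ \<gamma>] conjI \<gamma>(1) allI impI)
      fix \<D> assume \<D>: "\<D> tagged_division_of cbox (0::real) 1 \<and> \<gamma> fine \<D>"
      have "(\<Sum>(x,k)\<in>\<D>. measure lborel k *\<^sub>R norm (f x)) = (\<Sum>(x,k)\<in>\<D>. norm (measure lborel k *\<^sub>R f x - integral k f))"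
      proof (rule sum.cong, simp, clarify)
        fix x k assume xk: "(x, k) \<in> \<D>"
        obtain a b where k: "k = cbox a b" using tagged_division_ofD(4)[of \<D> "cbox 0 1" x k] \<D> xk by blast
        moreover have "k \<subseteq> cbox 0 1" using tagged_division_ofD(3)[of \<D> "cbox 0 1" x k] \<D> xk by blast
        ultimately have "integral k f = 0"
          using f[of a b] by (cases "a \<le> b") (auto simp: integral_unique)
        then show "measure lborel k *\<^sub>R norm (f x) = norm (measure lborel k *\<^sub>R f x - integral k f)" by simp
      qed
      also have "\<dots> < e" using \<gamma>(2) \<D> tagged_division_of_def by blast
      finally have "(\<Sum>(x,k)\<in>\<D>. measure lborel k *\<^sub>R norm (f x)) < e" .
      moreover have "(\<Sum>(x,k)\<in>\<D>. measure lborel k *\<^sub>R norm (f x)) \<ge> 0"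
        by (intro sum_nonneg) auto
      ultimately show "norm ((\<Sum>(x,k)\<in>\<D>. measure lborel k *\<^sub>R norm (f x)) - 0) < e" by simp
    qed
  qed
  then have hi: "((\<lambda>x. norm (f x)) has_integral 0) {0..1}" by simp
  then have int: "integrable (lebesgue_on {0..1}) (\<lambda>x. norm (f x))"
    by (intro absolutely_integrable_imp_integrable nonnegative_absolutely_integrable_1) (auto simp: has_integral_integrable)
  have "integral\<^sup>L (lebesgue_on {0..1}) (\<lambda>x. norm (f x)) = 0"
    using lebesgue_integral_eq_integral[OF int] integral_unique[OF hi] by simp
  then have "AE x in lebesgue_on {0..1}. norm (f x) = 0"
    using integral_nonneg_eq_0_iff_AE[OF int] by simp
  then show ?thesis by simp
qed

lemma indefinite_integral_unique:
  fixes u :: "real \<Rightarrow> 'a::euclidean_space"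
  assumes "indefinite_integral u g" "indefinite_integral u g'"
  shows "AE t in lebesgue_on {0..1}. g t = g' t"
proof -
  have "AE x in lebesgue_on {0..1}. g x - g' x = 0"
  proof (rule AE_zero_if_all_integrals_zero)
    fix s t :: real assume "0 \<le> s" "s \<le> t" "t \<le> 1"
    then have "(g has_integral u t - u s) {s..t}" "(g' has_integral u t - u s) {s..t}"
      using assms by (auto simp: indefinite_integral_def)
    from has_integral_diff[OF this] show "((\<lambda>x. g x - g' x) has_integral 0) {s..t}" by simp
  qed
  then show ?thesis by simp
qed

section \<open>Step functions\<close>

text \<open>The floor makes the j-th cell \<open>[j/m, (j+1)/m)\<close>, and pointwise operations on
  \<open>v\<close> commute with \<open>step_fun\<close> by unfolding. The value at 1 is
  \<open>v m\<close>, outside the sums over \<open>{..<m}\<close>; a null set hides it.\<close>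

definition step_fun :: "nat \<Rightarrow> (nat \<Rightarrow> 'a) \<Rightarrow> real \<Rightarrow> 'a" where
  "step_fun m v t = v (nat \<lfloor>real m * t\<rfloor>)"

lemma step_fun_eq:
  assumes "m > 0" "real j / real m \<le> t" "t < real (Suc j) / real m"
  shows "step_fun m v t = v j"
proof -
  have "real j \<le> real m * t" "real m * t < real j + 1"
    using assms by (simp_all add: field_simps)
  then have "\<lfloor>real m * t\<rfloor> = int j" by (simp add: floor_eq_iff)
  then show ?thesis by (simp add: step_fun_def)
qed

lemma step_fun_has_integral:
  fixes v :: "nat \<Rightarrow> 'a::euclidean_space"
  assumes m: "m > 0"
  shows "(step_fun m v has_integral (\<Sum>i<j. (1 / real m) *\<^sub>R v i)) {0..real j / real m}"
proof (induction j)
  case (Suc j)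
  have "((\<lambda>_. v j) has_integral (real (Suc j) / real m - real j / real m) *\<^sub>R v j) {real j / real m..real (Suc j) / real m}"
    using has_integral_const_real[of "v j" "real j / real m" "real (Suc j) / real m"] m
    by (simp add: field_simps)
  then have "(step_fun m v has_integral (real (Suc j) / real m - real j / real m) *\<^sub>R v j) {real j / real m..real (Suc j) / real m}"
  proof (rule has_integral_spike[of "{real (Suc j) / real m}", rotated 2])
    show "step_fun m v t = v j" if "t \<in> {real j / real m..real (Suc j) / real m} - {real (Suc j) / real m}" for t
      using that by (intro step_fun_eq m) auto
  qed auto
  moreover have "real (Suc j) / real m - real j / real m = 1 / real m" using m by (simp add: field_simps)
  ultimately have "(step_fun m v has_integral (\<Sum>i<j. (1 / real m) *\<^sub>R v i) + (1 / real m) *\<^sub>R v j) {0..real (Suc j) / real m}"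
    using m by (intro has_integral_combine[OF _ _ Suc]) (auto simp: field_simps)
  then show ?case by simp
qed (simp add: has_integral_refl)

lemma step_fun_integrable:
  fixes v :: "nat \<Rightarrow> 'a::euclidean_space"
  assumes m: "m > 0"
  shows "integrable (lebesgue_on {0..1}) (step_fun m v)"
    and "integral\<^sup>L (lebesgue_on {0..1}) (step_fun m v) = (\<Sum>i<m. (1 / real m) *\<^sub>R v i)"
proof -
  have 1: "(step_fun m v has_integral (\<Sum>i<m. (1 / real m) *\<^sub>R v i)) {0..1}"
    using step_fun_has_integral[OF m, of v m] m by simp
  have 2: "(step_fun m (\<lambda>i. norm (v i)) has_integral (\<Sum>i<m. (1 / real m) *\<^sub>R norm (v i))) {0..1}"
    using step_fun_has_integral[OF m, of "\<lambda>i. norm (v i)" m] m by simp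
  have "step_fun m v absolutely_integrable_on {0..1}"
  proof (rule absolutely_integrable_onI)
    show "step_fun m v integrable_on {0..1}" using 1 by (rule has_integral_integrable)
    have "(\<lambda>x. norm (step_fun m v x)) = step_fun m (\<lambda>i. norm (v i))" by (auto simp: step_fun_def)
    then show "(\<lambda>x. norm (step_fun m v x)) integrable_on {0..1}" using 2 by (simp add: has_integral_integrable)
  qed
  then show int: "integrable (lebesgue_on {0..1}) (step_fun m v)"
    by (intro absolutely_integrable_imp_integrable) auto
  show "integral\<^sup>L (lebesgue_on {0..1}) (step_fun m v) = (\<Sum>i<m. (1 / real m) *\<^sub>R v i)"
    using lebesgue_integral_eq_integral[OF int] integral_unique[OF 1] by simp
qed

lemma step_fun_refine:
  assumes "P > 0" "t \<ge> 0"
  shows "step_fun m v t = step_fun (m * P) (\<lambda>i. v (i div P)) t"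
proof -
  have "nat \<lfloor>real m * t\<rfloor> = nat (\<lfloor>real (m * P) * t\<rfloor> div int P)"
    using floor_divide_real_eq_div[of "int P" "real (m * P) * t"] assms by (simp add: field_simps)
  then show ?thesis using assms by (simp add: step_fun_def nat_div_distrib)
qed

section \<open>Difference quotients\<close>

definition diff_quot :: "(real \<Rightarrow> 'a::real_vector) \<Rightarrow> nat \<Rightarrow> nat \<Rightarrow> 'a" where
  "diff_quot u m i = real m *\<^sub>R (u (real (Suc i) / real m) - u (real i / real m))"

text \<open>Squaring a quotient gives \<open>m\<close> squared and a cell has length
  \<open>1/m\<close>, so one factor \<open>m\<close> remains: this is the squared
  \<open>L\<^sup>2\<close> norm, measured with \<open>N\<close>, of the step function of difference
  quotients.\<close>

definition quot_energy :: "('a::real_vector \<Rightarrow> real) \<Rightarrow> (real \<Rightarrow> 'a) \<Rightarrow> nat \<Rightarrow> real" where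
  "quot_energy N u m = real m * (\<Sum>i<m. (N (u (real (Suc i) / real m) - u (real i / real m)))\<^sup>2)"

lemma quot_energy_eq:
  assumes "is_norm N" "m > 0"
  shows "quot_energy N u m = (\<Sum>i<m. (1 / real m) *\<^sub>R (N (diff_quot u m i))\<^sup>2)"
  unfolding quot_energy_def sum_distrib_left diff_quot_def is_norm_scaleR[OF assms(1)]
  using assms(2) by (intro sum.cong) (auto simp: power_mult_distrib power2_eq_square)

lemma integral_diff_quot_sq:
  fixes u :: "real \<Rightarrow> 'a::euclidean_space"
  assumes "is_norm N" "m > 0"
  shows "integrable (lebesgue_on {0..1}) (\<lambda>t. (N (step_fun m (diff_quot u m) t))\<^sup>2)"
    and "integral\<^sup>L (lebesgue_on {0..1}) (\<lambda>t. (N (step_fun m (diff_quot u m) t))\<^sup>2) = quot_energy N u m"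
proof -
  have *: "(\<lambda>t. (N (step_fun m (diff_quot u m) t))\<^sup>2) = step_fun m (\<lambda>i. (N (diff_quot u m i))\<^sup>2)"
    by (auto simp: step_fun_def)
  show "integrable (lebesgue_on {0..1}) (\<lambda>t. (N (step_fun m (diff_quot u m) t))\<^sup>2)"
    unfolding * by (rule step_fun_integrable[OF assms(2)])
  show "integral\<^sup>L (lebesgue_on {0..1}) (\<lambda>t. (N (step_fun m (diff_quot u m) t))\<^sup>2) = quot_energy N u m"
    unfolding * step_fun_integrable(2)[OF assms(2)] quot_energy_eq[OF assms] ..
qed

text \<open>The step functions of difference quotients form a martingale along refinements of the partition,
  so their increments are orthogonal in \<open>L\<^sup>2\<close>.\<close>

lemma integral_diff_quot_refine:
  fixes u :: "real \<Rightarrow> 'a::euclidean_space"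
  assumes m: "m > 0" and P: "P > 0"
  shows "integrable (lebesgue_on {0..1}) (\<lambda>t. (norm (step_fun (m * P) (diff_quot u (m * P)) t - step_fun m (diff_quot u m) t))\<^sup>2)"
    and "integral\<^sup>L (lebesgue_on {0..1}) (\<lambda>t. (norm (step_fun (m * P) (diff_quot u (m * P)) t - step_fun m (diff_quot u m) t))\<^sup>2)
      = quot_energy norm u (m * P) - quot_energy norm u m"
proof -
  let ?a = "diff_quot u (m * P)" and ?b = "diff_quot u m"
  have mP: "m * P > 0" using m P by simp
  have *: "(norm (step_fun (m * P) ?a t - step_fun m ?b t))\<^sup>2 = step_fun (m * P) (\<lambda>i. (norm (?a i - ?b (i div P)))\<^sup>2) t"
    if "t \<in> {0..1}" for t
    using step_fun_refine[OF P, of t m ?b] that by (simp add: step_fun_def)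
  show "integrable (lebesgue_on {0..1}) (\<lambda>t. (norm (step_fun (m * P) ?a t - step_fun m ?b t))\<^sup>2)"
    using step_fun_integrable(1)[OF mP, of "\<lambda>i. (norm (?a i - ?b (i div P)))\<^sup>2"]
    by (subst Bochner_Integration.integrable_cong[OF refl]) (use * in \<open>auto simp: space_restrict_space\<close>)
  \<comment> \<open>A variance identity on each coarse cell: the coarse quotient is the mean of the
    \<open>P\<close> fine quotients, so the squared deviations sum to the sum of squares minus
    \<open>P\<close> times the squared mean.\<close>
  have block: "(\<Sum>i=j*P..<j*P+P. (norm (?a i - ?b (i div P)))\<^sup>2) = (\<Sum>i=j*P..<j*P+P. (norm (?a i))\<^sup>2) - real P * (norm (?b j))\<^sup>2" for j
  proof -
    have "(\<Sum>i=j*P..<j*P+P. u (real (Suc i) / real (m * P)) - u (real i / real (m * P)))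
        = u (real (j * P + P) / real (m * P)) - u (real (j * P) / real (m * P))"
      by (rule sum_Suc_diff') simp
    moreover have "real (j * P + P) / real (m * P) = real (Suc j) / real m" "real (j * P) / real (m * P) = real j / real m"
      using m P by (simp_all add: field_simps)
    ultimately have mean: "(\<Sum>i=j*P..<j*P+P. ?a i) = real P *\<^sub>R ?b j"
      by (simp add: diff_quot_def flip: scaleR_sum_right)
    have "(\<Sum>i=j*P..<j*P+P. (norm (?a i - ?b (i div P)))\<^sup>2)
        = (\<Sum>i=j*P..<j*P+P. (norm (?a i))\<^sup>2 - 2 * (?a i \<bullet> ?b j) + (norm (?b j))\<^sup>2)"
    proof (rule sum.cong)
      fix i assume "i \<in> {j*P..<j*P+P}"
      then have "i div P = j" using P
        by (metis add.commute atLeastLessThan_iff div_nat_eqI mult.commute mult_Suc_right)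
      then show "(norm (?a i - ?b (i div P)))\<^sup>2 = (norm (?a i))\<^sup>2 - 2 * (?a i \<bullet> ?b j) + (norm (?b j))\<^sup>2"
        by (simp add: power2_norm_eq_inner inner_diff inner_commute)
    qed simp
    also have "\<dots> = (\<Sum>i=j*P..<j*P+P. (norm (?a i))\<^sup>2) - 2 * ((\<Sum>i=j*P..<j*P+P. ?a i) \<bullet> ?b j) + real P * (norm (?b j))\<^sup>2"
      by (simp add: sum.distrib sum_subtractf inner_sum_left sum_distrib_left)
    also have "\<dots> = (\<Sum>i=j*P..<j*P+P. (norm (?a i))\<^sup>2) - real P * (norm (?b j))\<^sup>2"
      by (simp add: mean power2_norm_eq_inner)
    finally show ?thesis .
  qed
  have "integral\<^sup>L (lebesgue_on {0..1}) (\<lambda>t. (norm (step_fun (m * P) ?a t - step_fun m ?b t))\<^sup>2)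
      = integral\<^sup>L (lebesgue_on {0..1}) (step_fun (m * P) (\<lambda>i. (norm (?a i - ?b (i div P)))\<^sup>2))"
    by (rule Bochner_Integration.integral_cong) (use * in \<open>auto simp: space_restrict_space\<close>)
  also have "\<dots> = (1 / real (m * P)) * (\<Sum>i<m*P. (norm (?a i - ?b (i div P)))\<^sup>2)"
    unfolding step_fun_integrable(2)[OF mP] by (simp add: sum_divide_distrib)
  also have "(\<Sum>i<m*P. (norm (?a i - ?b (i div P)))\<^sup>2) = (\<Sum>j<m. \<Sum>i=j*P..<j*P+P. (norm (?a i - ?b (i div P)))\<^sup>2)"
    by (rule sum.nat_group[symmetric])
  also have "\<dots> = (\<Sum>j<m. \<Sum>i=j*P..<j*P+P. (norm (?a i))\<^sup>2) - real P * (\<Sum>j<m. (norm (?b j))\<^sup>2)"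
    by (simp add: block sum_subtractf sum_distrib_left)
  also have "(\<Sum>j<m. \<Sum>i=j*P..<j*P+P. (norm (?a i))\<^sup>2) = (\<Sum>i<m*P. (norm (?a i))\<^sup>2)"
    by (rule sum.nat_group)
  also have "(1 / real (m * P)) * ((\<Sum>i<m*P. (norm (?a i))\<^sup>2) - real P * (\<Sum>j<m. (norm (?b j))\<^sup>2))
      = (\<Sum>i<m*P. (1 / real (m * P)) *\<^sub>R (norm (?a i))\<^sup>2) - (\<Sum>j<m. (1 / real m) *\<^sub>R (norm (?b j))\<^sup>2)"
    using m P by (simp add: right_diff_distrib sum_divide_distrib diff_divide_distrib)
  also have "\<dots> = quot_energy norm u (m * P) - quot_energy norm u m"
    unfolding quot_energy_eq[OF is_norm_norm m] quot_energy_eq[OF is_norm_norm mP] ..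
  finally show "integral\<^sup>L (lebesgue_on {0..1}) (\<lambda>t. (norm (step_fun (m * P) ?a t - step_fun m ?b t))\<^sup>2)
      = quot_energy norm u (m * P) - quot_energy norm u m" .
qed

section \<open>Almost everywhere convergence of the martingale of difference quotients\<close>

lemma AE_summable_if_summable_integral_norm:
  fixes f :: "nat \<Rightarrow> 'a \<Rightarrow> 'b::{banach, second_countable_topology}"
  assumes int: "\<And>i. integrable M (f i)" and sums: "summable (\<lambda>i. \<integral>x. norm (f i x) \<partial>M)"
  shows "AE x in M. summable (\<lambda>i. norm (f i x))"
proof -
  have [measurable]: "f i \<in> borel_measurable M" for i using int by auto
  have "(\<integral>\<^sup>+ x. (\<Sum>i. ennreal (norm (f i x))) \<partial>M) = (\<Sum>i. \<integral>\<^sup>+ x. norm (f i x) \<partial>M)"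
    by (intro nn_integral_suminf) auto
  also have "\<dots> = (\<Sum>i. ennreal (\<integral>x. norm (f i x) \<partial>M))"
    by (intro arg_cong[where f=suminf] ext nn_integral_eq_integral integrable_norm int) auto
  finally have "(\<integral>\<^sup>+ x. (\<Sum>i. ennreal (norm (f i x))) \<partial>M) \<noteq> \<infinity>"
    by (simp add: sums ennreal_suminf_neq_top integral_nonneg_AE)
  then have "AE x in M. (\<Sum>i. ennreal (norm (f i x))) \<noteq> \<infinity>"
    by (intro nn_integral_PInf_AE) auto
  then show ?thesis
    by eventually_elim (auto intro!: summable_suminf_not_top)
qed

text \<open>A bounded monotone sequence converges, so indices can be taken where it is within the
  prescribed distance of its limit. The increments will be squared \<open>L\<^sup>2\<close> norms;
  the rate 1/4 leaves the summable rate 1/2 after taking roots.\<close>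

lemma rapid_subsequence:
  fixes Q :: "nat \<Rightarrow> real"
  assumes "mono Q" "\<And>k. Q k \<le> M"
  obtains r :: "nat \<Rightarrow> nat" where "mono r" "filterlim r at_top sequentially"
    "\<And>p. Q (r (Suc p)) - Q (r p) \<le> (1/4) ^ p"
proof -
  obtain L where L: "Q \<longlonglongrightarrow> L" "\<And>k. Q k \<le> L"
    using incseq_convergent[of Q M] assms by (auto simp: incseq_def mono_def)
  have "\<exists>n. \<forall>k\<ge>n. L - Q k < (1/4) ^ p" for p
  proof -
    have "\<exists>n. \<forall>k\<ge>n. norm (Q k - L) < (1/4) ^ p" by (rule LIMSEQ_D[OF L(1)]) simp
    moreover have "norm (Q k - L) = L - Q k" for k using L(2)[of k] by simp
    ultimately show ?thesis by simp
  qed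
  then obtain n where n: "\<And>p k. k \<ge> n p \<Longrightarrow> L - Q k < (1/4) ^ p" by metis
  \<comment> \<open>The sum makes \<open>r\<close> monotone and at least \<open>n p\<close>; the
    summand \<open>p\<close> drives it to infinity.\<close>
  define r where "r p = p + (\<Sum>i\<le>p. n i)" for p
  have "n p \<le> r p" for p unfolding r_def by (rule trans_le_add2) (auto intro: member_le_sum)
  then have "Q (r (Suc p)) - Q (r p) \<le> (1/4) ^ p" for p
    using n[of p "r p"] L(2)[of "r (Suc p)"] by (smt (verit))
  moreover have "mono r" unfolding r_def by (intro monoI add_mono sum_mono2) auto
  moreover have "filterlim r at_top sequentially"
    by (rule filterlim_at_top_mono[OF filterlim_ident]) (simp add: r_def)
  ultimately show ?thesis using that by blast
qed

text \<open>Bounded energies make the martingale Cauchy in \<open>L\<^sup>2\<close>; a subsequence with summable increments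
  converges almost everywhere and in \<open>L\<^sup>1\<close>, and Fatou's lemma bounds the energy of the limit.\<close>

lemma bounded_quot_energy_imp_indefinite_integral:
  fixes u :: "real \<Rightarrow> 'a::euclidean_space"
  assumes u: "continuous_on {0..1} u" and N: "is_norm N" and bound: "\<And>k. quot_energy N u (2 ^ k) \<le> M"
  obtains g where "g \<in> L2_space" "indefinite_integral u g"
    "integral\<^sup>L (lebesgue_on {0..1}) (\<lambda>t. (N (g t))\<^sup>2) \<le> M"
proof -
  let ?\<mu> = "lebesgue_on {0..1::real}"
  obtain C where C: "C > 0" "\<And>v. norm v \<le> C * N v" using is_norm_lower[OF N] by blast
  define f where "f k = step_fun (2 ^ k) (diff_quot u (2 ^ k))" for k
  define Q where "Q k = quot_energy norm u (2 ^ k)" for k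
  have incr: "integrable ?\<mu> (\<lambda>t. (norm (f l t - f k t))\<^sup>2)"
    "integral\<^sup>L ?\<mu> (\<lambda>t. (norm (f l t - f k t))\<^sup>2) = Q l - Q k" if "k \<le> l" for k l
  proof -
    have "(2::nat) ^ l = 2 ^ k * 2 ^ (l - k)" using that by (simp flip: power_add)
    then show "integrable ?\<mu> (\<lambda>t. (norm (f l t - f k t))\<^sup>2)"
      "integral\<^sup>L ?\<mu> (\<lambda>t. (norm (f l t - f k t))\<^sup>2) = Q l - Q k"
      using integral_diff_quot_refine[of "2 ^ k" "2 ^ (l - k)" u] by (simp_all add: f_def Q_def)
  qed
  have "mono Q"
  proof (rule monoI)
    fix k l :: nat assume "k \<le> l"
    have "0 \<le> integral\<^sup>L ?\<mu> (\<lambda>t. (norm (f l t - f k t))\<^sup>2)" by (rule integral_nonneg_AE) simp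
    then show "Q k \<le> Q l" using incr(2)[OF \<open>k \<le> l\<close>] by simp
  qed
  moreover have "Q k \<le> C\<^sup>2 * M" for k
  proof -
    have "Q k \<le> C\<^sup>2 * quot_energy N u (2 ^ k)"
      unfolding Q_def quot_energy_def sum_distrib_left
    proof (rule sum_mono)
      fix i
      let ?v = "u (real (Suc i) / real (2 ^ k)) - u (real i / real (2 ^ k))"
      have "(norm ?v)\<^sup>2 \<le> (C * N ?v)\<^sup>2" using C(2) by (intro power_mono) auto
      then show "real (2 ^ k) * (norm ?v)\<^sup>2 \<le> C\<^sup>2 * (real (2 ^ k) * (N ?v)\<^sup>2)"
        by (simp add: power_mult_distrib algebra_simps)
    qed
    also have "\<dots> \<le> C\<^sup>2 * M" by (intro mult_left_mono bound) simp
    finally show ?thesis .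
  qed
  ultimately obtain r where r: "mono r" "filterlim r at_top sequentially"
    "\<And>p. Q (r (Suc p)) - Q (r p) \<le> (1/4) ^ p" using rapid_subsequence by blast
  define F where "F p = f (r p)" for p
  define D where "D p t = F (Suc p) t - F p t" for p t
  have Fint: "integrable ?\<mu> (F p)" for p unfolding F_def f_def by (rule step_fun_integrable) simp
  have Fm: "F p \<in> borel_measurable ?\<mu>" for p using Fint by auto
  have Dint: "integrable ?\<mu> (D p)" for p unfolding D_def by (intro Bochner_Integration.integrable_diff Fint)
  have D2: "integrable ?\<mu> (\<lambda>t. (norm (D p t))\<^sup>2)" "integral\<^sup>L ?\<mu> (\<lambda>t. (norm (D p t))\<^sup>2) \<le> (1/4) ^ p" for p
    using incr[of "r p" "r (Suc p)"] monoD[OF r(1), of p "Suc p"] r(3)[of p] by (auto simp: D_def F_def)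
  \<comment> \<open>A weighted form of 2ab \<le> a^2 + b^2, with the weight \<open>2 ^ p\<close>
    chosen so that the constant and the quadratic term each contribute half of
    \<open>(1/2) ^ p\<close>.\<close>
  have D1: "integral\<^sup>L ?\<mu> (\<lambda>t. norm (D p t)) \<le> (1/2) ^ p" for p
  proof -
    have "integral\<^sup>L ?\<mu> (\<lambda>t. norm (D p t)) \<le> integral\<^sup>L ?\<mu> (\<lambda>t. (1/2) ^ p / 2 + (2 ^ p / 2) * (norm (D p t))\<^sup>2)"
    proof (rule integral_mono)
      show "integrable ?\<mu> (\<lambda>t. (1/2) ^ p / 2 + (2 ^ p / 2) * (norm (D p t))\<^sup>2)"
        using D2(1) finite_measure_unit
        by (intro Bochner_Integration.integrable_add finite_measure.integrable_const integrable_mult_right)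
      fix t
      have "0 \<le> (2 ^ p * norm (D p t) - 1)\<^sup>2" by simp
      then have "2 * (2 ^ p * norm (D p t)) \<le> 1 + (2 ^ p * norm (D p t))\<^sup>2" unfolding power2_diff by simp
      then show "norm (D p t) \<le> (1/2) ^ p / 2 + (2 ^ p / 2) * (norm (D p t))\<^sup>2"
        by (simp add: field_simps power2_eq_square)
    qed (use Dint in auto)
    also have "\<dots> = (1/2) ^ p / 2 + (2 ^ p / 2) * integral\<^sup>L ?\<mu> (\<lambda>t. (norm (D p t))\<^sup>2)"
      using D2(1)[of p] finite_measure.integrable_const[OF finite_measure_unit]
      by (subst Bochner_Integration.integral_add) (auto simp: measure_restrict_space)
    also have "\<dots> \<le> (1/2) ^ p / 2 + (2 ^ p / 2) * (1/4) ^ p"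
      by (intro add_left_mono mult_left_mono D2) simp
    also have "\<dots> = (1/2) ^ p"
      by (simp add: field_simps flip: power_mult_distrib)
    finally show ?thesis .
  qed
  have sumD: "summable (\<lambda>p. integral\<^sup>L ?\<mu> (\<lambda>t. norm (D p t)))"
    by (rule summable_comparison_test'[of "\<lambda>p. (1/2::real) ^ p" 0]) (auto simp: D1 integral_nonneg_AE summable_geometric)
  have AEs: "AE t in ?\<mu>. summable (\<lambda>p. norm (D p t))"
    by (rule AE_summable_if_summable_integral_norm[OF Dint sumD])
  \<comment> \<open>One integrable function that dominates \<open>F p - g\<close> for every
    \<open>p\<close>, because the difference is a tail of the series.\<close>
  define w where "w t = (\<Sum>p. norm (D p t))" for t
  define g where "g t = F 0 t + (\<Sum>p. D p t)" for t
  have w: "integrable ?\<mu> w" unfolding w_def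
    by (rule integrable_suminf) (use Dint AEs sumD in auto)
  have gint: "integrable ?\<mu> g" unfolding g_def
    by (intro Bochner_Integration.integrable_add Fint integrable_suminf Dint AEs sumD)
  have tele: "(\<Sum>q<p. D q t) = F p t - F 0 t" for p t
    unfolding D_def by (rule sum_lessThan_telescope)
  have lim: "AE t in ?\<mu>. (\<lambda>p. F p t) \<longlonglongrightarrow> g t" using AEs
  proof eventually_elim
    case (elim t)
    then have "(\<lambda>p. F 0 t + (\<Sum>q<p. D q t)) \<longlonglongrightarrow> g t" unfolding g_def
      by (rule tendsto_add[OF tendsto_const summable_LIMSEQ[OF summable_norm_cancel]])
    then show ?case by (simp add: tele)
  qed
  have L1: "(\<lambda>p. integral\<^sup>L ?\<mu> (\<lambda>t. norm (F p t - g t))) \<longlonglongrightarrow> integral\<^sup>L ?\<mu> (\<lambda>t. 0)"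
  proof (rule integral_dominated_convergence[OF _ _ w])
    show "AE t in ?\<mu>. (\<lambda>p. norm (F p t - g t)) \<longlonglongrightarrow> 0" using lim
      by eventually_elim (simp add: tendsto_norm_zero LIM_zero)
    show "AE t in ?\<mu>. norm (norm (F p t - g t)) \<le> w t" for p using AEs
    proof eventually_elim
      case (elim t)
      then have s: "summable (\<lambda>q. D q t)" by (rule summable_norm_cancel)
      have "g t - F p t = (\<Sum>q. D (q + p) t)"
        using suminf_split_initial_segment[OF s, of p] by (simp add: g_def tele)
      moreover have "norm (\<Sum>q. D (q + p) t) \<le> (\<Sum>q. norm (D (q + p) t))"
        by (rule summable_norm[OF summable_ignore_initial_segment[OF elim]])
      moreover have "(\<Sum>q. norm (D (q + p) t)) \<le> w t"
        unfolding w_def using suminf_split_initial_segment[OF elim, of p]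
        by (simp add: sum_nonneg)
      ultimately show ?case by (simp add: norm_minus_commute)
    qed
  qed (use Fm gint in auto)
  \<comment> \<open>Stated for an arbitrary norm because it is used twice: the Euclidean norm puts
    \<open>g\<close> into \<open>L2_space\<close>, and \<open>N\<close> gives the bound
    \<open>M\<close> without loss of a constant.\<close>
  have Fatou: "integrable ?\<mu> (\<lambda>t. (N' (g t))\<^sup>2)" "integral\<^sup>L ?\<mu> (\<lambda>t. (N' (g t))\<^sup>2) \<le> B"
    if N': "is_norm N'" and B: "\<And>k. quot_energy N' u (2 ^ k) \<le> B" for N' :: "'a \<Rightarrow> real" and B
  proof -
    have m: "(\<lambda>t. (N' (g t))\<^sup>2) \<in> borel_measurable ?\<mu>"
      using is_norm_measurable[OF N', of g] gint by simp
    have Bnn: "B \<ge> 0" using B[of 0] by (rule order_trans[rotated]) (simp add: quot_energy_def)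
    have nn: "(\<integral>\<^sup>+ t. ennreal ((N' (F p t))\<^sup>2) \<partial>?\<mu>) \<le> ennreal B" for p
    proof -
      have "(\<integral>\<^sup>+ t. ennreal ((N' (F p t))\<^sup>2) \<partial>?\<mu>) = ennreal (quot_energy N' u (2 ^ r p))"
        unfolding F_def f_def
        by (subst nn_integral_eq_integral) (use integral_diff_quot_sq[OF N', of "2 ^ r p" u] in auto)
      then show ?thesis using B[of "r p"] by (simp add: ennreal_leI)
    qed
    have "(\<integral>\<^sup>+ t. ennreal ((N' (g t))\<^sup>2) \<partial>?\<mu>) = (\<integral>\<^sup>+ t. liminf (\<lambda>p. ennreal ((N' (F p t))\<^sup>2)) \<partial>?\<mu>)"
    proof (rule nn_integral_cong_AE)
      show "AE t in ?\<mu>. ennreal ((N' (g t))\<^sup>2) = liminf (\<lambda>p. ennreal ((N' (F p t))\<^sup>2))" using lim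
      proof eventually_elim
        case (elim t)
        have "(\<lambda>p. ennreal ((N' (F p t))\<^sup>2)) \<longlonglongrightarrow> ennreal ((N' (g t))\<^sup>2)"
          by (intro tendsto_ennrealI tendsto_power is_norm_tendsto[OF N'] elim)
        then show ?case by (rule lim_imp_Liminf[OF sequentially_bot, symmetric])
      qed
    qed
    also have "\<dots> \<le> liminf (\<lambda>p. \<integral>\<^sup>+ t. ennreal ((N' (F p t))\<^sup>2) \<partial>?\<mu>)"
      using is_norm_measurable[OF N' Fm] by (intro nn_integral_liminf) auto
    also have "\<dots> \<le> liminf (\<lambda>p. ennreal B)" by (intro Liminf_mono always_eventually allI nn)
    also have "\<dots> = ennreal B" by (simp add: Liminf_const)
    finally have le: "(\<integral>\<^sup>+ t. ennreal ((N' (g t))\<^sup>2) \<partial>?\<mu>) \<le> ennreal B" .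
    show int: "integrable ?\<mu> (\<lambda>t. (N' (g t))\<^sup>2)"
      using m le by (intro integrableI_nonneg) (auto intro: le_less_trans)
    show "integral\<^sup>L ?\<mu> (\<lambda>t. (N' (g t))\<^sup>2) \<le> B"
      using le Bnn nn_integral_eq_integral[OF int] by simp
  qed
  have "g \<in> L2_space" unfolding L2_space_def
    using gint Fatou(1)[OF is_norm_norm, of "C\<^sup>2 * M"] \<open>\<And>k. Q k \<le> C\<^sup>2 * M\<close> by (auto simp: Q_def)
  moreover have "indefinite_integral u g"
  proof -
    have gi: "g integrable_on {0..1}" by (rule integrable_on_lebesgue_on[OF gint]) simp
    have main: "integral {0..t} g = u t - u 0" if t: "t \<in> {0..1}" for t
    proof -
      define m :: "nat \<Rightarrow> nat" where "m p = 2 ^ r p" for p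
      \<comment> \<open>The last grid point not beyond \<open>t\<close>. Up to a grid point the
        integral of the step function telescopes exactly to an increment of \<open>u\<close>;
        continuity then moves from \<open>\<tau> p\<close> to \<open>t\<close>.\<close>
      define \<tau> where "\<tau> p = real (nat \<lfloor>real (m p) * t\<rfloor>) / real (m p)" for p
      have mpos: "m p > 0" for p by (simp add: m_def)
      have \<tau>: "\<tau> p \<le> t" "t < \<tau> p + 1 / real (m p)" "0 \<le> \<tau> p" for p
      proof -
        have "real_of_int \<lfloor>real (m p) * t\<rfloor> \<le> real (m p) * t" "real (m p) * t < real_of_int \<lfloor>real (m p) * t\<rfloor> + 1"
          by linarith+
        moreover have "real (nat \<lfloor>real (m p) * t\<rfloor>) = real_of_int \<lfloor>real (m p) * t\<rfloor>" using t by simp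
        moreover have "0 \<le> real (m p) * t" using t by simp
        ultimately show "\<tau> p \<le> t" "t < \<tau> p + 1 / real (m p)" "0 \<le> \<tau> p"
          using mpos[of p] by (simp_all add: \<tau>_def field_simps)
      qed
      have "(\<lambda>n. (1/2::real) ^ n) \<longlonglongrightarrow> 0" by (simp add: LIMSEQ_realpow_zero)
      from filterlim_compose[OF this r(2)] have m0: "(\<lambda>p. 1 / real (m p)) \<longlonglongrightarrow> 0"
        by (simp add: m_def power_one_over)
      have "(\<lambda>p. t - 1 / real (m p)) \<longlonglongrightarrow> t - 0" by (intro tendsto_intros m0)
      then have \<tau>lim: "\<tau> \<longlonglongrightarrow> t"
        by (intro tendsto_sandwich[of "\<lambda>p. t - 1 / real (m p)" \<tau> _ "\<lambda>_. t"]) (use \<tau> in \<open>auto intro!: always_eventually simp: less_imp_le algebra_simps\<close>)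
      have \<tau>01: "\<tau> p \<in> {0..1}" for p using \<tau>[of p] t by auto
      have Fi: "(F p has_integral (u (\<tau> p) - u 0)) {0..\<tau> p}" for p
      proof -
        have "(\<Sum>i<j. (1 / real (m p)) *\<^sub>R diff_quot u (m p) i) = u (real j / real (m p)) - u 0" for j
          using sum_lessThan_telescope[of "\<lambda>i. u (real i / real (m p))" j] mpos[of p] by (simp add: diff_quot_def)
        then show ?thesis
          using step_fun_has_integral[OF mpos[of p], of "diff_quot u (m p)" "nat \<lfloor>real (m p) * t\<rfloor>"]
          by (simp add: F_def f_def m_def \<tau>_def)
      qed
      have le: "norm ((u (\<tau> p) - u 0) - integral {0..\<tau> p} g) \<le> integral\<^sup>L ?\<mu> (\<lambda>t. norm (F p t - g t))" for p
      proof -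
        have gi\<tau>: "g integrable_on {0..\<tau> p}" using integrable_on_subinterval[OF gi, of 0 "\<tau> p"] \<tau>01[of p] by auto
        have int: "integrable ?\<mu> (\<lambda>t. norm (F p t - g t))"
          by (intro integrable_norm Bochner_Integration.integrable_diff Fint gint)
        have ni: "(\<lambda>t. norm (F p t - g t)) integrable_on {0..1}"
          by (rule integrable_on_lebesgue_on[OF int]) simp
        then have ni\<tau>: "(\<lambda>t. norm (F p t - g t)) integrable_on {0..\<tau> p}"
          using integrable_on_subinterval[OF ni, of 0 "\<tau> p"] \<tau>01[of p] by auto
        have hi: "((\<lambda>t. F p t - g t) has_integral (u (\<tau> p) - u 0) - integral {0..\<tau> p} g) {0..\<tau> p}"
          by (rule has_integral_diff[OF Fi integrable_integral[OF gi\<tau>]])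
        have "norm ((u (\<tau> p) - u 0) - integral {0..\<tau> p} g) \<le> integral {0..\<tau> p} (\<lambda>t. norm (F p t - g t))"
          using integral_norm_bound_integral[OF has_integral_integrable[OF hi] ni\<tau>] integral_unique[OF hi] by simp
        also have "\<dots> \<le> integral {0..1} (\<lambda>t. norm (F p t - g t))"
          by (rule integral_subset_le[OF _ ni\<tau> ni]) (use \<tau>01[of p] in auto)
        also have "\<dots> = integral\<^sup>L ?\<mu> (\<lambda>t. norm (F p t - g t))"
          by (rule lebesgue_integral_eq_integral[OF int, symmetric]) simp
        finally show ?thesis .
      qed
      have z: "(\<lambda>p. (u (\<tau> p) - u 0) - integral {0..\<tau> p} g) \<longlonglongrightarrow> 0"
        by (rule Lim_null_comparison[of _ "\<lambda>p. integral\<^sup>L ?\<mu> (\<lambda>t. norm (F p t - g t))"])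
          (use le L1 in \<open>auto intro: always_eventually\<close>)
      have "(\<lambda>p. (u (\<tau> p) - u 0) - integral {0..\<tau> p} g) \<longlonglongrightarrow> (u t - u 0) - integral {0..t} g"
        by (intro tendsto_intros continuous_on_tendsto_compose[OF u \<tau>lim t]
            continuous_on_tendsto_compose[OF indefinite_integral_continuous_1[OF gi] \<tau>lim t] always_eventually allI \<tau>01)
      from LIMSEQ_unique[OF this z] show ?thesis by simp
    qed
    show ?thesis unfolding indefinite_integral_def
    proof (intro ballI impI)
      fix s t :: real assume st: "s \<in> {0..1}" "t \<in> {0..1}" "s \<le> t"
      have git: "g integrable_on {0..t}" "g integrable_on {s..t}"
        using integrable_on_subinterval[OF gi, of 0 t] integrable_on_subinterval[OF gi, of s t] st by auto
      have "integral {0..s} g + integral {s..t} g = integral {0..t} g"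
        by (rule Henstock_Kurzweil_Integration.integral_combine[OF _ _ git(1)]) (use st in auto)
      then have "integral {s..t} g = u t - u s"
        unfolding main[OF st(1)] main[OF st(2)] by (metis add_diff_cancel_left' diff_diff_eq2 diff_add_cancel)
      then show "(g has_integral u t - u s) {s..t}" using integrable_integral[OF git(2)] by simp
    qed
  qed
  ultimately show ?thesis using that Fatou(2)[OF N bound] by blast
qed

section \<open>Regularisers\<close>

text \<open>On Riemann sums this is the triangle inequality for \<open>N\<close>. A tagged division
  fine for both gauges approximates the two integrals at once; the tolerance for the first is
  divided by \<open>C\<close> because \<open>N\<close> magnifies its error by up to
  \<open>C\<close>.\<close>

lemma is_norm_integral_le:
  fixes g :: "real \<Rightarrow> 'a::euclidean_space"
  assumes N: "is_norm N" and g: "(g has_integral I) {a..b}" and Ng: "((\<lambda>t. N (g t)) has_integral J) {a..b}"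
  shows "N I \<le> J"
proof (rule field_le_epsilon)
  fix e :: real assume e: "e > 0"
  obtain C where C: "C > 0" "\<And>v. N v \<le> C * norm v" using is_norm_upper[OF N] by blast
  have "e / (2 * C) > 0" "e / 2 > 0" using e C by auto
  have g': "(g has_integral I) (cbox a b)" and Ng': "((\<lambda>t. N (g t)) has_integral J) (cbox a b)" using g Ng by simp_all
  from g'[unfolded has_integral, rule_format, OF \<open>e / (2 * C) > 0\<close>]
  obtain \<gamma>1 where \<gamma>1: "gauge \<gamma>1" "\<And>\<D>. \<D> tagged_division_of cbox a b \<Longrightarrow> \<gamma>1 fine \<D> \<Longrightarrow>
      norm ((\<Sum>(x,k)\<in>\<D>. measure lborel k *\<^sub>R g x) - I) < e / (2 * C)" by metis
  from Ng'[unfolded has_integral, rule_format, OF \<open>e / 2 > 0\<close>]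
  obtain \<gamma>2 where \<gamma>2: "gauge \<gamma>2" "\<And>\<D>. \<D> tagged_division_of cbox a b \<Longrightarrow> \<gamma>2 fine \<D> \<Longrightarrow>
      norm ((\<Sum>(x,k)\<in>\<D>. measure lborel k *\<^sub>R N (g x)) - J) < e / 2" by metis
  obtain \<D> where \<D>: "\<D> tagged_division_of cbox a b" "(\<lambda>x. \<gamma>1 x \<inter> \<gamma>2 x) fine \<D>"
    using fine_division_exists[OF gauge_Int[OF \<gamma>1(1) \<gamma>2(1)]] by blast
  define R where "R = (\<Sum>(x,k)\<in>\<D>. measure lborel k *\<^sub>R g x)"
  have fine: "\<gamma>1 fine \<D>" "\<gamma>2 fine \<D>" using \<D>(2) by (auto simp: fine_Int)
  have "N I \<le> N (I - R) + N R" using is_norm_triangle[OF N, of "I - R" R] by simp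
  also have "N (I - R) \<le> C * norm (I - R)" by (rule C(2))
  also have "norm (I - R) \<le> e / (2 * C)" using \<gamma>1(2)[OF \<D>(1) fine(1)] by (simp add: R_def norm_minus_commute)
  also have "C * (e / (2 * C)) = e / 2" using C by simp
  also have "N R \<le> (\<Sum>(x,k)\<in>\<D>. N (measure lborel k *\<^sub>R g x))"
    unfolding R_def split_def by (rule is_norm_sum[OF N])
  also have "\<dots> = (\<Sum>(x,k)\<in>\<D>. measure lborel k *\<^sub>R N (g x))" by (simp add: is_norm_scaleR[OF N])
  also have "\<dots> \<le> J + e / 2" using \<gamma>2(2)[OF \<D>(1) fine(2)] unfolding real_norm_def abs_less_iff by linarith
  finally show "N I \<le> J + e" using C by (simp add: mult_left_mono)
qed

text \<open>The integral of the squared deviation of \<open>f\<close> from its mean value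
  \<open>c\<close> is nonnegative. The degenerate interval is treated apart because the mean divides
  by the length.\<close>

lemma integral_square_le:
  fixes f :: "real \<Rightarrow> real"
  assumes f: "(f has_integral I) {s..t}" and f2: "((\<lambda>x. (f x)\<^sup>2) has_integral J) {s..t}" and "s \<le> t"
  shows "I\<^sup>2 \<le> (t - s) * J"
proof (cases "s = t")
  case True
  then have "I = 0" using f has_integral_refl by (metis box_real(2) has_integral_unique interval_cbox)
  then show ?thesis using True by simp
next
  case False
  then have st: "s < t" using assms by simp
  define c where "c = I / (t - s)"
  have "((\<lambda>x. (f x)\<^sup>2 - (2 * c) * f x + c\<^sup>2) has_integral J - (2 * c) * I + (t - s) * c\<^sup>2) {s..t}"
    using has_integral_const_real[of "c\<^sup>2" s t] st
    by (intro has_integral_add has_integral_diff f2 has_integral_mult_right f) auto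
  moreover have "(\<lambda>x. (f x)\<^sup>2 - (2 * c) * f x + c\<^sup>2) = (\<lambda>x. (f x - c)\<^sup>2)"
    by (auto simp: power2_diff)
  ultimately have "((\<lambda>x. (f x - c)\<^sup>2) has_integral J - (2 * c) * I + (t - s) * c\<^sup>2) {s..t}" by simp
  then have "0 \<le> J - (2 * c) * I + (t - s) * c\<^sup>2"
    by (rule has_integral_nonneg) simp
  moreover have "(2 * c) * I = 2 * I\<^sup>2 / (t - s)" "(t - s) * c\<^sup>2 = I\<^sup>2 / (t - s)"
    using st by (simp_all add: c_def power2_eq_square)
  ultimately have "I\<^sup>2 / (t - s) \<le> J" by simp
  then show ?thesis using st by (simp add: field_simps)
qed

lemma L2_space_is_norm_integrable_on:
  fixes g :: "real \<Rightarrow> 'a::euclidean_space"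
  assumes N: "is_norm N" and g: "g \<in> L2_space" and st: "0 \<le> s" "t \<le> 1"
  shows "(\<lambda>x. N (g x)) integrable_on {s..t}" "(\<lambda>x. (N (g x))\<^sup>2) integrable_on {s..t}"
proof -
  have "(\<lambda>x. (N (g x))\<^sup>2) integrable_on {0..1}"
    by (rule integrable_on_lebesgue_on[OF L2_space_is_norm_sq[OF N g]]) simp
  then show "(\<lambda>x. (N (g x))\<^sup>2) integrable_on {s..t}"
    using integrable_on_subinterval[of _ "{0..1}" s t] st by auto
  have "(\<lambda>x. N (g x)) \<in> L2_space"
    using L2_space_is_norm_sq[OF N g] is_norm_measurable[OF N L2_space_measurable[OF g]] by (simp add: L2_space_def)
  then have "(\<lambda>x. N (g x)) integrable_on {0..1}"
    by (intro integrable_on_lebesgue_on[OF L2_space_integrable]) auto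
  then show "(\<lambda>x. N (g x)) integrable_on {s..t}"
    using integrable_on_subinterval[of _ "{0..1}" s t] st by auto
qed

lemma indefinite_integral_increment_sq_le:
  fixes u :: "real \<Rightarrow> 'a::euclidean_space"
  assumes N: "is_norm N" and g: "g \<in> L2_space" "indefinite_integral u g" and st: "0 \<le> s" "s \<le> t" "t \<le> 1"
  shows "(N (u t - u s))\<^sup>2 \<le> (t - s) * integral {s..t} (\<lambda>x. (N (g x))\<^sup>2)"
proof -
  note int = L2_space_is_norm_integrable_on[OF N g(1) st(1,3), THEN integrable_integral]
  have "(g has_integral u t - u s) {s..t}" using g(2) st by (auto simp: indefinite_integral_def)
  from is_norm_integral_le[OF N this int(1)]
  have "(N (u t - u s))\<^sup>2 \<le> (integral {s..t} (\<lambda>x. N (g x)))\<^sup>2"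
    by (intro power_mono is_norm_nonneg[OF N])
  also have "\<dots> \<le> (t - s) * integral {s..t} (\<lambda>x. (N (g x))\<^sup>2)"
    by (rule integral_square_le[OF int st(2)])
  finally show ?thesis .
qed

lemma L2_norm_sq: "(L2_norm N f)\<^sup>2 = integral\<^sup>L (lebesgue_on {0..1}) (\<lambda>t. (N (f t))\<^sup>2)"
  unfolding L2_norm_def by (intro real_sqrt_pow2 integral_nonneg_AE) simp

lemma H1_space_weak_deriv:
  assumes "u \<in> H1_space"
  shows "weak_deriv u \<in> L2_space" "indefinite_integral u (weak_deriv u)"
proof -
  have "\<exists>g. has_weak_deriv u g" using assms by (simp add: H1_space_def)
  then have "has_weak_deriv u (weak_deriv u)" unfolding weak_deriv_def by (rule someI_ex)
  then show "weak_deriv u \<in> L2_space" "indefinite_integral u (weak_deriv u)"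
    using assms has_weak_deriv_imp_indefinite_integral by (auto simp: H1_space_def has_weak_deriv_def)
qed

text \<open>On one cell the squared increment is at most the cell length 1/n times the integral of
  the squared derivative norm, and the factor \<open>n\<close> cancels that length. There are only
  \<open>n - 1\<close> increments, so the last cell is missing; the integrand is nonnegative and
  adding the cell only helps.\<close>

lemma discrete_reg_sample_le:
  fixes u :: "real \<Rightarrow> 'a::euclidean_space"
  assumes N: "is_norm N" and u: "u \<in> H1_space" and n: "n \<ge> 1"
    and K: "\<And>i. i < n \<Longrightarrow> K i = u (real i / real n)"
  shows "discrete_reg N \<tau> n K \<le> continuum_reg N \<tau> u"
proof -
  note g = H1_space_weak_deriv[OF u]
  let ?g = "\<lambda>x. (N (weak_deriv u x))\<^sup>2"
  have gi: "?g integrable_on {s..t}" if "0 \<le> s" "t \<le> 1" for s t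
    using L2_space_is_norm_integrable_on[OF N g(1) that] by simp
  have "real n * (\<Sum>i = 1..j. (N (K i - K (i - 1)))\<^sup>2) \<le> integral {0..real j / real n} ?g" if "j < n" for j
    using that
  proof (induction j)
    case (Suc j)
    have j: "0 \<le> real j / real n" "real j / real n \<le> real (Suc j) / real n" "real (Suc j) / real n \<le> 1"
      using n Suc.prems by (simp_all add: field_simps)
    have "real n * (N (K (Suc j) - K j))\<^sup>2 \<le> real n * ((real (Suc j) / real n - real j / real n) * integral {real j / real n..real (Suc j) / real n} ?g)"
      using indefinite_integral_increment_sq_le[OF N g j] K[of j] K[of "Suc j"] Suc.prems by (intro mult_left_mono) auto
    also have "\<dots> = integral {real j / real n..real (Suc j) / real n} ?g"
      using n by (simp add: field_simps flip: distrib_right)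
    finally have "real n * (\<Sum>i = 1..Suc j. (N (K i - K (i - 1)))\<^sup>2)
        \<le> integral {0..real j / real n} ?g + integral {real j / real n..real (Suc j) / real n} ?g"
      using Suc by (simp add: distrib_left)
    also have "\<dots> = integral {0..real (Suc j) / real n} ?g"
      by (rule Henstock_Kurzweil_Integration.integral_combine[OF j(1,2) gi]) (use j in auto)
    finally show ?case .
  qed simp
  from this[of "n - 1"] have "real n * (\<Sum>i = 1..n-1. (N (K i - K (i - 1)))\<^sup>2) \<le> integral {0..real (n-1) / real n} ?g"
    using n by simp
  also have "\<dots> \<le> integral {0..1} ?g"
    by (rule integral_subset_le) (use n gi in \<open>auto simp: field_simps\<close>)
  also have "\<dots> = (L2_norm N (weak_deriv u))\<^sup>2"
    unfolding L2_norm_sq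
    by (rule lebesgue_integral_eq_integral[symmetric]) (use L2_space_is_norm_sq[OF N g(1)] in auto)
  finally show ?thesis
    using K[of 0] n by (simp add: discrete_reg_def continuum_reg_def)
qed

text \<open>The constructed density is a weak derivative, hence agrees almost everywhere with the
  one selected by \<open>weak_deriv\<close>, and its energy bound transfers to the selected
  one.\<close>

lemma bounded_quot_energy_imp_H1:
  fixes u :: "real \<Rightarrow> 'a::euclidean_space"
  assumes u: "continuous_on {0..1} u" and N: "is_norm N" and bound: "\<And>k. quot_energy N u (2 ^ k) \<le> M"
  shows "u \<in> H1_space" "(L2_norm N (weak_deriv u))\<^sup>2 \<le> M"
proof -
  obtain g where g: "g \<in> L2_space" "indefinite_integral u g"
    "integral\<^sup>L (lebesgue_on {0..1}) (\<lambda>t. (N (g t))\<^sup>2) \<le> M"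
    using bounded_quot_energy_imp_indefinite_integral[OF assms] by blast
  show H1: "u \<in> H1_space"
    using u continuous_on_imp_L2_space indefinite_integral_imp_has_weak_deriv[OF g(1,2)] by (auto simp: H1_space_def)
  note wd = H1_space_weak_deriv[OF H1]
  have "AE t in lebesgue_on {0..1}. weak_deriv u t = g t"
    by (rule indefinite_integral_unique[OF wd(2) g(2)])
  then have "integral\<^sup>L (lebesgue_on {0..1}) (\<lambda>t. (N (weak_deriv u t))\<^sup>2) = integral\<^sup>L (lebesgue_on {0..1}) (\<lambda>t. (N (g t))\<^sup>2)"
    using L2_space_is_norm_sq[OF N wd(1)] L2_space_is_norm_sq[OF N g(1)]
    by (intro integral_cong_AE) auto
  then show "(L2_norm N (weak_deriv u))\<^sup>2 \<le> M" using g(3) by (simp add: L2_norm_sq)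
qed

section \<open>The flow and its Euler approximation\<close>

lemma bounded_bilinear_matrix_vector_mult:
  "bounded_bilinear (\<lambda>(A::real^'n::finite^'m::finite) x. A *v x)"
proof -
  have "bilinear (\<lambda>(A::real^'n^'m) x. A *v x)"
    unfolding bilinear_def
    by (auto intro!: linearI simp: matrix_vector_right_distrib matrix_vector_mult_add_rdistrib
        matrix_vector_mult_scaleR scaleR_matrix_vector_assoc)
  then show ?thesis by (simp add: bilinear_conv_bounded_bilinear)
qed

lemmas continuous_on_matrix_vector_mult = bounded_bilinear.continuous_on[OF bounded_bilinear_matrix_vector_mult]
lemmas tendsto_matrix_vector_mult = bounded_bilinear.tendsto[OF bounded_bilinear_matrix_vector_mult]

text \<open>Picard iteration from the constant curve. The factorial in the bound on successive
  differences gives uniform convergence on the whole interval for every \<open>A\<close>, so no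
  subdivision into short intervals occurs.\<close>

lemma picard_lindeloef_unit_interval:
  fixes f :: "real \<Rightarrow> 'a::euclidean_space \<Rightarrow> 'a" and x0 :: 'a
  assumes cont: "\<And>X. continuous_on {0..1} X \<Longrightarrow> continuous_on {0..1} (\<lambda>t. f t (X t))"
    and lip: "\<And>t x y. t \<in> {0..1} \<Longrightarrow> norm (f t x - f t y) \<le> A * norm (x - y)" and A: "A \<ge> 0"
  obtains X where "X 0 = x0" "\<And>t. t \<in> {0..1} \<Longrightarrow> (X has_vector_derivative f t (X t)) (at t within {0..1})"
proof -
  define X where "X = rec_nat (\<lambda>_. x0) (\<lambda>_ Y t. x0 + integral {0..t} (\<lambda>s. f s (Y s)))"
  have X0: "X 0 = (\<lambda>_. x0)" and XS: "X (Suc k) = (\<lambda>t. x0 + integral {0..t} (\<lambda>s. f s (X k s)))" for k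
    by (simp_all add: X_def)
  have Xc: "continuous_on {0..1} (X k)" for k
  proof (induction k)
    case (Suc k)
    then show ?case unfolding XS
      by (intro continuous_intros indefinite_integral_continuous_1 integrable_continuous_interval cont)
  qed (simp add: X0)
  have int: "(\<lambda>s. f s (Y s)) integrable_on {0..t}" if "continuous_on {0..1} Y" "t \<in> {0..1}" for Y t
    using that(2) by (intro integrable_continuous_interval continuous_on_subset[OF cont[OF that(1)]]) auto
  obtain M where M: "\<And>t. t \<in> {0..1} \<Longrightarrow> norm (f t x0) \<le> M" "M \<ge> 0"
  proof -
    have "bounded ((\<lambda>t. f t x0) ` {0..1})"
      by (intro compact_imp_bounded compact_continuous_image cont[of "\<lambda>_. x0"]) auto
    then show ?thesis using that unfolding bounded_pos by (metis imageI less_imp_le)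
  qed
  have bound: "norm (X (Suc k) t - X k t) \<le> M * A ^ k * t ^ Suc k / fact (Suc k)" if "t \<in> {0..1}" for k t
    using that
  proof (induction k arbitrary: t)
    case 0
    have "norm (integral {0..t} (\<lambda>s. f s x0)) \<le> integral {0..t} (\<lambda>s. M)"
      using int[of "\<lambda>_. x0" t] 0 M by (intro integral_norm_bound_integral) auto
    then show ?case using 0 by (simp add: XS X0 mult.commute)
  next
    case (Suc k)
    have hi: "((\<lambda>s. A * (M * A ^ k * s ^ Suc k / fact (Suc k))) has_integral M * A ^ Suc k * t ^ Suc (Suc k) / fact (Suc (Suc k))) {0..t}"
    proof -
      have "((\<lambda>s. A * (M * A ^ k * s ^ Suc k / fact (Suc k))) has_integral
          (M * A ^ Suc k * t ^ Suc (Suc k) / fact (Suc (Suc k)) - M * A ^ Suc k * 0 ^ Suc (Suc k) / fact (Suc (Suc k)))) {0..t}"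
      proof (rule fundamental_theorem_of_calculus)
        fix s :: real
        have "((\<lambda>s. M * A ^ Suc k * s ^ Suc (Suc k) / fact (Suc (Suc k))) has_real_derivative
            (M * A ^ Suc k / fact (Suc (Suc k))) * (real (Suc (Suc k)) * s ^ Suc k)) (at s within {0..t})"
          by (rule derivative_eq_intros refl | simp)+
        moreover have "(M * A ^ Suc k / fact (Suc (Suc k))) * (real (Suc (Suc k)) * s ^ Suc k) = A * (M * A ^ k * s ^ Suc k / fact (Suc k))"
          by (simp add: fact_Suc[of "Suc k"] del: fact_Suc of_nat_Suc)
        ultimately show "((\<lambda>s. M * A ^ Suc k * s ^ Suc (Suc k) / fact (Suc (Suc k))) has_vector_derivative A * (M * A ^ k * s ^ Suc k / fact (Suc k))) (at s within {0..t})"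
          by (metis has_real_derivative_iff_has_vector_derivative)
      qed (use Suc.prems in auto)
      then show ?thesis by simp
    qed
    have "X (Suc (Suc k)) t - X (Suc k) t = integral {0..t} (\<lambda>s. f s (X (Suc k) s)) - integral {0..t} (\<lambda>s. f s (X k s))"
      by (simp add: XS)
    also have "\<dots> = integral {0..t} (\<lambda>s. f s (X (Suc k) s) - f s (X k s))"
      by (rule Henstock_Kurzweil_Integration.integral_diff[symmetric]) (intro int Xc Suc.prems)+
    also have "norm \<dots> \<le> integral {0..t} (\<lambda>s. A * (M * A ^ k * s ^ Suc k / fact (Suc k)))"
    proof (rule integral_norm_bound_integral)
      show "(\<lambda>s. f s (X (Suc k) s) - f s (X k s)) integrable_on {0..t}"
        by (intro integrable_diff int Xc Suc.prems)
      fix s assume "s \<in> {0..t}"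
      then have s: "s \<in> {0..1}" using Suc.prems by auto
      have "norm (f s (X (Suc k) s) - f s (X k s)) \<le> A * norm (X (Suc k) s - X k s)" by (rule lip[OF s])
      also have "\<dots> \<le> A * (M * A ^ k * s ^ Suc k / fact (Suc k))" by (intro mult_left_mono Suc.IH s A)
      finally show "norm (f s (X (Suc k) s) - f s (X k s)) \<le> A * (M * A ^ k * s ^ Suc k / fact (Suc k))" .
    qed (use hi in \<open>auto simp: has_integral_integrable\<close>)
    also have "\<dots> = M * A ^ Suc k * t ^ Suc (Suc k) / fact (Suc (Suc k))" using hi by (rule integral_unique)
    finally show ?case .
  qed
  have ul: "uniform_limit {0..1} (\<lambda>n t. \<Sum>k<n. X (Suc k) t - X k t) (\<lambda>t. \<Sum>k. X (Suc k) t - X k t) sequentially"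
  proof (rule Weierstrass_m_test)
    have "summable (\<lambda>k. M * (inverse (fact k) * A ^ k))" by (intro summable_mult summable_exp)
    then show "summable (\<lambda>k. M * (A ^ k / fact k))" by (simp add: field_simps)
    fix k and t :: real assume t: "t \<in> {0..1}"
    have "M * A ^ k * t ^ Suc k / fact (Suc k) \<le> M * A ^ k * 1 / fact k"
      using t A M by (intro frac_le mult_left_mono power_le_one) (auto simp: fact_mono)
    then show "norm (X (Suc k) t - X k t) \<le> M * (A ^ k / fact k)" using bound[OF t, of k] by simp
  qed
  define L where "L t = x0 + (\<Sum>k. X (Suc k) t - X k t)" for t
  have "uniform_limit {0..1} (\<lambda>n t. x0 + (\<Sum>k<n. X (Suc k) t - X k t)) L sequentially"
    unfolding L_def by (intro uniform_limit_add uniform_limit_const ul)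
  moreover have "(\<lambda>n t. x0 + (\<Sum>k<n. X (Suc k) t - X k t)) = X"
    using sum_lessThan_telescope[of "\<lambda>k. X k t" for t] by (auto simp: X0 intro!: ext)
  ultimately have XL: "uniform_limit {0..1} X L sequentially" by simp
  have Lc: "continuous_on {0..1} L"
    by (rule uniform_limit_theorem[OF _ XL]) (auto intro: Xc always_eventually)
  have fixpt: "L t = x0 + integral {0..t} (\<lambda>s. f s (L s))" if t: "t \<in> {0..1}" for t
  proof (rule LIMSEQ_unique)
    show "(\<lambda>n. X (Suc n) t) \<longlonglongrightarrow> L t"
      using tendsto_uniform_limitI[OF XL t] by (rule LIMSEQ_Suc)
    have "(\<lambda>n. integral {0..t} (\<lambda>s. f s (X n s))) \<longlonglongrightarrow> integral {0..t} (\<lambda>s. f s (L s))"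
    proof (rule LIMSEQ_I)
      fix e :: real assume e: "e > 0"
      \<comment> \<open>The shift to \<open>A + 1\<close> avoids a division by zero when
        \<open>A = 0\<close>.\<close>
      have "e / (2 * (A + 1)) > 0" using e A by simp
      then obtain n0 where n0: "\<And>n s. n \<ge> n0 \<Longrightarrow> s \<in> {0..1} \<Longrightarrow> dist (X n s) (L s) < e / (2 * (A + 1))"
        using XL unfolding uniform_limit_iff eventually_sequentially by metis
      show "\<exists>n0. \<forall>n\<ge>n0. norm (integral {0..t} (\<lambda>s. f s (X n s)) - integral {0..t} (\<lambda>s. f s (L s))) < e"
      proof (intro exI[of _ n0] allI impI)
        fix n assume n: "n \<ge> n0"
        have "integral {0..t} (\<lambda>s. f s (X n s)) - integral {0..t} (\<lambda>s. f s (L s)) = integral {0..t} (\<lambda>s. f s (X n s) - f s (L s))"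
          by (rule Henstock_Kurzweil_Integration.integral_diff[symmetric]) (intro int Xc Lc t)+
        also have "norm \<dots> \<le> integral {0..t} (\<lambda>s. e / 2)"
        proof (rule integral_norm_bound_integral)
          show "(\<lambda>s. f s (X n s) - f s (L s)) integrable_on {0..t}" by (intro integrable_diff int Xc Lc t)
          fix s assume "s \<in> {0..t}"
          then have s: "s \<in> {0..1}" using t by auto
          have "norm (f s (X n s) - f s (L s)) \<le> A * norm (X n s - L s)" by (rule lip[OF s])
          also have "\<dots> \<le> (A + 1) * (e / (2 * (A + 1)))"
            using n0[OF n s] A by (intro mult_mono) (auto simp: dist_norm)
          also have "\<dots> = e / 2" using A by (simp add: field_simps)
          finally show "norm (f s (X n s) - f s (L s)) \<le> e / 2" .
        qed auto
        also have "\<dots> \<le> 1 * (e / 2)" using t e by (simp add: mult_left_le_one_le)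
        also have "\<dots> < e" using e by simp
        finally show "norm (integral {0..t} (\<lambda>s. f s (X n s)) - integral {0..t} (\<lambda>s. f s (L s))) < e" .
      qed
    qed
    then show "(\<lambda>n. X (Suc n) t) \<longlonglongrightarrow> x0 + integral {0..t} (\<lambda>s. f s (L s))"
      unfolding XS by (intro tendsto_intros)
  qed
  show ?thesis
  proof (rule that)
    show "L 0 = x0" using fixpt[of 0] by simp
    fix t :: real assume t: "t \<in> {0..1}"
    have "((\<lambda>t. x0 + integral {0..t} (\<lambda>s. f s (L s))) has_vector_derivative 0 + f t (L t)) (at t within {0..1})"
      by (intro has_vector_derivative_add has_vector_derivative_const integral_has_vector_derivative cont Lc t)
    then show "(L has_vector_derivative f t (L t)) (at t within {0..1})"
      using has_vector_derivative_transform[OF t, of L "\<lambda>t. x0 + integral {0..t} (\<lambda>s. f s (L s))"] fixpt by simp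
  qed
qed

text \<open>Existence justifies the choice in \<open>flow\<close>. A continuous \<open>K\<close> is
  bounded on the compact interval, so the right-hand side is Lipschitz in the state uniformly in
  time.\<close>

lemma flow_is_flow:
  fixes K :: "real \<Rightarrow> real^'d::finite^'d"
  assumes \<sigma>: "C-lipschitz_on UNIV \<sigma>" and K: "continuous_on {0..1} K" and b: "continuous_on {0..1} b"
  shows "is_flow \<sigma> K b x (flow \<sigma> K b x)"
proof -
  obtain B where B: "B > 0" "\<And>(A::real^'d^'d) x. norm (A *v x) \<le> norm A * norm x * B"
    using bounded_bilinear.pos_bounded[OF bounded_bilinear_matrix_vector_mult] by metis
  obtain M where M: "\<And>t. t \<in> {0..1} \<Longrightarrow> norm (K t) \<le> M" "M > 0"
  proof -
    have "bounded (K ` {0..1})" by (intro compact_imp_bounded compact_continuous_image K) auto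
    then show ?thesis using that unfolding bounded_pos by (metis imageI)
  qed
  have C: "C \<ge> 0" using \<sigma> by (rule lipschitz_on_nonneg)
  have "\<exists>X. is_flow \<sigma> K b x X"
  proof (rule picard_lindeloef_unit_interval[of "\<lambda>t x. \<sigma> (K t *v x + b t)" "C * (M * B)" x])
    show "continuous_on {0..1} (\<lambda>t. \<sigma> (K t *v X t + b t))" if "continuous_on {0..1} X" for X
      by (intro continuous_on_compose2[OF lipschitz_on_continuous_on[OF \<sigma>]] continuous_on_add
          continuous_on_matrix_vector_mult K b that) auto
    show "norm (\<sigma> (K t *v x + b t) - \<sigma> (K t *v y + b t)) \<le> C * (M * B) * norm (x - y)" if "t \<in> {0..1}" for t x y
    proof -
      have "norm (\<sigma> (K t *v x + b t) - \<sigma> (K t *v y + b t)) \<le> C * norm (K t *v (x - y))"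
        using lipschitz_onD[OF \<sigma>, of "K t *v x + b t" "K t *v y + b t"]
        by (simp add: dist_norm matrix_vector_mult_diff_distrib)
      also have "\<dots> \<le> C * (norm (K t) * norm (x - y) * B)" by (intro mult_left_mono B C)
      also have "\<dots> \<le> C * (M * norm (x - y) * B)"
        using B M(1)[OF that] by (intro mult_left_mono mult_right_mono C) auto
      finally show ?thesis by (simp add: mult_ac)
    qed
    show "0 \<le> C * (M * B)" using B M C by simp
  qed (auto simp: is_flow_def)
  then show ?thesis unfolding flow_def by (rule someI_ex)
qed

text \<open>Uniform convergence tested on the grids. The mesh is itself a sequence
  \<open>n k\<close>, so the notion passes to subsequences of networks of varying depth.\<close>

definition grid_converges :: "(nat \<Rightarrow> nat) \<Rightarrow> (nat \<Rightarrow> nat \<Rightarrow> 'a::real_normed_vector) \<Rightarrow> (real \<Rightarrow> 'a) \<Rightarrow> bool" where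
  "grid_converges n K u \<longleftrightarrow>
     (\<forall>e>0. \<forall>\<^sub>F k in sequentially. \<forall>i<n k. norm (K k i - u (real i / real (n k))) < e)"

text \<open>The induction carries the bound \<open>exp (A * (i/n)) * ((i/n) * \<delta>)\<close>; its
  linear factor replaces the sharper (exp A - 1) / A and covers \<open>A = 0\<close> without a case
  split.\<close>

lemma discrete_gronwall:
  fixes a :: "nat \<Rightarrow> real"
  assumes "a 0 = 0" and "\<And>i. i < n \<Longrightarrow> a (Suc i) \<le> (1 + A / real n) * a i + \<delta> / real n"
    and "A \<ge> 0" "\<delta> \<ge> 0" "n \<ge> 1"
  shows "a n \<le> exp A * \<delta>"
proof -
  have "a i \<le> exp (A * (real i / real n)) * ((real i / real n) * \<delta>)" if "i \<le> n" for i
    using that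
  proof (induction i)
    case (Suc i)
    have "a (Suc i) \<le> (1 + A / real n) * a i + \<delta> / real n" using Suc.prems by (intro assms) auto
    also have "\<dots> \<le> exp (A / real n) * (exp (A * (real i / real n)) * ((real i / real n) * \<delta>))
        + exp (A * (real (Suc i) / real n)) * (\<delta> / real n)"
    proof (rule add_mono)
      have "(1 + A / real n) * a i \<le> (1 + A / real n) * (exp (A * (real i / real n)) * ((real i / real n) * \<delta>))"
        using Suc assms by (intro mult_left_mono) auto
      also have "\<dots> \<le> exp (A / real n) * (exp (A * (real i / real n)) * ((real i / real n) * \<delta>))"
        using assms by (intro mult_right_mono exp_ge_add_one_self) auto
      finally show "(1 + A / real n) * a i \<le> exp (A / real n) * (exp (A * (real i / real n)) * ((real i / real n) * \<delta>))" .
      have "1 * (\<delta> / real n) \<le> exp (A * (real (Suc i) / real n)) * (\<delta> / real n)"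
        using assms by (intro mult_right_mono) auto
      then show "\<delta> / real n \<le> exp (A * (real (Suc i) / real n)) * (\<delta> / real n)" by simp
    qed
    also have "exp (A / real n) * (exp (A * (real i / real n)) * ((real i / real n) * \<delta>))
        = exp (A * (real (Suc i) / real n)) * ((real i / real n) * \<delta>)"
      by (simp add: add_divide_distrib distrib_left flip: exp_add mult.assoc)
    also have "exp (A * (real (Suc i) / real n)) * ((real i / real n) * \<delta>) + exp (A * (real (Suc i) / real n)) * (\<delta> / real n)
        = exp (A * (real (Suc i) / real n)) * ((real (Suc i) / real n) * \<delta>)"
      by (simp add: add_divide_distrib distrib_left distrib_right)
    finally show ?case .
  qed (simp add: assms)
  from this[of n] show ?thesis using assms(5) by simp
qed

text \<open>Scheme and flow are compared at grid points. Uniform continuity of the velocity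
  \<open>Y\<close> makes the truncation error of a step at most \<open>\<epsilon> / N\<close>, the
  coefficients contribute errors of the same order, and the Gronwall bound sums them up.\<close>

lemma layer_tendsto_flow:
  fixes K :: "real \<Rightarrow> real^'d::finite^'d"
  assumes \<sigma>: "C-lipschitz_on UNIV \<sigma>" and K: "continuous_on {0..1} K" and b: "continuous_on {0..1} b"
    and n: "filterlim n at_top sequentially"
    and Kn: "grid_converges n Kn K" and bn: "grid_converges n bn b"
  shows "(\<lambda>k. layer \<sigma> (n k) (Kn k) (bn k) x (n k)) \<longlonglongrightarrow> flow \<sigma> K b x 1"
proof -
  define X where "X = flow \<sigma> K b x"
  define Y where "Y t = \<sigma> (K t *v X t + b t)" for t
  have X0: "X 0 = x" and dX: "\<And>t. t \<in> {0..1} \<Longrightarrow> (X has_vector_derivative Y t) (at t within {0..1})"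
    using flow_is_flow[OF \<sigma> K b, of x] by (auto simp: is_flow_def X_def Y_def)
  have Xc: "continuous_on {0..1} X"
    by (rule continuous_on_vector_derivative[OF dX])
  have Yc: "continuous_on {0..1} Y" unfolding Y_def
    by (intro continuous_on_compose2[OF lipschitz_on_continuous_on[OF \<sigma>]] continuous_on_add
        continuous_on_matrix_vector_mult K b Xc) auto
  have C: "C \<ge> 0" using \<sigma> by (rule lipschitz_on_nonneg)
  obtain B where B: "B > 0" "\<And>(A::real^'d^'d) x. norm (A *v x) \<le> norm A * norm x * B"
    using bounded_bilinear.pos_bounded[OF bounded_bilinear_matrix_vector_mult] by metis
  have bdd: "\<exists>M>0. \<forall>t\<in>{0..1}. norm (f t) \<le> M" if "continuous_on {0..1} f" for f :: "real \<Rightarrow> 'x::real_normed_vector"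
  proof -
    have "bounded (f ` {0..1})" by (intro compact_imp_bounded compact_continuous_image that) auto
    then show ?thesis unfolding bounded_pos by auto
  qed
  obtain M where M: "M > 0" "\<And>t. t \<in> {0..1} \<Longrightarrow> norm (K t) \<le> M" using bdd[OF K] by blast
  obtain R where R: "R > 0" "\<And>t. t \<in> {0..1} \<Longrightarrow> norm (X t) \<le> R" using bdd[OF Xc] by blast
  \<comment> \<open>\<open>A\<close> is a Lipschitz constant of the discrete right-hand side in the
    state; \<open>M + 1\<close> bounds the discrete matrices because \<epsilon> below is capped at
    1. In \<open>c\<close>, the term \<open>C * (R * B + 1)\<close> collects the errors in the
    matrix and the bias, and the final 1 the truncation error.\<close>
  define A where "A = C * ((M + 1) * B)"
  define c where "c = C * (R * B + 1) + 1"
  have A: "A \<ge> 0" and c: "c > 0" using C M B R by (auto simp: A_def c_def intro!: add_nonneg_pos)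
  show ?thesis
  proof (rule LIMSEQ_I)
    fix e :: real assume e: "e > 0"
    define \<epsilon> where "\<epsilon> = min 1 (e / (2 * exp A * c))"
    have \<epsilon>: "\<epsilon> > 0" "\<epsilon> \<le> 1" "exp A * (c * \<epsilon>) < e"
    proof -
      show "\<epsilon> > 0" "\<epsilon> \<le> 1" using e c by (simp_all add: \<epsilon>_def)
      have "exp A * c * \<epsilon> \<le> exp A * c * (e / (2 * exp A * c))"
        using c by (intro mult_left_mono) (auto simp: \<epsilon>_def)
      also have "\<dots> = e / 2" using c by simp
      also have "\<dots> < e" using e by simp
      finally show "exp A * (c * \<epsilon>) < e" by (simp add: mult.assoc)
    qed
    have "uniformly_continuous_on {0..1} Y" by (rule compact_uniformly_continuous[OF Yc]) simp
    then obtain d where d: "d > 0" "\<And>s t. s \<in> {0..1} \<Longrightarrow> t \<in> {0..1} \<Longrightarrow> dist t s < d \<Longrightarrow> dist (Y t) (Y s) < \<epsilon>"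
      using \<epsilon>(1) unfolding uniformly_continuous_on_def by metis
    obtain m :: nat where m: "1 / real (Suc m) < d" using d(1) nat_approx_posE by blast
    have "\<forall>\<^sub>F k in sequentially. (\<forall>i<n k. norm (Kn k i - K (real i / real (n k))) < \<epsilon>) \<and>
        (\<forall>i<n k. norm (bn k i - b (real i / real (n k))) < \<epsilon>) \<and> n k \<ge> Suc m"
      using Kn bn n \<epsilon>(1) by (intro eventually_conj) (auto simp: grid_converges_def filterlim_at_top)
    then have "\<forall>\<^sub>F k in sequentially. norm (layer \<sigma> (n k) (Kn k) (bn k) x (n k) - flow \<sigma> K b x 1) < e"
    proof eventually_elim
      case (elim k)
      define N where "N = n k"
      have N: "N \<ge> Suc m" "N > 0" using elim by (auto simp: N_def)
      have "1 / real N \<le> 1 / real (Suc m)" using N by (intro divide_left_mono) auto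
      then have Nd: "1 / real N < d" using m by linarith
      define l where "l i = layer \<sigma> N (Kn k) (bn k) x i" for i
      define a where "a i = norm (l i - X (real i / real N))" for i
      have "a N \<le> exp A * (c * \<epsilon>)"
      proof (rule discrete_gronwall)
        show "a 0 = 0" by (simp add: a_def l_def X0)
        fix i assume i: "i < N"
        define s where "s = real i / real N"
        define t where "t = real (Suc i) / real N"
        have st: "s \<in> {0..1}" "t \<in> {0..1}" "s \<le> t" "t - s = 1 / real N"
          using i N by (auto simp: s_def t_def field_simps)
        have hi: "(Y has_integral (X t - X s)) {s..t}"
          by (rule fundamental_theorem_of_calculus[OF st(3)])
            (use st in \<open>auto intro!: has_vector_derivative_within_subset[OF dX]\<close>)
        have "norm ((X t - X s) - (t - s) *\<^sub>R Y s) \<le> \<epsilon> * (t - s)"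
        proof -
          have "((\<lambda>r. Y r - Y s) has_integral (X t - X s) - (t - s) *\<^sub>R Y s) (cbox s t)"
            using has_integral_diff[OF hi has_integral_const_real[of "Y s" s t]] st by simp
          moreover have "norm (Y r - Y s) \<le> \<epsilon>" if "r \<in> cbox s t" for r
          proof -
            have "r \<in> {0..1}" "dist r s < d" using that st Nd by (auto simp: dist_real_def)
            from d(2)[OF st(1) this] show ?thesis by (simp add: dist_norm)
          qed
          ultimately show ?thesis
            using has_integral_bound[of \<epsilon> "\<lambda>r. Y r - Y s" _ s t] \<epsilon>(1) st(3) by force
        qed
        then have e1: "norm ((X t - X s) - (1 / real N) *\<^sub>R Y s) \<le> \<epsilon> / real N" by (simp add: st(4))
        have Ki: "norm (Kn k i - K s) < \<epsilon>" and bi: "norm (bn k i - b s) < \<epsilon>"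
          using elim i by (auto simp: N_def s_def)
        have Kb: "norm (Kn k i) \<le> M + 1"
          using Ki \<epsilon>(2) M(2)[OF st(1)] norm_triangle_sub[of "Kn k i" "K s"] by linarith
        have "norm (\<sigma> (Kn k i *v l i + bn k i) - Y s) \<le> C * norm ((Kn k i *v l i + bn k i) - (K s *v X s + b s))"
          using lipschitz_onD[OF \<sigma>, of "Kn k i *v l i + bn k i" "K s *v X s + b s"] by (simp add: Y_def dist_norm)
        also have "(Kn k i *v l i + bn k i) - (K s *v X s + b s)
            = Kn k i *v (l i - X s) + (Kn k i - K s) *v X s + (bn k i - b s)"
          by (simp add: matrix_vector_mult_diff_distrib matrix_vector_mult_diff_rdistrib)
        also have "norm \<dots> \<le> norm (Kn k i *v (l i - X s)) + norm ((Kn k i - K s) *v X s) + norm (bn k i - b s)"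
          by (intro norm_triangle_le add_right_mono norm_triangle_ineq)
        also have "\<dots> \<le> (M + 1) * a i * B + \<epsilon> * R * B + \<epsilon>"
        proof (intro add_mono)
          have "norm (Kn k i *v (l i - X s)) \<le> norm (Kn k i) * norm (l i - X s) * B" by (rule B)
          also have "\<dots> \<le> (M + 1) * a i * B"
            unfolding a_def s_def[symmetric] using B Kb by (intro mult_right_mono) auto
          finally show "norm (Kn k i *v (l i - X s)) \<le> (M + 1) * a i * B" .
          have "norm ((Kn k i - K s) *v X s) \<le> norm (Kn k i - K s) * norm (X s) * B" by (rule B)
          also have "\<dots> \<le> \<epsilon> * R * B"
            using B Ki R(2)[OF st(1)] \<epsilon>(1) by (intro mult_right_mono mult_mono) auto
          finally show "norm ((Kn k i - K s) *v X s) \<le> \<epsilon> * R * B" .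
        qed (use bi in simp)
        finally have e2: "norm (\<sigma> (Kn k i *v l i + bn k i) - Y s) \<le> C * ((M + 1) * a i * B + \<epsilon> * R * B + \<epsilon>)"
          using C by (simp add: mult_left_mono)
        have "l (Suc i) - X t = (l i - X s) + (1 / real N) *\<^sub>R (\<sigma> (Kn k i *v l i + bn k i) - Y s) - ((X t - X s) - (1 / real N) *\<^sub>R Y s)"
          by (simp add: l_def algebra_simps)
        then have "a (Suc i) = norm ((l i - X s) + (1 / real N) *\<^sub>R (\<sigma> (Kn k i *v l i + bn k i) - Y s) - ((X t - X s) - (1 / real N) *\<^sub>R Y s))"
          by (simp only: a_def t_def[symmetric])
        also have "\<dots> \<le> a i + (1 / real N) * norm (\<sigma> (Kn k i *v l i + bn k i) - Y s) + norm ((X t - X s) - (1 / real N) *\<^sub>R Y s)"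
          by (intro order_trans[OF norm_triangle_ineq4] add_right_mono order_trans[OF norm_triangle_ineq])
            (simp add: a_def s_def)
        also have "\<dots> \<le> a i + (1 / real N) * (C * ((M + 1) * a i * B + \<epsilon> * R * B + \<epsilon>)) + \<epsilon> / real N"
          by (intro add_mono mult_left_mono e1 e2) auto
        also have "\<dots> = (1 + A / real N) * a i + c * \<epsilon> / real N"
          by (simp add: A_def c_def add_divide_distrib algebra_simps)
        finally show "a (Suc i) \<le> (1 + A / real N) * a i + c * \<epsilon> / real N" .
      qed (use A c \<epsilon> N in auto)
      also have "\<dots> < e" by (rule \<epsilon>(3))
      finally show ?case using N by (simp add: a_def l_def X_def N_def)
    qed
    then show "\<exists>k0. \<forall>k\<ge>k0. norm (layer \<sigma> (n k) (Kn k) (bn k) x (n k) - flow \<sigma> K b x 1) < e"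
      by (simp add: eventually_sequentially)
  qed
qed

section \<open>Compactness\<close>

text \<open>The functions may jump, but by amounts that vanish with \<open>\<epsilon> k\<close>.
  After a diagonal choice on the rational points, comparison with finitely many points j/m gives a
  uniform Cauchy property, and the limit inherits the modulus without \<epsilon>, hence is
  continuous.\<close>

lemma asymptotic_arzela_ascoli:
  fixes F :: "nat \<Rightarrow> real \<Rightarrow> 'a::euclidean_space"
  assumes bound: "\<And>k t. t \<in> {0..1} \<Longrightarrow> norm (F k t) \<le> B"
    and incr: "\<And>k s t. s \<in> {0..1} \<Longrightarrow> t \<in> {0..1} \<Longrightarrow> norm (F k t - F k s) \<le> C * sqrt (\<bar>t - s\<bar> + \<epsilon> k)"
    and \<epsilon>: "\<epsilon> \<longlonglongrightarrow> 0" and C: "C \<ge> 0"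
  obtains q :: "nat \<Rightarrow> nat" and u where "strict_mono q" "continuous_on {0..1} u" "uniform_limit {0..1} (\<lambda>k. F (q k)) u sequentially"
proof -
  obtain q :: "nat \<Rightarrow> nat" where q: "strict_mono q" "\<And>t. t \<in> \<rat> \<inter> {0..1} \<Longrightarrow> \<exists>l. (\<lambda>k. F (q k) t) \<longlonglongrightarrow> l"
    using function_convergent_subsequence[of "\<rat> \<inter> {0..1}" F B] bound countable_rat by (metis Int_iff countable_Int1)
  have \<epsilon>q: "(\<lambda>k. \<epsilon> (q k)) \<longlonglongrightarrow> 0" using LIMSEQ_subseq_LIMSEQ[OF \<epsilon> q(1)] by (simp add: o_def)
  have "uniformly_Cauchy_on {0..1} (\<lambda>k. F (q k))"
  proof (rule uniformly_Cauchy_onI)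
    fix e :: real assume e: "e > 0"
    \<comment> \<open>One summand 1/m will bound the distance to the grid point, the other the error
      \<open>\<epsilon> (q k)\<close>.\<close>
    have "(\<lambda>m. C * sqrt (1 / real (Suc m) + 1 / real (Suc m))) \<longlonglongrightarrow> C * sqrt (0 + 0)"
      by (intro tendsto_intros LIMSEQ_inverse_real_of_nat[unfolded inverse_eq_divide])
    then have "\<forall>\<^sub>F m in sequentially. C * sqrt (1 / real (Suc m) + 1 / real (Suc m)) < e / 3"
      by (rule order_tendstoD(2)) (use e in simp)
    then obtain m0 where m0: "C * sqrt (1 / real (Suc m0) + 1 / real (Suc m0)) < e / 3"
      by (auto simp: eventually_sequentially)
    define m where "m = Suc m0"
    have m: "m > 0" "C * sqrt (1 / real m + 1 / real m) < e / 3" using m0 by (simp_all add: m_def)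
    have "\<exists>k0. \<forall>a\<ge>k0. \<forall>b\<ge>k0. dist (F (q a) (real j / real m)) (F (q b) (real j / real m)) < e / 3" if "j \<le> m" for j
    proof -
      have "real j / real m \<in> \<rat> \<inter> {0..1}" using that m by auto
      then have "Cauchy (\<lambda>k. F (q k) (real j / real m))" using q(2) LIMSEQ_imp_Cauchy by blast
      moreover have "e / 3 > 0" using e by simp
      ultimately show ?thesis unfolding Cauchy_def by blast
    qed
    then obtain k0 where k0: "\<And>j a b. j \<le> m \<Longrightarrow> a \<ge> k0 j \<Longrightarrow> b \<ge> k0 j \<Longrightarrow>
        dist (F (q a) (real j / real m)) (F (q b) (real j / real m)) < e / 3" by metis
    have "\<forall>\<^sub>F k in sequentially. \<epsilon> (q k) < 1 / real m"
      by (rule order_tendstoD(2)[OF \<epsilon>q]) (use m in simp)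
    then obtain k1 where k1: "\<And>k. k \<ge> k1 \<Longrightarrow> \<epsilon> (q k) < 1 / real m" by (auto simp: eventually_sequentially)
    define k2 where "k2 = k1 + (\<Sum>j\<le>m. k0 j)"
    have k02: "k0 j \<le> k2" if "j \<le> m" for j
      unfolding k2_def by (rule trans_le_add2) (use that in \<open>auto intro: member_le_sum\<close>)
    show "\<exists>k. \<forall>t\<in>{0..1}. \<forall>a\<ge>k. \<forall>b\<ge>k. dist (F (q a) t) (F (q b) t) < e"
    proof (intro exI[of _ k2] ballI allI impI)
      fix t :: real and a b assume t: "t \<in> {0..1}" and ab: "a \<ge> k2" "b \<ge> k2"
      define j where "j = nat \<lfloor>real m * t\<rfloor>"
      have "real m * t \<le> real m" "0 \<le> real m * t" using t by (auto simp: mult_left_le)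
      then have j: "j \<le> m" "real j \<le> real m * t" "real m * t < real j + 1" unfolding j_def by linarith+
      define s where "s = real j / real m"
      have "t - s = (real m * t - real j) / real m" using m by (simp add: s_def field_simps)
      moreover have "0 \<le> (real m * t - real j) / real m" "(real m * t - real j) / real m \<le> 1 / real m"
        using j by (auto intro!: divide_right_mono)
      ultimately have s: "s \<in> {0..1}" "\<bar>t - s\<bar> \<le> 1 / real m" using j m by (auto simp: s_def)
      have near: "norm (F (q k) t - F (q k) s) < e / 3" if "k \<ge> k2" for k
      proof -
        have "norm (F (q k) t - F (q k) s) \<le> C * sqrt (\<bar>t - s\<bar> + \<epsilon> (q k))" by (rule incr[OF s(1) t])
        also have "\<dots> \<le> C * sqrt (1 / real m + 1 / real m)"
          using s(2) k1[of k] that by (intro mult_left_mono C real_sqrt_le_mono) (auto simp: k2_def)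
        finally show ?thesis using m(2) by simp
      qed
      have "dist (F (q a) s) (F (q b) s) < e / 3"
        unfolding s_def using k02[OF j(1)] ab by (intro k0 j) auto
      then have "norm (F (q a) s - F (q b) s) < e / 3" by (simp add: dist_norm)
      moreover have "norm ((F (q a) t - F (q a) s) + (F (q a) s - F (q b) s) - (F (q b) t - F (q b) s))
          \<le> norm (F (q a) t - F (q a) s) + norm (F (q a) s - F (q b) s) + norm (F (q b) t - F (q b) s)"
        by (intro order_trans[OF norm_triangle_ineq4] add_right_mono norm_triangle_ineq)
      then have "norm (F (q a) t - F (q b) t) \<le> norm (F (q a) t - F (q a) s) + norm (F (q a) s - F (q b) s) + norm (F (q b) t - F (q b) s)"
        by simp
      ultimately show "dist (F (q a) t) (F (q b) t) < e"
        using near[OF ab(1)] near[OF ab(2)] unfolding dist_norm by linarith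
    qed
  qed
  then obtain u where u: "uniform_limit {0..1} (\<lambda>k. F (q k)) u sequentially"
    using Cauchy_uniformly_convergent uniformly_convergent_on_def by blast
  have hoelder: "norm (u t - u s) \<le> C * sqrt \<bar>t - s\<bar>" if "s \<in> {0..1}" "t \<in> {0..1}" for s t
  proof (rule LIMSEQ_le)
    show "(\<lambda>k. norm (F (q k) t - F (q k) s)) \<longlonglongrightarrow> norm (u t - u s)"
      by (intro tendsto_intros tendsto_uniform_limitI[OF u] that)
    have "(\<lambda>k. C * sqrt (\<bar>t - s\<bar> + \<epsilon> (q k))) \<longlonglongrightarrow> C * sqrt (\<bar>t - s\<bar> + 0)"
      by (intro tendsto_intros \<epsilon>q)
    then show "(\<lambda>k. C * sqrt (\<bar>t - s\<bar> + \<epsilon> (q k))) \<longlonglongrightarrow> C * sqrt \<bar>t - s\<bar>" by simp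
  qed (use incr[OF that] in blast)
  have "continuous_on {0..1} u" unfolding continuous_on
  proof
    fix s :: real assume s: "s \<in> {0..1}"
    have "((\<lambda>t. C * sqrt \<bar>t - s\<bar>) \<longlongrightarrow> C * sqrt \<bar>s - s\<bar>) (at s within {0..1})"
      by (intro tendsto_intros)
    then have "((\<lambda>t. u t - u s) \<longlongrightarrow> 0) (at s within {0..1})"
      by (intro Lim_null_comparison[of "\<lambda>t. u t - u s" "\<lambda>t. C * sqrt \<bar>t - s\<bar>"])
        (use hoelder[OF s] in \<open>auto simp: eventually_at_filter\<close>)
    then show "(u \<longlongrightarrow> u s) (at s within {0..1})" by (simp add: LIM_zero_iff)
  qed
  then show ?thesis using that q(1) u by blast
qed

text \<open>The cap at \<open>n - 1\<close> matters at \<open>t = 1\<close>, where the floor would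
  point beyond the tuple. Composing a tuple with \<open>grid_index n\<close> gives its step function
  on the closed interval.\<close>

definition grid_index :: "nat \<Rightarrow> real \<Rightarrow> nat" where
  "grid_index n t = min (nat \<lfloor>real n * t\<rfloor>) (n - 1)"

lemma grid_index_less: "n \<ge> 1 \<Longrightarrow> grid_index n t < n"
  by (simp add: grid_index_def)

lemma grid_index_mono: "s \<le> t \<Longrightarrow> grid_index n s \<le> grid_index n t"
  unfolding grid_index_def by (intro min.mono nat_mono floor_mono mult_left_mono) auto

lemma grid_index_grid:
  assumes "i < n"
  shows "grid_index n (real i / real n) = i"
  using assms by (simp add: grid_index_def)

lemma grid_index_0: "grid_index n 0 = 0" and grid_index_1: "grid_index n 1 = n - 1"
  by (simp_all add: grid_index_def)

lemma grid_index_diff: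
  assumes "0 \<le> s" "s \<le> t"
  shows "real (grid_index n t - grid_index n s) \<le> real n * (t - s) + 1"
proof -
  have "grid_index n t - grid_index n s \<le> nat \<lfloor>real n * t\<rfloor> - nat \<lfloor>real n * s\<rfloor>"
    unfolding grid_index_def by linarith
  then have "real (grid_index n t - grid_index n s) \<le> real (nat \<lfloor>real n * t\<rfloor> - nat \<lfloor>real n * s\<rfloor>)" by simp
  also have "\<dots> = real_of_int \<lfloor>real n * t\<rfloor> - real_of_int \<lfloor>real n * s\<rfloor>"
  proof -
    have "0 \<le> real n * s" "real n * s \<le> real n * t"
      using assms by (auto intro!: mult_left_mono)
    then have "0 \<le> real n * s" "0 \<le> real n * t" "\<lfloor>real n * s\<rfloor> \<le> \<lfloor>real n * t\<rfloor>"
      by (auto intro: floor_mono)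
    then show ?thesis by (subst of_nat_diff) (auto intro: nat_mono)
  qed
  also have "\<dots> \<le> real n * t - real n * s + 1" by linarith
  finally show ?thesis by (simp add: algebra_simps)
qed

lemma sum_monotone_blocks:
  fixes a :: "nat \<Rightarrow> nat" and f :: "nat \<Rightarrow> real"
  assumes "\<And>i. a i \<le> a (Suc i)"
  shows "(\<Sum>i<m. sum f {a i<..a (Suc i)}) = sum f {a 0<..a m}"
proof (induction m)
  case (Suc m)
  have "a 0 \<le> a m" by (rule lift_Suc_mono_le[of a]) (use assms in auto)
  then have "{a 0<..a (Suc m)} = {a 0<..a m} \<union> {a m<..a (Suc m)}" using assms[of m] by auto
  then show ?case using Suc by (simp add: sum.union_disjoint)
qed simp

section \<open>Increment energies on coarse and fine grids\<close>

definition increment_energy :: "('a::real_vector \<Rightarrow> real) \<Rightarrow> nat \<Rightarrow> (nat \<Rightarrow> 'a) \<Rightarrow> real" where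
  "increment_energy N n K = real n * (\<Sum>i = 1..n - 1. (N (K i - K (i - 1)))\<^sup>2)"

lemma discrete_reg_eq: "discrete_reg N \<tau> n K = increment_energy N n K + \<tau> * (N (K 0))\<^sup>2"
  by (simp add: discrete_reg_def increment_energy_def)

lemma increment_energy_nonneg: "increment_energy N n K \<ge> 0"
  by (simp add: increment_energy_def sum_nonneg)

lemma increment_sq_le:
  assumes N: "is_norm N" and "i \<le> j"
  shows "(N (K j - K i))\<^sup>2 \<le> real (j - i) * (\<Sum>l\<in>{i<..j}. (N (K l - K (l - 1)))\<^sup>2)"
proof -
  have "(\<Sum>l\<in>{i<..j}. K l - K (l - 1)) = K j - K i"
    using \<open>i \<le> j\<close>
  proof (induction rule: dec_induct)
    case (step j)
    then have "{i<..Suc j} = insert (Suc j) {i<..j}" by auto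
    then show ?case using step by simp
  qed simp
  then have "N (K j - K i) \<le> (\<Sum>l\<in>{i<..j}. N (K l - K (l - 1)))" using is_norm_sum[OF N] by metis
  then have "(N (K j - K i))\<^sup>2 \<le> (\<Sum>l\<in>{i<..j}. N (K l - K (l - 1)))\<^sup>2"
    by (intro power_mono is_norm_nonneg[OF N])
  also have "\<dots> \<le> (\<Sum>l\<in>{i<..j}. (N (K l - K (l - 1)))\<^sup>2) * card {i<..j}"
    by (rule sum_squared_le_sum_of_squares)
  finally show ?thesis by (simp add: mult.commute)
qed

text \<open>A coarse increment telescopes into at most n/m + 1 fine ones, so Cauchy-Schwarz costs
  this factor; multiplied by \<open>m\<close> it becomes n + m. The extra 1 is there because
  \<open>m\<close> need not divide \<open>n\<close>.\<close>

lemma quot_energy_sample_le: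
  assumes N: "is_norm N" and n: "n \<ge> 1" and m: "m \<ge> 1"
  shows "quot_energy N (\<lambda>t. K (grid_index n t)) m \<le> (1 + real m / real n) * increment_energy N n K"
proof -
  define a where "a i = grid_index n (real i / real m)" for i
  define f where "f l = (N (K l - K (l - 1)))\<^sup>2" for l
  have a: "a i \<le> a (Suc i)" for i unfolding a_def by (intro grid_index_mono divide_right_mono) auto
  have step: "(N (K (a (Suc i)) - K (a i)))\<^sup>2 \<le> (real n / real m + 1) * sum f {a i<..a (Suc i)}" for i
  proof -
    have "real (a (Suc i) - a i) \<le> real n * (real (Suc i) / real m - real i / real m) + 1"
      unfolding a_def by (rule grid_index_diff) (auto intro: divide_right_mono)
    also have "\<dots> = real n / real m + 1" using m by (simp add: field_simps)
    finally have "real (a (Suc i) - a i) * sum f {a i<..a (Suc i)} \<le> (real n / real m + 1) * sum f {a i<..a (Suc i)}"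
      by (intro mult_right_mono sum_nonneg) (auto simp: f_def)
    then show ?thesis using increment_sq_le[OF N a[of i], of K] unfolding f_def by linarith
  qed
  have "quot_energy N (\<lambda>t. K (grid_index n t)) m = real m * (\<Sum>i<m. (N (K (a (Suc i)) - K (a i)))\<^sup>2)"
    by (simp add: quot_energy_def a_def)
  also have "\<dots> \<le> real m * (\<Sum>i<m. (real n / real m + 1) * sum f {a i<..a (Suc i)})"
    by (intro mult_left_mono sum_mono step) simp
  also have "\<dots> = (real n + real m) * sum f {a 0<..a m}"
    unfolding sum_distrib_left[symmetric] sum_monotone_blocks[of a f m, OF a] using m by (simp add: field_simps)
  also have "{a 0<..a m} = {1..n - 1}" using m by (auto simp: a_def grid_index_0 grid_index_1)
  also have "(real n + real m) * sum f {1..n - 1} = (1 + real m / real n) * increment_energy N n K"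
    using n by (simp add: increment_energy_def f_def field_simps)
  finally show ?thesis .
qed

text \<open>A discrete form of the embedding of \<open>H\<^sup>1\<close> into Hoelder functions of
  exponent 1/2. Positivity of \<tau> controls the entry at 0, and the increment bound over a length
  of at most 1 carries this to every other entry.\<close>

lemma discrete_reg_bounds:
  assumes N: "is_norm N" and n: "n \<ge> 1" and \<tau>: "\<tau> > 0" and M: "discrete_reg N \<tau> n K \<le> M"
  shows "i \<le> j \<Longrightarrow> j < n \<Longrightarrow> N (K j - K i) \<le> sqrt (M * (real (j - i) / real n))"
    and "i < n \<Longrightarrow> N (K i) \<le> sqrt M + sqrt (M / \<tau>)"
proof -
  have E: "increment_energy N n K \<le> M" "\<tau> * (N (K 0))\<^sup>2 \<le> M"
    using M \<tau> increment_energy_nonneg[of N n K] unfolding discrete_reg_eq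
    by (auto intro: order_trans[rotated])
  have M0: "M \<ge> 0" using E(1) increment_energy_nonneg[of N n K] by linarith
  have incr: "N (K j - K i) \<le> sqrt (M * (real (j - i) / real n))" if "i \<le> j" "j < n" for i j
  proof (rule real_le_rsqrt)
    have "(N (K j - K i))\<^sup>2 \<le> real (j - i) * (\<Sum>l\<in>{i<..j}. (N (K l - K (l - 1)))\<^sup>2)"
      by (rule increment_sq_le[OF N that(1)])
    also have "\<dots> \<le> real (j - i) * (\<Sum>l\<in>{1..n - 1}. (N (K l - K (l - 1)))\<^sup>2)"
      using that by (intro mult_left_mono sum_mono2) auto
    also have "\<dots> = (real (j - i) / real n) * increment_energy N n K"
      using n by (simp add: increment_energy_def)
    also have "\<dots> \<le> (real (j - i) / real n) * M" by (intro mult_left_mono E) simp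
    finally show "(N (K j - K i))\<^sup>2 \<le> M * (real (j - i) / real n)" by (simp add: mult.commute)
  qed
  then show "i \<le> j \<Longrightarrow> j < n \<Longrightarrow> N (K j - K i) \<le> sqrt (M * (real (j - i) / real n))" .
  assume i: "i < n"
  have "M * (real i / real n) \<le> M * 1" using i M0 by (intro mult_left_mono) (auto simp: field_simps)
  then have "sqrt (M * (real i / real n)) \<le> sqrt M" by simp
  then have "N (K i - K 0) \<le> sqrt M" using incr[of 0 i] i unfolding diff_zero by linarith
  moreover have "N (K 0) \<le> sqrt (M / \<tau>)" using E(2) \<tau> by (intro real_le_rsqrt) (simp add: field_simps)
  ultimately show "N (K i) \<le> sqrt M + sqrt (M / \<tau>)"
    using is_norm_triangle[OF N, of "K i - K 0" "K 0"] by simp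
qed

lemma bounded_real_convergent_subsequence:
  fixes f :: "nat \<Rightarrow> real"
  assumes "\<And>k. f k \<in> {a..b}"
  obtains q :: "nat \<Rightarrow> nat" and l where "strict_mono q" "(\<lambda>k. f (q k)) \<longlonglongrightarrow> l"
proof -
  have "\<exists>l\<in>{a..b}. \<exists>q. strict_mono q \<and> (f \<circ> q) \<longlonglongrightarrow> l"
    using compact_Icc[of a b] assms unfolding compact_eq_seq_compact_metric seq_compact_def by blast
  then show ?thesis using that by (auto simp: o_def)
qed

text \<open>The subsequence is chosen so that the regularisers converge as well. Lower
  semicontinuity then reads \<open>continuum_reg N \<tau> u \<le> \<rho>\<close> and combines with
  the other limits by plain arithmetic.\<close>

lemma discrete_reg_compactness:
  fixes K :: "nat \<Rightarrow> nat \<Rightarrow> 'a::euclidean_space"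
  assumes N: "is_norm N" and \<tau>: "\<tau> > 0" and n: "filterlim n at_top sequentially" "\<And>k. n k \<ge> 1"
    and M: "\<And>k. discrete_reg N \<tau> (n k) (K k) \<le> M"
  obtains q :: "nat \<Rightarrow> nat" and u \<rho> where "strict_mono q" "u \<in> H1_space"
    "grid_converges (\<lambda>k. n (q k)) (\<lambda>k. K (q k)) u"
    "(\<lambda>k. discrete_reg N \<tau> (n (q k)) (K (q k))) \<longlonglongrightarrow> \<rho>" "continuum_reg N \<tau> u \<le> \<rho>"
proof -
  obtain C where C: "C > 0" "\<And>v. norm v \<le> C * N v" using is_norm_lower[OF N] by blast
  define F where "F k t = K k (grid_index (n k) t)" for k t
  have reg0: "discrete_reg N \<tau> (n k) (K k) \<ge> 0" for k
    using \<tau> increment_energy_nonneg[of N "n k" "K k"] unfolding discrete_reg_eq by simp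
  have M0: "M \<ge> 0" using reg0[of 0] M[of 0] by linarith
  have n0: "(\<lambda>k. 1 / real (n k)) \<longlonglongrightarrow> 0"
    by (rule real_tendsto_divide_at_top[OF tendsto_const filterlim_compose[OF filterlim_real_sequentially n(1)]])
  have incr1: "norm (F k t - F k s) \<le> (C * sqrt M) * sqrt (\<bar>t - s\<bar> + 1 / real (n k))"
    if st: "s \<in> {0..1}" "t \<in> {0..1}" "s \<le> t" for k s t
  proof -
    let ?i = "grid_index (n k) s" and ?j = "grid_index (n k) t"
    have "N (K k ?j - K k ?i) \<le> sqrt (M * (real (?j - ?i) / real (n k)))"
      by (intro discrete_reg_bounds(1)[OF N n(2) \<tau> M] grid_index_mono st grid_index_less n(2))
    also have "\<dots> \<le> sqrt (M * ((real (n k) * (t - s) + 1) / real (n k)))"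
      using grid_index_diff[of s t "n k"] st by (intro real_sqrt_le_mono mult_left_mono divide_right_mono M0) auto
    also have "(real (n k) * (t - s) + 1) / real (n k) = \<bar>t - s\<bar> + 1 / real (n k)"
      using n(2)[of k] st by (simp add: field_simps)
    finally have "N (K k ?j - K k ?i) \<le> sqrt M * sqrt (\<bar>t - s\<bar> + 1 / real (n k))" by (simp add: real_sqrt_mult)
    then have "C * N (K k ?j - K k ?i) \<le> C * (sqrt M * sqrt (\<bar>t - s\<bar> + 1 / real (n k)))"
      using C by (intro mult_left_mono) auto
    then show ?thesis using C(2)[of "K k ?j - K k ?i"] by (simp add: F_def mult.assoc)
  qed
  have incr: "norm (F k t - F k s) \<le> (C * sqrt M) * sqrt (\<bar>t - s\<bar> + 1 / real (n k))"
    if "s \<in> {0..1}" "t \<in> {0..1}" for k s t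
    using incr1[OF that, of k] incr1[OF that(2,1), of k]
    by (cases "s \<le> t") (simp_all add: norm_minus_commute abs_minus_commute)
  have bound: "norm (F k t) \<le> C * (sqrt M + sqrt (M / \<tau>))" for k t
  proof -
    have "C * N (F k t) \<le> C * (sqrt M + sqrt (M / \<tau>))" unfolding F_def
      using C by (intro mult_left_mono discrete_reg_bounds(2)[OF N n(2) \<tau> M] grid_index_less n(2)) auto
    then show ?thesis using C(2)[of "F k t"] by linarith
  qed
  obtain q1 :: "nat \<Rightarrow> nat" and u where q1: "strict_mono q1" and u: "continuous_on {0..1} u"
    and ul: "uniform_limit {0..1} (\<lambda>k. F (q1 k)) u sequentially"
    using asymptotic_arzela_ascoli[of F, OF bound incr n0] C M0 by (metis less_imp_le mult_nonneg_nonneg real_sqrt_ge_zero)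
  have "discrete_reg N \<tau> (n (q1 k)) (K (q1 k)) \<in> {0..M}" for k using reg0 M by simp
  then obtain q2 :: "nat \<Rightarrow> nat" and \<rho> where q2: "strict_mono q2"
    and \<rho>: "(\<lambda>k. discrete_reg N \<tau> (n (q1 (q2 k))) (K (q1 (q2 k)))) \<longlonglongrightarrow> \<rho>"
    by (rule bounded_real_convergent_subsequence)
  define q where "q k = q1 (q2 k)" for k
  have q: "strict_mono q" using q1 q2 by (simp add: strict_mono_def q_def)
  have ulq: "uniform_limit {0..1} (\<lambda>k. F (q k)) u sequentially"
    unfolding q_def using filterlim_compose[OF ul filterlim_subseq[OF q2]] by (simp add: o_def)
  have grid: "grid_converges (\<lambda>k. n (q k)) (\<lambda>k. K (q k)) u"
    unfolding grid_converges_def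
  proof (intro allI impI)
    fix e :: real assume "e > 0"
    then have "\<forall>\<^sub>F k in sequentially. \<forall>t\<in>{0..1}. dist (F (q k) t) (u t) < e"
      using ulq by (simp add: uniform_limit_iff)
    then show "\<forall>\<^sub>F k in sequentially. \<forall>i<n (q k). norm (K (q k) i - u (real i / real (n (q k)))) < e"
    proof eventually_elim
      case (elim k)
      show ?case
      proof (intro allI impI)
        fix i assume i: "i < n (q k)"
        then have "real i / real (n (q k)) \<in> {0..1}" by simp
        with elim have "dist (F (q k) (real i / real (n (q k)))) (u (real i / real (n (q k)))) < e" by blast
        then show "norm (K (q k) i - u (real i / real (n (q k)))) < e"
          by (simp add: F_def grid_index_grid[OF i] dist_norm)
      qed
    qed
  qed
  have pw: "(\<lambda>k. F (q k) t) \<longlonglongrightarrow> u t" if "t \<in> {0..1}" for t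
    by (rule tendsto_uniform_limitI[OF ulq that])
  have K0: "(\<lambda>k. N (K (q k) 0)) \<longlonglongrightarrow> N (u 0)"
    using is_norm_tendsto[OF N pw[of 0]] by (simp add: F_def grid_index_0)
  \<comment> \<open>The initial term converges on its own because \<open>F (q k)\<close> converges
    at 0, so the increment energies have a limit too.\<close>
  define \<rho>' where "\<rho>' = \<rho> - \<tau> * (N (u 0))\<^sup>2"
  have "(\<lambda>k. discrete_reg N \<tau> (n (q k)) (K (q k)) - \<tau> * (N (K (q k) 0))\<^sup>2) \<longlonglongrightarrow> \<rho>'"
    unfolding \<rho>'_def by (intro tendsto_intros K0) (use \<rho> in \<open>simp add: q_def\<close>)
  then have inc: "(\<lambda>k. increment_energy N (n (q k)) (K (q k))) \<longlonglongrightarrow> \<rho>'"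
    by (simp add: discrete_reg_eq)
  have nq0: "(\<lambda>k. 1 / real (n (q k))) \<longlonglongrightarrow> 0"
    using LIMSEQ_subseq_LIMSEQ[OF n0 q] by (simp add: o_def)
  \<comment> \<open>Here \<open>m\<close> is fixed while \<open>k\<close> grows: only finitely many
    point values are involved on the left, and the factor on the right tends to 1.\<close>
  have quot: "quot_energy N u m \<le> \<rho>'" if m: "m \<ge> 1" for m
  proof (rule LIMSEQ_le)
    show "(\<lambda>k. quot_energy N (F (q k)) m) \<longlonglongrightarrow> quot_energy N u m"
      unfolding quot_energy_def
      using m by (intro tendsto_intros is_norm_tendsto[OF N] pw) (auto simp: field_simps)
    have "(\<lambda>k. (1 + real m * (1 / real (n (q k)))) * increment_energy N (n (q k)) (K (q k))) \<longlonglongrightarrow> (1 + real m * 0) * \<rho>'"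
      by (intro tendsto_intros nq0 inc)
    then show "(\<lambda>k. (1 + real m / real (n (q k))) * increment_energy N (n (q k)) (K (q k))) \<longlonglongrightarrow> \<rho>'" by simp
    show "\<exists>k0. \<forall>k\<ge>k0. quot_energy N (F (q k)) m \<le> (1 + real m / real (n (q k))) * increment_energy N (n (q k)) (K (q k))"
      using quot_energy_sample_le[OF N n(2) m] by (auto simp: F_def[abs_def])
  qed
  have "u \<in> H1_space" "(L2_norm N (weak_deriv u))\<^sup>2 \<le> \<rho>'"
    by (rule bounded_quot_energy_imp_H1[OF u N], rule quot, simp)+
  then have "u \<in> H1_space" "continuum_reg N \<tau> u \<le> \<rho>" by (simp_all add: continuum_reg_def \<rho>'_def)
  then show ?thesis using that[OF q _ grid] \<rho> by (simp add: q_def)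
qed

section \<open>Convergence of the piecewise constant interpolants\<close>

text \<open>Grid points are excluded because the cells in \<open>piecewise_const\<close> are open
  and leave the value 0 there.\<close>

lemma piecewise_const_eq:
  assumes n: "n \<ge> 1" and t: "t \<in> {0..1}" and off: "t \<notin> (\<lambda>i. real i / real n) ` {..n}"
  shows "\<exists>i<n. piecewise_const n K t = K i \<and> real i / real n < t \<and> t < real (Suc i) / real n"
proof -
  define j where "j = nat \<lfloor>real n * t\<rfloor>"
  have "real n * t \<le> real n" "0 \<le> real n * t" using t by (auto simp: mult_left_le)
  then have j: "real j \<le> real n * t" "real n * t < real j + 1" "j \<le> n" unfolding j_def by linarith+
  have ne: "real j / real n \<noteq> t" using off j(3) by auto
  then have lt: "real j / real n < t" "t < real (Suc j) / real n" using j n by (auto simp: field_simps less_le)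
  then have jn: "j < n" using t j(3) n by (cases "j = n") (auto simp: field_simps)
  have "piecewise_const n K t = (\<Sum>i = 1..n. if i = Suc j then K j else 0)"
    unfolding piecewise_const_def
  proof (rule sum.cong)
    fix i assume i: "i \<in> {1..n}"
    show "indicat_real {real (i - 1) / real n<..<real i / real n} t *\<^sub>R K (i - 1) = (if i = Suc j then K j else 0)"
    proof (cases "i = Suc j")
      case True
      then show ?thesis using lt by simp
    next
      case False
      have "t \<notin> {real (i - 1) / real n<..<real i / real n}"
      proof
        assume "t \<in> {real (i - 1) / real n<..<real i / real n}"
        then have "real (i - 1) < real n * t" "real n * t < real i" using n by (auto simp: field_simps)
        then have "real (i - 1) < real j + 1" "real j < real i" using j by linarith+
        then show False using False i by auto
      qed
      then show ?thesis using False by simp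
    qed
  qed simp
  also have "\<dots> = K j" using jn by (simp add: sum.delta)
  finally show ?thesis using jn lt by blast
qed

lemma AE_off_grid: "AE t in lebesgue_on {0..1}. t \<notin> (\<lambda>i. real i / real n) ` {..n}"
proof -
  have "negligible ((\<lambda>i. real i / real n) ` {..n})" by (rule negligible_finite) simp
  then have "AE t in lebesgue. t \<notin> (\<lambda>i. real i / real n) ` {..n}"
    by (intro AE_not_in) (simp add: negligible_iff_null_sets)
  then have "AE t in lebesgue. t \<in> {0..1} \<longrightarrow> t \<notin> (\<lambda>i. real i / real n) ` {..n}"
    by eventually_elim simp
  then show ?thesis by (subst AE_restrict_space_iff) auto
qed

lemma grid_converges_imp_L2_norm_tendsto:
  fixes K :: "nat \<Rightarrow> nat \<Rightarrow> 'a::euclidean_space"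
  assumes N: "is_norm N" and n: "filterlim n at_top sequentially"
    and u: "continuous_on {0..1} u" and grid: "grid_converges n K u"
  shows "(\<lambda>k. L2_norm N (\<lambda>t. piecewise_const (n k) (K k) t - u t)) \<longlonglongrightarrow> 0"
proof (rule LIMSEQ_I)
  fix r :: real assume r: "r > 0"
  obtain C where C: "C > 0" "\<And>v. N v \<le> C * norm v" using is_norm_upper[OF N] by blast
  \<comment> \<open>Two errors below \<open>e\<close>, the grid error and the oscillation of
    \<open>u\<close> within a cell, are magnified by at most \<open>C\<close> and add up to
    \<open>r / 2\<close>, which leaves room for the strict inequality.\<close>
  define e where "e = r / (4 * C)"
  have e: "e > 0" using r C by (simp add: e_def)
  have "uniformly_continuous_on {0..1} u" by (rule compact_uniformly_continuous[OF u]) simp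
  then obtain d where d: "d > 0" "\<And>s t. s \<in> {0..1} \<Longrightarrow> t \<in> {0..1} \<Longrightarrow> dist t s < d \<Longrightarrow> dist (u t) (u s) < e"
    using e unfolding uniformly_continuous_on_def by metis
  obtain m :: nat where m: "1 / real (Suc m) < d" using d(1) nat_approx_posE by blast
  have "\<forall>\<^sub>F k in sequentially. (\<forall>i<n k. norm (K k i - u (real i / real (n k))) < e) \<and> n k \<ge> Suc m"
    using grid n e by (intro eventually_conj) (auto simp: grid_converges_def filterlim_at_top)
  then have "\<forall>\<^sub>F k in sequentially. norm (L2_norm N (\<lambda>t. piecewise_const (n k) (K k) t - u t) - 0) < r"
  proof eventually_elim
    case (elim k)
    have "1 / real (n k) \<le> 1 / real (Suc m)" using elim by (intro divide_left_mono) auto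
    then have nd: "1 / real (n k) < d" using m by linarith
    have "AE t in lebesgue_on {0..1}. (N (piecewise_const (n k) (K k) t - u t))\<^sup>2 \<le> (r / 2)\<^sup>2"
      using AE_off_grid[of "n k"] AE_space
    proof eventually_elim
      case (elim t)
      then have t: "t \<in> {0..1}" by (simp add: space_restrict_space)
      obtain i where i: "i < n k" "piecewise_const (n k) (K k) t = K k i" "real i / real (n k) < t" "t < real (Suc i) / real (n k)"
        using piecewise_const_eq[of "n k" t "K k"] t elim \<open>_ \<and> Suc m \<le> n k\<close> by auto
      define s where "s = real i / real (n k)"
      have "s \<in> {0..1}" "dist s t < d" using i nd by (auto simp: s_def dist_real_def field_simps)
      then have "dist (u s) (u t) < e" using d(2) t by blast
      moreover have "norm (K k i - u s) < e" unfolding s_def using \<open>_ \<and> Suc m \<le> n k\<close> i(1) by blast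
      ultimately have "norm (K k i - u t) \<le> 2 * e"
        using norm_triangle_ineq[of "K k i - u s" "u s - u t"] by (simp add: dist_norm)
      then have "C * norm (K k i - u t) \<le> C * (2 * e)" using C by (intro mult_left_mono) auto
      also have "C * (2 * e) = r / 2" using C by (simp add: e_def)
      finally have "N (K k i - u t) \<le> r / 2" using C(2)[of "K k i - u t"] by linarith
      then show ?case using i(2) is_norm_nonneg[OF N] by (intro power_mono) auto
    qed
    then have "integral\<^sup>L (lebesgue_on {0..1}) (\<lambda>t. (N (piecewise_const (n k) (K k) t - u t))\<^sup>2)
        \<le> integral\<^sup>L (lebesgue_on {0..1::real}) (\<lambda>t. (r / 2)\<^sup>2)"
      by (intro integral_mono_AE') (auto intro: finite_measure.integrable_const[OF finite_measure_unit])
    also have "\<dots> = (r / 2)\<^sup>2" by (simp add: measure_restrict_space)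
    finally have "L2_norm N (\<lambda>t. piecewise_const (n k) (K k) t - u t) \<le> r / 2"
      unfolding L2_norm_def using r by (intro real_le_lsqrt) auto
    moreover have "L2_norm N (\<lambda>t. piecewise_const (n k) (K k) t - u t) \<ge> 0"
      unfolding L2_norm_def by (intro real_sqrt_ge_zero integral_nonneg_AE) simp
    ultimately show ?case using r by simp
  qed
  then show "\<exists>k0. \<forall>k\<ge>k0. norm (L2_norm N (\<lambda>t. piecewise_const (n k) (K k) t - u t) - 0) < r"
    by (simp add: eventually_sequentially)
qed

section \<open>Uniqueness of limits and independence of values outside the unit interval\<close>

lemma piecewise_const_L2_space: "piecewise_const n (K :: nat \<Rightarrow> 'a::euclidean_space) \<in> L2_space"
  unfolding L2_space_def
proof (intro CollectI conjI)
  show m: "piecewise_const n K \<in> borel_measurable (lebesgue_on {0..1})"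
    unfolding piecewise_const_def[abs_def]
    by (intro borel_measurable_sum borel_measurable_scaleR borel_measurable_const borel_measurable_indicator measurable_restrict_space1) auto
  define B where "B = (\<Sum>i = 1..n. norm (K (i - 1)))"
  have "norm (piecewise_const n K t) \<le> B" for t
    unfolding piecewise_const_def B_def by (rule sum_norm_le) (auto simp: indicator_def)
  then have "(norm (piecewise_const n K t))\<^sup>2 \<le> B\<^sup>2" for t by (intro power_mono) auto
  then show "integrable (lebesgue_on {0..1}) (\<lambda>t. (norm (piecewise_const n K t))\<^sup>2)"
    using m by (intro finite_measure.integrable_const_bound[OF finite_measure_unit, of _ "B\<^sup>2"]) auto
qed

text \<open>The squared triangle inequality makes the integral of
  \<open>(N (u t - v t))\<^sup>2\<close> zero. Continuity upgrades this to equality at every point,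
  in particular at 0, where the regulariser evaluates the function.\<close>

lemma L2_limit_unique:
  fixes K :: "nat \<Rightarrow> nat \<Rightarrow> 'a::euclidean_space"
  assumes N: "is_norm N" and uv: "continuous_on {0..1} u" "continuous_on {0..1} v"
    and lu: "(\<lambda>k. L2_norm N (\<lambda>t. piecewise_const (n k) (K k) t - u t)) \<longlonglongrightarrow> 0"
    and lv: "(\<lambda>k. L2_norm N (\<lambda>t. piecewise_const (n k) (K k) t - v t)) \<longlonglongrightarrow> 0"
    and t: "t \<in> {0..1}"
  shows "u t = v t"
proof -
  let ?\<mu> = "lebesgue_on {0..1::real}"
  define I where "I = integral\<^sup>L ?\<mu> (\<lambda>t. (N (u t - v t))\<^sup>2)"
  have le: "I \<le> 2 * (L2_norm N (\<lambda>t. piecewise_const (n k) (K k) t - u t))\<^sup>2 + 2 * (L2_norm N (\<lambda>t. piecewise_const (n k) (K k) t - v t))\<^sup>2" for k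
  proof -
    let ?p = "piecewise_const (n k) (K k)"
    have int: "integrable ?\<mu> (\<lambda>t. (N (?p t - w t))\<^sup>2)" if "continuous_on {0..1} w" for w
      by (intro L2_space_is_norm_sq[OF N] L2_space_diff piecewise_const_L2_space continuous_on_imp_L2_space that)
    have "I \<le> integral\<^sup>L ?\<mu> (\<lambda>t. 2 * (N (?p t - u t))\<^sup>2 + 2 * (N (?p t - v t))\<^sup>2)"
      unfolding I_def
    proof (rule integral_mono)
      show "integrable ?\<mu> (\<lambda>t. (N (u t - v t))\<^sup>2)"
        by (intro L2_space_is_norm_sq[OF N] L2_space_diff continuous_on_imp_L2_space uv)
      show "integrable ?\<mu> (\<lambda>t. 2 * (N (?p t - u t))\<^sup>2 + 2 * (N (?p t - v t))\<^sup>2)"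
        using int[OF uv(1)] int[OF uv(2)] by simp
      fix t
      have "N (u t - v t) \<le> N (?p t - v t) + N (?p t - u t)"
        using is_norm_triangle_sub[OF N, of "?p t - v t" "?p t - u t"] by simp
      then have "(N (u t - v t))\<^sup>2 \<le> (N (?p t - v t) + N (?p t - u t))\<^sup>2"
        by (intro power_mono is_norm_nonneg[OF N])
      also have "\<dots> \<le> 2 * (N (?p t - u t))\<^sup>2 + 2 * (N (?p t - v t))\<^sup>2"
        using sum_squares_bound[of "N (?p t - v t)" "N (?p t - u t)"] by (simp add: power2_sum)
      finally show "(N (u t - v t))\<^sup>2 \<le> 2 * (N (?p t - u t))\<^sup>2 + 2 * (N (?p t - v t))\<^sup>2" .
    qed
    also have "\<dots> = 2 * (L2_norm N (\<lambda>t. ?p t - u t))\<^sup>2 + 2 * (L2_norm N (\<lambda>t. ?p t - v t))\<^sup>2"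
      using int[OF uv(1)] int[OF uv(2)] by (simp add: L2_norm_sq)
    finally show ?thesis .
  qed
  have "(\<lambda>k. 2 * (L2_norm N (\<lambda>t. piecewise_const (n k) (K k) t - u t))\<^sup>2 + 2 * (L2_norm N (\<lambda>t. piecewise_const (n k) (K k) t - v t))\<^sup>2)
      \<longlonglongrightarrow> 2 * 0\<^sup>2 + 2 * 0\<^sup>2" by (intro tendsto_intros lu lv)
  then have "I \<le> 0" using le by (intro LIMSEQ_le_const) auto
  moreover have "I \<ge> 0" unfolding I_def by (intro integral_nonneg_AE) simp
  ultimately have "I = 0" by simp
  moreover have "continuous_on {0..1} (\<lambda>t. (N (u t - v t))\<^sup>2)"
    by (intro continuous_intros continuous_on_compose2[OF is_norm_continuous_on[OF N, of UNIV]] uv) auto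
  ultimately have "(N (u t - v t))\<^sup>2 = 0"
    using integralL_eq_0_iff[of 0 1 "\<lambda>t. (N (u t - v t))\<^sup>2"] t by (simp add: I_def)
  then show ?thesis by (simp add: is_norm_eq_0[OF N])
qed

text \<open>Testing sees only the unit interval, so the predicates \<open>has_weak_deriv u\<close>
  and \<open>has_weak_deriv v\<close> are the same function and the choice operator selects the same
  derivative for both.\<close>

lemma continuum_reg_cong:
  assumes "\<And>t. t \<in> {0..1} \<Longrightarrow> u t = v t"
  shows "continuum_reg N \<tau> u = continuum_reg N \<tau> v"
proof -
  have "integral\<^sup>L (lebesgue_on {0..1}) (\<lambda>t. deriv \<phi> t *\<^sub>R u t) = integral\<^sup>L (lebesgue_on {0..1}) (\<lambda>t. deriv \<phi> t *\<^sub>R v t)" for \<phi>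
    by (rule Bochner_Integration.integral_cong) (use assms in \<open>auto simp: space_restrict_space\<close>)
  then have "has_weak_deriv u = has_weak_deriv v" by (auto simp: has_weak_deriv_def fun_eq_iff)
  then show ?thesis using assms[of 0] by (simp add: continuum_reg_def weak_deriv_def)
qed

lemma grid_converges_cong:
  assumes "\<And>t. t \<in> {0..1} \<Longrightarrow> u t = v t"
  shows "grid_converges n K u \<longleftrightarrow> grid_converges n K v"
proof -
  have "u (real i / real m) = v (real i / real m)" if "i < m" for i m :: nat
    using that by (intro assms) auto
  then show ?thesis unfolding grid_converges_def by (simp cong: imp_cong)
qed

section \<open>Minimisers, compactness and convergence of the energies\<close>

lemma grid_converges_subseq:
  assumes "grid_converges n K u" "strict_mono q"
  shows "grid_converges (\<lambda>k. n (q k)) (\<lambda>k. K (q k)) u"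
  unfolding grid_converges_def
proof (intro allI impI)
  fix e :: real assume "e > 0"
  then have "\<forall>\<^sub>F k in sequentially. \<forall>i<n k. norm (K k i - u (real i / real (n k))) < e"
    using assms(1) by (simp add: grid_converges_def)
  then show "\<forall>\<^sub>F k in sequentially. \<forall>i<n (q k). norm (K (q k) i - u (real i / real (n (q k)))) < e"
    by (rule eventually_subseq[OF assms(2)])
qed

lemma tendsto_subseq: "f \<longlonglongrightarrow> l \<Longrightarrow> strict_mono q \<Longrightarrow> (\<lambda>k. f (q k)) \<longlonglongrightarrow> l"
  using LIMSEQ_subseq_LIMSEQ by (fastforce simp: o_def)

lemma H1_space_continuous_on: "u \<in> H1_space \<Longrightarrow> continuous_on {0..1} u"
  by (simp add: H1_space_def)

lemma discrete_reg_nonneg: "\<tau> \<ge> 0 \<Longrightarrow> discrete_reg N \<tau> n K \<ge> 0"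
  using increment_energy_nonneg[of N n K] by (simp add: discrete_reg_eq)

locale resnet_setting =
  fixes P :: "('d::finite, 'm::finite) resnet" and C :: real
  assumes norms: "is_norm (norm_d P)" "is_norm (norm_dd P)" "is_norm (norm_md P)" "is_norm (norm_m P)"
    and alpha: "alpha P 1 > 0" "alpha P 2 > 0" "alpha P 3 > 0" "alpha P 4 > 0"
    and tau: "tau P 1 > 0" "tau P 2 > 0"
    and outmap: "continuous_on UNIV (outmap P)"
    and act: "C-lipschitz_on UNIV (act P)"
    and loss_nonneg: "\<And>z y. loss P z y \<ge> 0"
    and loss_continuous: "\<And>y. continuous_on UNIV (\<lambda>z. loss P z y)"
begin

abbreviation loss_term where "loss_term n K b W c \<equiv>
  (\<Sum>s = 1..num_data P. loss P (outmap P (W *v layer (act P) n K b (xdata P s) n + c)) (ydata P s))"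

text \<open>Coercivity: all summands of the energy are nonnegative, so each one alone is at most
  \<open>M\<close>, and the weights are positive.\<close>

lemma energy_n_bounds:
  assumes "energy_n P n (K, b, W, c) \<le> M"
  shows "discrete_reg (norm_dd P) (tau P 1) n K \<le> M / alpha P 1"
    and "discrete_reg (norm_d P) (tau P 2) n b \<le> M / alpha P 2"
    and "norm_md P W \<le> sqrt (M / alpha P 3)" and "norm_m P c \<le> sqrt (M / alpha P 4)"
proof -
  have nn: "loss_term n K b W c \<ge> 0" "alpha P 1 * discrete_reg (norm_dd P) (tau P 1) n K \<ge> 0"
    "alpha P 2 * discrete_reg (norm_d P) (tau P 2) n b \<ge> 0" "alpha P 3 * (norm_md P W)\<^sup>2 \<ge> 0" "alpha P 4 * (norm_m P c)\<^sup>2 \<ge> 0"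
    using alpha tau by (auto intro!: sum_nonneg loss_nonneg mult_nonneg_nonneg discrete_reg_nonneg)
  then have *: "alpha P 1 * discrete_reg (norm_dd P) (tau P 1) n K \<le> M"
    "alpha P 2 * discrete_reg (norm_d P) (tau P 2) n b \<le> M"
    "alpha P 3 * (norm_md P W)\<^sup>2 \<le> M" "alpha P 4 * (norm_m P c)\<^sup>2 \<le> M"
    using assms unfolding energy_n.simps by linarith+
  then show "discrete_reg (norm_dd P) (tau P 1) n K \<le> M / alpha P 1"
    "discrete_reg (norm_d P) (tau P 2) n b \<le> M / alpha P 2"
    using alpha by (simp_all add: pos_le_divide_eq mult.commute)
  show "norm_md P W \<le> sqrt (M / alpha P 3)" "norm_m P c \<le> sqrt (M / alpha P 4)"
    using * alpha by (auto intro!: real_le_rsqrt simp: pos_le_divide_eq mult.commute)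
qed

text \<open>Continuity refers to the product topology on sequences, of which a layer reads finitely
  many coordinates. The spare component of type \<open>'x\<close> lets the statement apply to the
  full parameter tuple.\<close>

lemma continuous_on_layer:
  "continuous_on UNIV (\<lambda>\<theta>::(nat \<Rightarrow> real^'d^'d) \<times> (nat \<Rightarrow> real^'d) \<times> 'x::topological_space. layer (act P) n (fst \<theta>) (fst (snd \<theta>)) x j)"
proof (induction j)
  case (Suc j)
  have "continuous_on UNIV (\<lambda>\<theta>::(nat \<Rightarrow> real^'d^'d) \<times> (nat \<Rightarrow> real^'d) \<times> 'x. fst \<theta> j)"
    "continuous_on UNIV (\<lambda>\<theta>::(nat \<Rightarrow> real^'d^'d) \<times> (nat \<Rightarrow> real^'d) \<times> 'x. fst (snd \<theta>) j)"
    by (rule continuous_on_product_then_coordinatewise, intro continuous_on_fst continuous_on_snd continuous_on_id)+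
  then show ?case using Suc
    by (auto intro!: continuous_intros continuous_on_compose2[OF lipschitz_on_continuous_on[OF act]] continuous_on_matrix_vector_mult)
qed simp

lemma continuous_on_energy_n: "continuous_on UNIV (energy_n P n)"
proof -
  have coord: "continuous_on UNIV (\<lambda>\<theta>::('d, 'm) discrete_param. fst \<theta> i)"
    "continuous_on UNIV (\<lambda>\<theta>::('d, 'm) discrete_param. fst (snd \<theta>) i)" for i
    by (rule continuous_on_product_then_coordinatewise, intro continuous_on_fst continuous_on_snd continuous_on_id)+
  note N = continuous_on_compose2[OF is_norm_continuous_on[OF norms(1), of UNIV]]
    continuous_on_compose2[OF is_norm_continuous_on[OF norms(2), of UNIV]]
    continuous_on_compose2[OF is_norm_continuous_on[OF norms(3), of UNIV]]
    continuous_on_compose2[OF is_norm_continuous_on[OF norms(4), of UNIV]]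
  have "continuous_on UNIV (\<lambda>\<theta>. energy_n P n (fst \<theta>, fst (snd \<theta>), fst (snd (snd \<theta>)), snd (snd (snd \<theta>))))"
    unfolding energy_n.simps discrete_reg_def
    by (intro continuous_on_add continuous_on_sum continuous_on_mult continuous_on_const continuous_on_power
        continuous_on_compose2[OF loss_continuous] continuous_on_compose2[OF outmap] N
        continuous_on_matrix_vector_mult continuous_on_layer continuous_on_diff coord
        continuous_on_fst continuous_on_snd continuous_on_id subset_UNIV)
  then show ?thesis by simp
qed

lemma energy_n_minimiser:
  assumes n: "n \<ge> 1"
  shows "\<exists>\<theta>\<in>Theta_n n. \<forall>\<theta>'\<in>Theta_n n. energy_n P n \<theta> \<le> energy_n P n \<theta>'"
proof -
  \<comment> \<open>The zero network fixes a level \<open>M\<close>; every parameter of energy at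
    most \<open>M\<close> lies in the compact box \<open>S\<close> defined below.\<close>
  define \<theta>0 :: "('d, 'm) discrete_param" where "\<theta>0 = (\<lambda>i\<in>{..<n}. 0, \<lambda>i\<in>{..<n}. 0, 0, 0)"
  have \<theta>0: "\<theta>0 \<in> Theta_n n" by (auto simp: \<theta>0_def Theta_n_def)
  define M where "M = energy_n P n \<theta>0"
  obtain C1 where C1: "C1 > 0" "\<And>v. norm v \<le> C1 * norm_dd P v" using is_norm_lower[OF norms(2)] by blast
  obtain C2 where C2: "C2 > 0" "\<And>v. norm v \<le> C2 * norm_d P v" using is_norm_lower[OF norms(1)] by blast
  obtain C3 where C3: "C3 > 0" "\<And>v. norm v \<le> C3 * norm_md P v" using is_norm_lower[OF norms(3)] by blast
  obtain C4 where C4: "C4 > 0" "\<And>v. norm v \<le> C4 * norm_m P v" using is_norm_lower[OF norms(4)] by blast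
  define R1 where "R1 = C1 * (sqrt (M / alpha P 1) + sqrt (M / alpha P 1 / tau P 1))"
  define R2 where "R2 = C2 * (sqrt (M / alpha P 2) + sqrt (M / alpha P 2 / tau P 2))"
  define R3 where "R3 = C3 * sqrt (M / alpha P 3)"
  define R4 where "R4 = C4 * sqrt (M / alpha P 4)"
  define S :: "('d, 'm) discrete_param set" where
    "S = ({..<n} \<rightarrow>\<^sub>E cball 0 R1) \<times> ({..<n} \<rightarrow>\<^sub>E cball 0 R2) \<times> cball 0 R3 \<times> cball 0 R4"
  \<comment> \<open>An extensional product over \<open>{..<n}\<close> is a full product whose
    factors at the idle indices are the singleton \<open>{undefined}\<close>, so Tychonoff's theorem
    applies.\<close>
  have cpt: "compact ({..<n} \<rightarrow>\<^sub>E cball (0::'v::euclidean_space) R)" for R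
  proof -
    have "({..<n} \<rightarrow>\<^sub>E cball (0::'v) R) = (\<Pi>\<^sub>E i\<in>UNIV. if i < n then cball 0 R else {undefined})"
    proof (rule set_eqI)
      fix f :: "nat \<Rightarrow> 'v"
      have "f i \<in> (if i < n then cball 0 R else {undefined}) \<longleftrightarrow> (i < n \<longrightarrow> f i \<in> cball 0 R) \<and> (\<not> i < n \<longrightarrow> f i = undefined)" for i
        by simp
      then show "f \<in> ({..<n} \<rightarrow>\<^sub>E cball 0 R) \<longleftrightarrow> f \<in> (\<Pi>\<^sub>E i\<in>UNIV. if i < n then cball 0 R else {undefined})"
        unfolding PiE_iff extensional_def by (simp only: lessThan_iff mem_Collect_eq UNIV_I ball_UNIV Ball_def) blast
    qed
    moreover have "compactin (product_topology (\<lambda>_. euclidean) UNIV) (\<Pi>\<^sub>E i\<in>UNIV. if i < n then cball (0::'v) R else {undefined})"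
      by (subst compactin_PiE) auto
    ultimately show ?thesis by (simp add: euclidean_product_topology)
  qed
  have in_S: "\<theta> \<in> S" if "\<theta> \<in> Theta_n n" "energy_n P n \<theta> \<le> M" for \<theta>
  proof -
    obtain K b W c where \<theta>: "\<theta> = (K, b, W, c)" by (cases \<theta>)
    note bd = energy_n_bounds[OF that(2)[unfolded \<theta>]]
    have "norm (K i) \<le> R1" "norm (b i) \<le> R2" if "i < n" for i
      using order_trans[OF C1(2) mult_left_mono[OF discrete_reg_bounds(2)[OF norms(2) n tau(1) bd(1) that]]]
        order_trans[OF C2(2) mult_left_mono[OF discrete_reg_bounds(2)[OF norms(1) n tau(2) bd(2) that]]] C1(1) C2(1)
      by (auto simp: R1_def R2_def)
    moreover have "norm W \<le> R3" "norm c \<le> R4"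
      using order_trans[OF C3(2) mult_left_mono[OF bd(3)]] order_trans[OF C4(2) mult_left_mono[OF bd(4)]] C3(1) C4(1)
      by (auto simp: R3_def R4_def)
    ultimately show ?thesis using that(1) by (auto simp: S_def Theta_n_def \<theta> PiE_iff)
  qed
  have "compact S" unfolding S_def by (intro compact_Times cpt compact_cball)
  moreover have "\<theta>0 \<in> S" using in_S \<theta>0 by (simp add: M_def)
  ultimately obtain \<theta> where \<theta>: "\<theta> \<in> S" "\<And>\<theta>'. \<theta>' \<in> S \<Longrightarrow> energy_n P n \<theta> \<le> energy_n P n \<theta>'"
    using continuous_attains_inf[of S "energy_n P n"] continuous_on_subset[OF continuous_on_energy_n] by blast
  have "\<theta> \<in> Theta_n n" using \<theta>(1) by (auto simp: S_def Theta_n_def PiE_iff)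
  moreover have "energy_n P n \<theta> \<le> energy_n P n \<theta>'" if "\<theta>' \<in> Theta_n n" for \<theta>'
  proof (cases "energy_n P n \<theta>' \<le> M")
    case True
    then show ?thesis using \<theta>(2) in_S that by blast
  next
    case False
    then show ?thesis using \<theta>(2)[OF \<open>\<theta>0 \<in> S\<close>] by (simp add: M_def)
  qed
  ultimately show ?thesis by blast
qed

text \<open>Common source of compactness and of the lower bound. Subsequences are extracted in turn
  for \<open>K\<close>, for \<open>b\<close> and for the pair \<open>(W, c)\<close>; each property
  already gained survives the later extractions.\<close>

lemma energy_bounded_subsequence:
  fixes \<theta> :: "nat \<Rightarrow> ('d, 'm) discrete_param"
  assumes n: "filterlim n at_top sequentially" "\<And>k. n k \<ge> 1"
    and \<theta>: "\<And>k. \<theta> k = (K k, b k, W k, c k)"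
    and M: "\<And>k. energy_n P (n k) (\<theta> k) \<le> M"
  obtains q :: "nat \<Rightarrow> nat" and u v W' c' \<rho>1 \<rho>2 where "strict_mono q" "u \<in> H1_space" "v \<in> H1_space"
    "grid_converges (\<lambda>k. n (q k)) (\<lambda>k. K (q k)) u" "grid_converges (\<lambda>k. n (q k)) (\<lambda>k. b (q k)) v"
    "(\<lambda>k. W (q k)) \<longlonglongrightarrow> W'" "(\<lambda>k. c (q k)) \<longlonglongrightarrow> c'"
    "(\<lambda>k. discrete_reg (norm_dd P) (tau P 1) (n (q k)) (K (q k))) \<longlonglongrightarrow> \<rho>1"
    "(\<lambda>k. discrete_reg (norm_d P) (tau P 2) (n (q k)) (b (q k))) \<longlonglongrightarrow> \<rho>2"
    "continuum_reg (norm_dd P) (tau P 1) u \<le> \<rho>1" "continuum_reg (norm_d P) (tau P 2) v \<le> \<rho>2"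
proof -
  note bd = energy_n_bounds[OF M[unfolded \<theta>]]
  obtain q1 :: "nat \<Rightarrow> nat" and u \<rho>1 where q1: "strict_mono q1" and u: "u \<in> H1_space"
    "grid_converges (\<lambda>k. n (q1 k)) (\<lambda>k. K (q1 k)) u"
    "(\<lambda>k. discrete_reg (norm_dd P) (tau P 1) (n (q1 k)) (K (q1 k))) \<longlonglongrightarrow> \<rho>1"
    "continuum_reg (norm_dd P) (tau P 1) u \<le> \<rho>1"
    using discrete_reg_compactness[OF norms(2) tau(1) n bd(1)] by blast
  have n1: "filterlim (\<lambda>k. n (q1 k)) at_top sequentially"
    using filterlim_compose[OF n(1) filterlim_subseq[OF q1]] by (simp add: o_def)
  obtain q2 :: "nat \<Rightarrow> nat" and v \<rho>2 where q2: "strict_mono q2" and v: "v \<in> H1_space"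
    "grid_converges (\<lambda>k. n (q1 (q2 k))) (\<lambda>k. b (q1 (q2 k))) v"
    "(\<lambda>k. discrete_reg (norm_d P) (tau P 2) (n (q1 (q2 k))) (b (q1 (q2 k)))) \<longlonglongrightarrow> \<rho>2"
    "continuum_reg (norm_d P) (tau P 2) v \<le> \<rho>2"
    using discrete_reg_compactness[of _ _ "\<lambda>k. n (q1 k)" "\<lambda>k. b (q1 k)", OF norms(1) tau(2) n1 n(2) bd(2)] by blast
  obtain C3 where C3: "C3 > 0" "\<And>v. norm v \<le> C3 * norm_md P v" using is_norm_lower[OF norms(3)] by blast
  obtain C4 where C4: "C4 > 0" "\<And>v. norm v \<le> C4 * norm_m P v" using is_norm_lower[OF norms(4)] by blast
  let ?S = "cball (0::real^'d^'m) (C3 * sqrt (M / alpha P 3)) \<times> cball (0::real^'m) (C4 * sqrt (M / alpha P 4))"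
  have cpt: "compact ?S" by (intro compact_Times compact_cball)
  have mem: "(W (q1 (q2 k)), c (q1 (q2 k))) \<in> ?S" for k
    using order_trans[OF C3(2) mult_left_mono[OF bd(3)]] order_trans[OF C4(2) mult_left_mono[OF bd(4)]] C3(1) C4(1)
    by auto
  obtain l and q3 :: "nat \<Rightarrow> nat" where q3: "strict_mono q3" and l: "((\<lambda>k. (W (q1 (q2 k)), c (q1 (q2 k)))) \<circ> q3) \<longlonglongrightarrow> l"
    by (rule seq_compactE[OF compact_imp_seq_compact[OF cpt], of "\<lambda>k. (W (q1 (q2 k)), c (q1 (q2 k)))"])
      (use mem in blast)+
  obtain W' c' where "l = (W', c')" by (cases l)
  with l have Wc: "(\<lambda>k. (W (q1 (q2 (q3 k))), c (q1 (q2 (q3 k))))) \<longlonglongrightarrow> (W', c')" by (simp add: o_def)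
  define q where "q k = q1 (q2 (q3 k))" for k
  have q23: "strict_mono (\<lambda>k. q2 (q3 k))" using q2 q3 by (simp add: strict_mono_def)
  show ?thesis
  proof (rule that[of q u v W' c' \<rho>1 \<rho>2])
    show "strict_mono q" using q1 q23 by (simp add: strict_mono_def q_def)
    show "grid_converges (\<lambda>k. n (q k)) (\<lambda>k. K (q k)) u" unfolding q_def by (rule grid_converges_subseq[OF u(2) q23])
    show "grid_converges (\<lambda>k. n (q k)) (\<lambda>k. b (q k)) v" unfolding q_def by (rule grid_converges_subseq[OF v(2) q3])
    show "(\<lambda>k. W (q k)) \<longlonglongrightarrow> W'" "(\<lambda>k. c (q k)) \<longlonglongrightarrow> c'"
      using tendsto_fst[OF Wc] tendsto_snd[OF Wc] by (simp_all add: q_def)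
    show "(\<lambda>k. discrete_reg (norm_dd P) (tau P 1) (n (q k)) (K (q k))) \<longlonglongrightarrow> \<rho>1"
      unfolding q_def by (rule tendsto_subseq[OF u(3) q23])
    show "(\<lambda>k. discrete_reg (norm_d P) (tau P 2) (n (q k)) (b (q k))) \<longlonglongrightarrow> \<rho>2"
      unfolding q_def by (rule tendsto_subseq[OF v(3) q3])
  qed (use u v in auto)
qed

section \<open>Convergence of parameters and of the loss\<close>

lemma param_dist_tendsto:
  assumes n: "filterlim n at_top sequentially"
    and u: "continuous_on {0..1} u" "grid_converges n K u" and v: "continuous_on {0..1} v" "grid_converges n b v"
    and W: "W \<longlonglongrightarrow> W'" and c: "c \<longlonglongrightarrow> c'"
  shows "(\<lambda>k. param_dist P (n k) (K k, b k, W k, c k) (u, v, W', c')) \<longlonglongrightarrow> 0"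
proof -
  have "(\<lambda>k. param_dist P (n k) (K k, b k, W k, c k) (u, v, W', c')) \<longlonglongrightarrow> 0 + 0 + 0 + 0"
    unfolding param_dist.simps
    by (intro tendsto_add grid_converges_imp_L2_norm_tendsto norms n u v
        is_norm_tendsto_0_iff[OF norms(3), THEN iffD2] is_norm_tendsto_0_iff[OF norms(4), THEN iffD2] W c)
  then show ?thesis by simp
qed

lemma param_dist_tendstoD:
  assumes "(\<lambda>k. param_dist P (n k) (K k, b k, W k, c k) (u, v, W', c')) \<longlonglongrightarrow> 0"
  shows "(\<lambda>k. L2_norm (norm_dd P) (\<lambda>t. piecewise_const (n k) (K k) t - u t)) \<longlonglongrightarrow> 0"
    and "(\<lambda>k. L2_norm (norm_d P) (\<lambda>t. piecewise_const (n k) (b k) t - v t)) \<longlonglongrightarrow> 0"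
    and "W \<longlonglongrightarrow> W'" and "c \<longlonglongrightarrow> c'"
proof -
  have nn: "L2_norm N f \<ge> 0" for N :: "'x::euclidean_space \<Rightarrow> real" and f
    unfolding L2_norm_def by (intro real_sqrt_ge_zero integral_nonneg_AE) simp
  have nns: "norm_md P w \<ge> 0" "norm_m P z \<ge> 0" for w z using is_norm_nonneg norms by blast+
  have *: "f \<longlonglongrightarrow> 0" if "\<And>k. 0 \<le> f k" "\<And>k. f k \<le> param_dist P (n k) (K k, b k, W k, c k) (u, v, W', c')" for f
    by (rule tendsto_sandwich[OF _ _ tendsto_const assms]) (use that in auto)
  show "(\<lambda>k. L2_norm (norm_dd P) (\<lambda>t. piecewise_const (n k) (K k) t - u t)) \<longlonglongrightarrow> 0"
    "(\<lambda>k. L2_norm (norm_d P) (\<lambda>t. piecewise_const (n k) (b k) t - v t)) \<longlonglongrightarrow> 0"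
    by (rule *; simp add: nn nns)+
  have "(\<lambda>k. norm_md P (W k - W')) \<longlonglongrightarrow> 0" "(\<lambda>k. norm_m P (c k - c')) \<longlonglongrightarrow> 0"
    by (rule *; simp add: nn nns)+
  then show "W \<longlonglongrightarrow> W'" "c \<longlonglongrightarrow> c'"
    using is_norm_tendsto_0_iff[OF norms(3)] is_norm_tendsto_0_iff[OF norms(4)] by blast+
qed

lemma loss_term_tendsto:
  assumes n: "filterlim n at_top sequentially"
    and u: "continuous_on {0..1} u" "grid_converges n K u" and v: "continuous_on {0..1} v" "grid_converges n b v"
    and W: "W \<longlonglongrightarrow> W'" and c: "c \<longlonglongrightarrow> c'"
  shows "(\<lambda>k. loss_term (n k) (K k) (b k) (W k) (c k)) \<longlonglongrightarrow>
    (\<Sum>s = 1..num_data P. loss P (outmap P (W' *v flow (act P) u v (xdata P s) 1 + c')) (ydata P s))"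
  by (intro tendsto_sum continuous_on_tendsto_compose[OF loss_continuous] continuous_on_tendsto_compose[OF outmap]
      tendsto_add tendsto_matrix_vector_mult layer_tendsto_flow[OF act] n u v W c always_eventually allI UNIV_I)

lemma energy_bounded_relatively_compact:
  assumes bdd: "bdd_above ((\<lambda>n. energy_n P n (\<theta> n)) ` {1..})"
    and r: "strict_mono (r :: nat \<Rightarrow> nat)"
  shows "\<exists>q :: nat \<Rightarrow> nat. strict_mono q \<and> (\<exists>\<theta>'\<in>Theta. (\<lambda>k. param_dist P (r (q k)) (\<theta> (r (q k))) \<theta>') \<longlonglongrightarrow> 0)"
proof -
  obtain M where M: "\<And>n. n \<ge> 1 \<Longrightarrow> energy_n P n (\<theta> n) \<le> M"
    using bdd by (force simp: bdd_above_def)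
  \<comment> \<open>The shift skips \<open>r 0\<close>, which may be 0, an index for which the
    energy bound is not assumed.\<close>
  define n where "n k = r (Suc k)" for k
  have n1: "n k \<ge> 1" for k using strict_mono_imp_increasing[OF r, of "Suc k"] by (simp add: n_def)
  have nmono: "strict_mono n" using r by (simp add: strict_mono_def n_def)
  have nlim: "filterlim n at_top sequentially" by (rule filterlim_subseq[OF nmono])
  define K b W c where "K k = fst (\<theta> (n k))" and "b k = fst (snd (\<theta> (n k)))"
    and "W k = fst (snd (snd (\<theta> (n k))))" and "c k = snd (snd (snd (\<theta> (n k))))" for k
  have eq: "\<theta> (n k) = (K k, b k, W k, c k)" for k by (simp add: K_def b_def W_def c_def)
  obtain q u v W' c' where q: "strict_mono q" and uv: "u \<in> H1_space" "v \<in> H1_space"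
    "grid_converges (\<lambda>k. n (q k)) (\<lambda>k. K (q k)) u" "grid_converges (\<lambda>k. n (q k)) (\<lambda>k. b (q k)) v"
    "(\<lambda>k. W (q k)) \<longlonglongrightarrow> W'" "(\<lambda>k. c (q k)) \<longlonglongrightarrow> c'"
    by (rule energy_bounded_subsequence[OF nlim n1 eq M[OF n1]]) blast
  have nq: "filterlim (\<lambda>k. n (q k)) at_top sequentially"
    using filterlim_compose[OF nlim filterlim_subseq[OF q]] by (simp add: o_def)
  have "(\<lambda>k. param_dist P (n (q k)) (K (q k), b (q k), W (q k), c (q k)) (u, v, W', c')) \<longlonglongrightarrow> 0"
    by (rule param_dist_tendsto[OF nq]) (use uv in \<open>auto intro: H1_space_continuous_on\<close>)
  then have "(\<lambda>k. param_dist P (r (Suc (q k))) (\<theta> (r (Suc (q k)))) (u, v, W', c')) \<longlonglongrightarrow> 0"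
    unfolding eq[symmetric] by (simp add: n_def)
  moreover have "strict_mono (\<lambda>k. Suc (q k))" using q by (simp add: strict_mono_def)
  moreover have "(u, v, W', c') \<in> Theta" using uv by (simp add: Theta_def)
  ultimately show ?thesis by (intro exI[of _ "\<lambda>k. Suc (q k)"]) blast
qed

text \<open>If the bound failed, infinitely many energies would lie below a level strictly smaller
  than the limit energy. Along these indices the energy is bounded, so compactness applies and
  forces the limit energy below the level.\<close>

lemma energy_liminf:
  assumes \<theta>: "\<theta> \<in> Theta" and conv: "(\<lambda>n. param_dist P n (\<theta>n n) \<theta>) \<longlonglongrightarrow> 0"
  shows "ereal (energy_infinity P \<theta>) \<le> liminf (\<lambda>n. ereal (energy_n P n (\<theta>n n)))"
proof (rule ccontr)
  assume "\<not> ?thesis"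
  then obtain y where y: "y < ereal (energy_infinity P \<theta>)"
    "\<not> eventually (\<lambda>n. y < ereal (energy_n P n (\<theta>n n))) sequentially"
    by (auto simp: le_Liminf_iff)
  have "frequently (\<lambda>n. ereal (energy_n P n (\<theta>n n)) \<le> y) sequentially"
    using y(2) by (simp add: frequently_def not_le)
  then have "frequently (\<lambda>n. ereal (energy_n P n (\<theta>n n)) \<le> y \<and> n \<ge> 1) sequentially"
    using eventually_ge_at_top[of "1::nat"] by (rule frequently_eventually_frequently)
  then have "infinite {n. ereal (energy_n P n (\<theta>n n)) \<le> y \<and> n \<ge> 1}"
    by (simp add: frequently_cofinite flip: cofinite_eq_sequentially)
  from infinite_enumerate[OF this] obtain n :: "nat \<Rightarrow> nat" where mono: "strict_mono n"
    and mem: "\<And>k. n k \<in> {n. ereal (energy_n P n (\<theta>n n)) \<le> y \<and> n \<ge> 1}" by blast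
  have n: "strict_mono n" "\<And>k. ereal (energy_n P (n k) (\<theta>n (n k))) \<le> y" "\<And>k. n k \<ge> 1"
    using mono mem by simp_all
  \<comment> \<open>The level is finite: real energies lie below it, and the real limit energy lies
    above it.\<close>
  obtain L where L: "y = ereal L" using n(2)[of 0] y(1) by (cases y) auto
  have nlim: "filterlim n at_top sequentially" by (rule filterlim_subseq[OF n(1)])
  obtain u0 v0 W0 c0 where \<theta>eq: "\<theta> = (u0, v0, W0, c0)" by (cases \<theta>)
  have uv0: "u0 \<in> H1_space" "v0 \<in> H1_space" using \<theta> by (auto simp: \<theta>eq Theta_def)
  note c0 = H1_space_continuous_on[OF uv0(1)] H1_space_continuous_on[OF uv0(2)]
  define K b W c where "K k = fst (\<theta>n (n k))" and "b k = fst (snd (\<theta>n (n k)))"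
    and "W k = fst (snd (snd (\<theta>n (n k))))" and "c k = snd (snd (snd (\<theta>n (n k))))" for k
  have eq: "\<theta>n (n k) = (K k, b k, W k, c k)" for k by (simp add: K_def b_def W_def c_def)
  have le: "energy_n P (n k) (\<theta>n (n k)) \<le> L" for k using n(2)[of k] by (simp add: L)
  obtain q u v W' c' \<rho>1 \<rho>2 where q: "strict_mono q" and uv: "u \<in> H1_space" "v \<in> H1_space"
    "grid_converges (\<lambda>k. n (q k)) (\<lambda>k. K (q k)) u" "grid_converges (\<lambda>k. n (q k)) (\<lambda>k. b (q k)) v"
    and reg: "(\<lambda>k. discrete_reg (norm_dd P) (tau P 1) (n (q k)) (K (q k))) \<longlonglongrightarrow> \<rho>1"
    "(\<lambda>k. discrete_reg (norm_d P) (tau P 2) (n (q k)) (b (q k))) \<longlonglongrightarrow> \<rho>2"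
    and \<rho>: "continuum_reg (norm_dd P) (tau P 1) u \<le> \<rho>1" "continuum_reg (norm_d P) (tau P 2) v \<le> \<rho>2"
    by (rule energy_bounded_subsequence[OF nlim n(3) eq le]) blast
  have nq: "filterlim (\<lambda>k. n (q k)) at_top sequentially"
    using filterlim_compose[OF nlim filterlim_subseq[OF q]] by (simp add: o_def)
  have "strict_mono (\<lambda>k. n (q k))" using n(1) q by (simp add: strict_mono_def)
  from tendsto_subseq[OF conv this]
  have "(\<lambda>k. param_dist P (n (q k)) (K (q k), b (q k), W (q k), c (q k)) (u0, v0, W0, c0)) \<longlonglongrightarrow> 0"
    by (simp add: eq \<theta>eq)
  note d = param_dist_tendstoD[OF this]
  \<comment> \<open>Compactness gives grid convergence to some \<open>u\<close>, the hypothesis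
    \<open>L\<^sup>2\<close> convergence to \<open>u0\<close>. Their equality transfers grid
    convergence, and with it the limit of the loss, as well as the regulariser bound to
    \<open>u0\<close>.\<close>
  have ueq: "u t = u0 t" if "t \<in> {0..1}" for t
    using L2_limit_unique[OF norms(2) H1_space_continuous_on[OF uv(1)] c0(1)
        grid_converges_imp_L2_norm_tendsto[OF norms(2) nq H1_space_continuous_on[OF uv(1)] uv(3)] d(1) that] .
  have veq: "v t = v0 t" if "t \<in> {0..1}" for t
    using L2_limit_unique[OF norms(1) H1_space_continuous_on[OF uv(2)] c0(2)
        grid_converges_imp_L2_norm_tendsto[OF norms(1) nq H1_space_continuous_on[OF uv(2)] uv(4)] d(2) that] .
  have g: "grid_converges (\<lambda>k. n (q k)) (\<lambda>k. K (q k)) u0" "grid_converges (\<lambda>k. n (q k)) (\<lambda>k. b (q k)) v0"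
    using uv(3,4) grid_converges_cong[of u u0] grid_converges_cong[of v v0] ueq veq by metis+
  have \<rho>0: "continuum_reg (norm_dd P) (tau P 1) u0 \<le> \<rho>1" "continuum_reg (norm_d P) (tau P 2) v0 \<le> \<rho>2"
    using \<rho> continuum_reg_cong[of u u0] continuum_reg_cong[of v v0] ueq veq by metis+
  let ?loss = "\<Sum>s = 1..num_data P. loss P (outmap P (W0 *v flow (act P) u0 v0 (xdata P s) 1 + c0)) (ydata P s)"
  have "(\<lambda>k. energy_n P (n (q k)) (K (q k), b (q k), W (q k), c (q k))) \<longlonglongrightarrow>
      ?loss + alpha P 1 * \<rho>1 + alpha P 2 * \<rho>2 + alpha P 3 * (norm_md P W0)\<^sup>2 + alpha P 4 * (norm_m P c0)\<^sup>2"
    unfolding energy_n.simps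
    by (intro tendsto_add tendsto_mult tendsto_const tendsto_power reg
        is_norm_tendsto[OF norms(3)] is_norm_tendsto[OF norms(4)] d(3,4)
        loss_term_tendsto[OF nq c0(1) g(1) c0(2) g(2) d(3,4)])
  then have "?loss + alpha P 1 * \<rho>1 + alpha P 2 * \<rho>2 + alpha P 3 * (norm_md P W0)\<^sup>2 + alpha P 4 * (norm_m P c0)\<^sup>2 \<le> L"
    by (rule LIMSEQ_le_const2) (use le in \<open>auto simp flip: eq\<close>)
  moreover have "alpha P 1 * continuum_reg (norm_dd P) (tau P 1) u0 \<le> alpha P 1 * \<rho>1"
    "alpha P 2 * continuum_reg (norm_d P) (tau P 2) v0 \<le> alpha P 2 * \<rho>2"
    using \<rho>0 alpha by (auto intro: mult_left_mono)
  ultimately have "energy_infinity P \<theta> \<le> L" unfolding \<theta>eq energy_infinity.simps by linarith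
  then show False using y(1) by (simp add: L)
qed

lemma energy_limsup:
  assumes \<theta>: "\<theta> \<in> Theta"
  shows "\<exists>\<theta>n. (\<forall>n\<ge>1. \<theta>n n \<in> Theta_n n) \<and> (\<lambda>n. param_dist P n (\<theta>n n) \<theta>) \<longlonglongrightarrow> 0 \<and>
    limsup (\<lambda>n. ereal (energy_n P n (\<theta>n n))) \<le> ereal (energy_infinity P \<theta>)"
proof -
  obtain u v W c where \<theta>eq: "\<theta> = (u, v, W, c)" by (cases \<theta>)
  have uv: "u \<in> H1_space" "v \<in> H1_space" using \<theta> by (auto simp: \<theta>eq Theta_def)
  note cont = H1_space_continuous_on[OF uv(1)] H1_space_continuous_on[OF uv(2)]
  define K where "K n = (\<lambda>i\<in>{..<n}. u (real i / real n))" for n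
  define b where "b n = (\<lambda>i\<in>{..<n}. v (real i / real n))" for n
  define \<theta>n where "\<theta>n n = (K n, b n, W, c)" for n
  \<comment> \<open>The samples equal the limit functions at the grid points, so the grid error is
    exactly zero.\<close>
  have grid: "grid_converges (\<lambda>n. n) K u" "grid_converges (\<lambda>n. n) b v"
    by (auto simp: grid_converges_def K_def b_def)
  have lim: "filterlim (\<lambda>n::nat. n) at_top sequentially" by (rule filterlim_ident)
  let ?loss = "\<Sum>s = 1..num_data P. loss P (outmap P (W *v flow (act P) u v (xdata P s) 1 + c)) (ydata P s)"
  let ?reg = "alpha P 1 * continuum_reg (norm_dd P) (tau P 1) u + alpha P 2 * continuum_reg (norm_d P) (tau P 2) v
    + alpha P 3 * (norm_md P W)\<^sup>2 + alpha P 4 * (norm_m P c)\<^sup>2"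
  have "(\<lambda>n. loss_term n (K n) (b n) W c + ?reg) \<longlonglongrightarrow> ?loss + ?reg"
    by (intro tendsto_add tendsto_const loss_term_tendsto[OF lim cont(1) grid(1) cont(2) grid(2)])
  also have "?loss + ?reg = energy_infinity P \<theta>" by (simp add: \<theta>eq)
  finally have "limsup (\<lambda>n. ereal (loss_term n (K n) (b n) W c + ?reg)) = ereal (energy_infinity P \<theta>)"
    by (intro lim_imp_Limsup) auto
  \<comment> \<open>The discrete regularisers are replaced by the fixed continuum ones, which bound
    them from above. Only the loss still varies with \<open>n\<close>, and it converges.\<close>
  moreover have "limsup (\<lambda>n. ereal (energy_n P n (\<theta>n n))) \<le> limsup (\<lambda>n. ereal (loss_term n (K n) (b n) W c + ?reg))"
  proof (rule Limsup_mono)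
    show "\<forall>\<^sub>F n in sequentially. ereal (energy_n P n (\<theta>n n)) \<le> ereal (loss_term n (K n) (b n) W c + ?reg)"
      using eventually_ge_at_top[of "1::nat"]
    proof eventually_elim
      case (elim n)
      have "discrete_reg (norm_dd P) (tau P 1) n (K n) \<le> continuum_reg (norm_dd P) (tau P 1) u"
        by (rule discrete_reg_sample_le[OF norms(2) uv(1) elim]) (simp add: K_def)
      moreover have "discrete_reg (norm_d P) (tau P 2) n (b n) \<le> continuum_reg (norm_d P) (tau P 2) v"
        by (rule discrete_reg_sample_le[OF norms(1) uv(2) elim]) (simp add: b_def)
      ultimately have "alpha P 1 * discrete_reg (norm_dd P) (tau P 1) n (K n) \<le> alpha P 1 * continuum_reg (norm_dd P) (tau P 1) u"
        "alpha P 2 * discrete_reg (norm_d P) (tau P 2) n (b n) \<le> alpha P 2 * continuum_reg (norm_d P) (tau P 2) v"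
        using alpha by (auto intro: mult_left_mono)
      then show ?case by (simp add: \<theta>n_def)
    qed
  qed
  moreover have "(\<lambda>n. param_dist P n (\<theta>n n) \<theta>) \<longlonglongrightarrow> 0"
    unfolding \<theta>n_def \<theta>eq by (rule param_dist_tendsto[OF lim cont(1) grid(1) cont(2) grid(2)]) auto
  moreover have "\<theta>n n \<in> Theta_n n" for n by (auto simp: \<theta>n_def Theta_n_def K_def b_def)
  ultimately show ?thesis by (intro exI[of _ \<theta>n]) auto
qed

end

theorem theorem4p1:
  fixes P :: "('d::finite, 'm::finite) resnet"
  assumes "num_data P \<ge> 1"
    and "is_norm (norm_d P)" "is_norm (norm_dd P)" "is_norm (norm_md P)" "is_norm (norm_m P)"
    and "\<forall>i\<in>{1..4}. alpha P i > 0" "\<forall>j\<in>{1..2}. tau P j > 0"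
    and "continuous_on UNIV (outmap P)"
    and "\<exists>C. C-lipschitz_on UNIV (act P)" "acts_componentwise (act P)"
    and "act P 0 = 0"
    and "\<forall>z y. loss P z y \<ge> 0" "\<forall>y. continuous_on UNIV (\<lambda>z. loss P z y)"
  shows "(\<forall>n\<ge>1. \<exists>\<theta>\<in>Theta_n n. \<forall>\<theta>'\<in>Theta_n n. energy_n P n \<theta> \<le> energy_n P n \<theta>') \<and>
    (\<forall>\<theta>n. (\<forall>n\<ge>1. \<theta>n n \<in> Theta_n n) \<and> bdd_above ((\<lambda>n. energy_n P n (\<theta>n n)) ` {1..}) \<longrightarrow>
       (\<forall>r :: nat \<Rightarrow> nat. strict_mono r \<longrightarrow>
          (\<exists>q :: nat \<Rightarrow> nat. strict_mono q \<and>
             (\<exists>\<theta>\<in>Theta. (\<lambda>k. param_dist P (r (q k)) (\<theta>n (r (q k))) \<theta>) \<longlonglongrightarrow> 0)))) \<and>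
    Gamma_limit Theta_n Theta (param_dist P) (energy_n P) (energy_infinity P)"
proof -
  obtain C where "C-lipschitz_on UNIV (act P)" using assms(9) by blast
  moreover have "alpha P 1 > 0" "alpha P 2 > 0" "alpha P 3 > 0" "alpha P 4 > 0" "tau P 1 > 0" "tau P 2 > 0"
    using assms(6,7) by simp_all
  ultimately interpret resnet_setting P C
    by unfold_locales (use assms in blast)+
  show ?thesis unfolding Gamma_limit_def
    using energy_n_minimiser energy_bounded_relatively_compact energy_liminf energy_limsup by (intro conjI allI impI ballI) simp_all
qed

end
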